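(* Let $\sigma\in\mathcal S'(\mathbb R)$ be a tempered distribution which vanishes to order $k\ge 0$ at the point $0$. Then its Fourier transform $\widehat\sigma$ can be extended to a distribution on $\mathbb R\cup\{\infty\}$ which vanishes to order $k$ at $\infty$. In particular, if $\sigma$ vanishes to infinite order at $0$, the Fourier transform $\widehat\sigma$ has a canonical extension across $\infty$.
   Context: Distributions on a one-dimensional smooth manifold $M$ (here $M=\mathbb R$, or $\mathbb{RP}^1=\mathbb R\cup\{\infty\}$ with local coordinate $1/x$ near $\infty$) are the dual of the space of compactly supported smooth complex measures; the pairing is written as an integral. Locally $L^1$ functions are distributions, and distributions transform like functions under changes of coordinates. Let $p\in M$. A smooth function vanishes to order $k\ge0$ at $p$ if it lies in the $k$-th power of the ideal of smooth functions vanishing at $p$. A linear differential operator $D$ with $C^\infty$ coefficients on a neighborhood of $p$ is tangential to $\{p\}$ if, for every $k\in\mathbb N$, it maps (germs of) smooth functions vanishing to order $k$ at $p$ to functions vanishing to order $k$ at $p$. A distribution $\sigma$ vanishes to order $k\ge 0$ at $p$ if there is an open neighborhood $U_p$ of $p$ on which $\sigma=\sum_{1\le j\le N} f_jD_jh_j$, with $h_j\in L^\infty_{\rm loc}(U_p)$, $D_j$ differential operators on $U_p$ tangential to $\{p\}$, and $f_j\in C^\infty(U_p)$ vanishing to order $k$ at $p$. It vanishes to infinite order at $p$ if it vanishes to order $k$ for every $k\ge0$. A distribution $\tau$ defined on $M-\{p\}$ has a canonical extension across $p$ if there is a (necessarily unique) distribution on $M$ which agrees with $\tau$ on $M-\{p\}$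 and vanishes to infinite order at $p$. Fourier transform: $\widehat f(y)=\int_{\mathbb R}f(x)e(-xy)\,dx$ with $e(u)=e^{2\pi i u}$ for Schwartz functions $f$, and $\int_{\mathbb R}\widehat\sigma(x)f(x)\,dx=\int_{\mathbb R}\sigma(y)\widehat f(y)\,dy$ for tempered distributions $\sigma$. *)

theory Defs
  imports "HOL-Analysis.Analysis"
begin

subsection \<open>Smooth functions and powers of the ideal of a point\<close>

definition nderiv :: "nat \<Rightarrow> (real \<Rightarrow> complex) \<Rightarrow> real \<Rightarrow> complex" where
  "nderiv n f = ((\<lambda>g x. vector_derivative g (at x)) ^^ n) f"

text \<open>Used for open sets only; the values of the function outside the set are irrelevant.\<close>

definition smooth_on :: "real set \<Rightarrow> (real \<Rightarrow> complex) \<Rightarrow> bool" where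
  "smooth_on U f \<longleftrightarrow> (\<forall>n. \<forall>x\<in>U. nderiv n f differentiable at x)"

text \<open>The power \<open>I ^ k\<close> in the ring of smooth functions on \<open>U\<close>, where \<open>I\<close> is the ideal of
  functions vanishing at \<open>p\<close>: \<open>I ^ 0\<close> is the whole ring, and \<open>I ^ (k + 1)\<close> consists of the
  finite sums of products of an element of \<open>I\<close> and an element of \<open>I ^ k\<close>.\<close>

primrec point_ideal_power :: "real set \<Rightarrow> real \<Rightarrow> nat \<Rightarrow> (real \<Rightarrow> complex) set" where
  "point_ideal_power U p 0 = {f. smooth_on U f}"
| "point_ideal_power U p (Suc k) =
     {f. \<exists>(N::nat) g h.
        (\<forall>j<N. smooth_on U (g j) \<and> g j p = 0 \<and> h j \<in> point_ideal_power U p k) \<and>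
        (\<forall>x\<in>U. f x = (\<Sum>j<N. g j x * h j x))}"

definition fun_vanishes_to_order :: "real set \<Rightarrow> real \<Rightarrow> nat \<Rightarrow> (real \<Rightarrow> complex) \<Rightarrow> bool" where
  "fun_vanishes_to_order U p k f \<longleftrightarrow> f \<in> point_ideal_power U p k"


subsection \<open>Linear differential operators\<close>

text \<open>The list \<open>[a\<^sub>0, \<dots>, a\<^sub>m]\<close> stands for the operator
  \<open>a\<^sub>0 + a\<^sub>1 (d/dx) + \<dots> + a\<^sub>m (d/dx) ^ m\<close>.\<close>

type_synonym diff_op = "(real \<Rightarrow> complex) list"

definition diff_op_on :: "real set \<Rightarrow> diff_op \<Rightarrow> bool" where
  "diff_op_on U D \<longleftrightarrow> (\<forall>a\<in>set D. smooth_on U a)"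

definition apply_op :: "diff_op \<Rightarrow> (real \<Rightarrow> complex) \<Rightarrow> real \<Rightarrow> complex" where
  "apply_op D f x = (\<Sum>i<length D. (D ! i) x * nderiv i f x)"

definition transpose_op :: "diff_op \<Rightarrow> (real \<Rightarrow> complex) \<Rightarrow> real \<Rightarrow> complex" where
  "transpose_op D \<phi> x = (\<Sum>i<length D. (- 1) ^ i * nderiv i (\<lambda>t. (D ! i) t * \<phi> t) x)"

text \<open>A germ at \<open>p\<close> is represented by a function on some open neighbourhood \<open>V\<close> of \<open>p\<close>.\<close>

definition tangential :: "real set \<Rightarrow> real \<Rightarrow> diff_op \<Rightarrow> bool" where
  "tangential U p D \<longleftrightarrow>
     (\<forall>k V f. open V \<and> p \<in> V \<and> V \<subseteq> U \<and> fun_vanishes_to_order V p k f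
        \<longrightarrow> fun_vanishes_to_order V p k (apply_op D f))"


subsection \<open>Distributions on open subsets of the real line\<close>

text \<open>Using the coordinate \<open>x\<close> of the line, the compactly supported smooth measure
  \<open>\<phi>(x) dx\<close> is represented by its density \<open>\<phi>\<close>. A distribution on \<open>U\<close> is represented by a
  functional on densities of which only the values on \<open>test_functions U\<close> matter.\<close>

type_synonym functional = "(real \<Rightarrow> complex) \<Rightarrow> complex"

definition test_functions :: "real set \<Rightarrow> (real \<Rightarrow> complex) set" where
  "test_functions U =
     {\<phi>. smooth_on UNIV \<phi> \<and> (\<exists>K. compact K \<and> K \<subseteq> U \<and> (\<forall>x. x \<notin> K \<longrightarrow> \<phi> x = 0))}"

definition agree_on :: "real set \<Rightarrow> functional \<Rightarrow> functional \<Rightarrow> bool" where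
  "agree_on U S T \<longleftrightarrow> (\<forall>\<phi>\<in>test_functions U. S \<phi> = T \<phi>)"

definition Linf_loc :: "real set \<Rightarrow> (real \<Rightarrow> complex) \<Rightarrow> bool" where
  "Linf_loc U h \<longleftrightarrow> h \<in> borel_measurable (lebesgue_on U) \<and>
     (\<forall>K. compact K \<and> K \<subseteq> U \<longrightarrow> (\<exists>C. AE x in lebesgue_on U. x \<in> K \<longrightarrow> norm (h x) \<le> C))"

definition dist_of_fun :: "real set \<Rightarrow> (real \<Rightarrow> complex) \<Rightarrow> functional" where
  "dist_of_fun U h \<phi> = integral\<^sup>L (lebesgue_on U) (\<lambda>x. h x * \<phi> x)"

definition dist_mult :: "(real \<Rightarrow> complex) \<Rightarrow> functional \<Rightarrow> functional" where
  "dist_mult f S \<phi> = S (\<lambda>x. f x * \<phi> x)"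

definition dist_op :: "diff_op \<Rightarrow> functional \<Rightarrow> functional" where
  "dist_op D S \<phi> = S (transpose_op D \<phi>)"

definition dist_vanishes_to_order :: "real \<Rightarrow> nat \<Rightarrow> functional \<Rightarrow> bool" where
  "dist_vanishes_to_order p k S \<longleftrightarrow>
     (\<exists>U (N::nat) f D h. open U \<and> p \<in> U \<and>
        (\<forall>j\<in>{1..N}. Linf_loc U (h j) \<and> diff_op_on U (D j) \<and> tangential U p (D j) \<and>
           smooth_on U (f j) \<and> fun_vanishes_to_order U p k (f j)) \<and>
        agree_on U S
          (\<lambda>\<phi>. \<Sum>j=1..N. dist_mult (f j) (dist_op (D j) (dist_of_fun U (h j))) \<phi>))"


subsection \<open>Tempered distributions and the Fourier transform\<close>

definition schwartz :: "(real \<Rightarrow> complex) set" where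
  "schwartz = {f. smooth_on UNIV f \<and> (\<forall>m n. bounded (range (\<lambda>x. of_real (x ^ m) * nderiv n f x)))}"

text \<open>As \<open>test_functions UNIV \<subseteq> schwartz\<close>, a tempered distribution is, without any coercion,
  also a distribution on the real line.\<close>

definition tempered :: "functional \<Rightarrow> bool" where
  "tempered S \<longleftrightarrow>
     (\<forall>f\<in>schwartz. \<forall>g\<in>schwartz. S (\<lambda>x. f x + g x) = S f + S g) \<and>
     (\<forall>c. \<forall>f\<in>schwartz. S (\<lambda>x. c * f x) = c * S f) \<and>
     (\<exists>C N. \<forall>f\<in>schwartz.
        norm (S f) \<le> C * (\<Sum>m\<le>N. \<Sum>n\<le>N. SUP x. norm (of_real (x ^ m) * nderiv n f x)))"

definition e_char :: "real \<Rightarrow> complex" where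
  "e_char u = exp (2 * of_real pi * \<i> * of_real u)"

definition fourier :: "(real \<Rightarrow> complex) \<Rightarrow> real \<Rightarrow> complex" where
  "fourier f y = integral\<^sup>L lborel (\<lambda>x. f x * e_char (- (x * y)))"

definition fourier_dist :: "functional \<Rightarrow> functional" where
  "fourier_dist S f = S (fourier f)"


subsection \<open>Distributions on the real projective line\<close>

text \<open>With \<open>x = 1/u\<close>, the measure \<open>\<phi>(x) dx\<close> equals \<open>\<phi>(1/u) u\<^sup>-\<^sup>2 du\<close>. Since division by zero
  yields zero, \<open>inv_density \<phi>\<close> also has the right value \<open>0\<close> at the origin if \<open>\<phi>\<close> has compact
  support.\<close>

definition inv_density :: "(real \<Rightarrow> complex) \<Rightarrow> real \<Rightarrow> complex" where
  "inv_density \<phi> u = \<phi> (1 / u) / of_real (u ^ 2)"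

text \<open>A smooth measure on the projective line is given by the pair of its densities
  \<open>\<phi>\<close> and \<open>\<psi>\<close> in the coordinates \<open>x\<close> and \<open>u = 1/x\<close>, which determine each other where
  both coordinates are defined.\<close>

definition rp1_measures :: "((real \<Rightarrow> complex) \<times> (real \<Rightarrow> complex)) set" where
  "rp1_measures = {(\<phi>, \<psi>). smooth_on UNIV \<phi> \<and> smooth_on UNIV \<psi> \<and>
     (\<forall>u. u \<noteq> 0 \<longrightarrow> \<psi> u = inv_density \<phi> u)}"

type_synonym rp1_functional = "(real \<Rightarrow> complex) \<times> (real \<Rightarrow> complex) \<Rightarrow> complex"

text \<open>The projective line is compact and is covered by the sets where \<open>\<bar>x\<bar> \<le> 1\<close> and where
  \<open>\<bar>u\<bar> \<le> 1\<close>, so that suprema of derivatives over these two sets define the topology of the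
  space of smooth measures.\<close>

definition rp1_distribution :: "rp1_functional \<Rightarrow> bool" where
  "rp1_distribution T \<longleftrightarrow>
     (\<forall>\<phi> \<psi> \<phi>' \<psi>'. (\<phi>, \<psi>) \<in> rp1_measures \<and> (\<phi>', \<psi>') \<in> rp1_measures \<longrightarrow>
        T (\<lambda>x. \<phi> x + \<phi>' x, \<lambda>u. \<psi> u + \<psi>' u) = T (\<phi>, \<psi>) + T (\<phi>', \<psi>')) \<and>
     (\<forall>c \<phi> \<psi>. (\<phi>, \<psi>) \<in> rp1_measures \<longrightarrow> T (\<lambda>x. c * \<phi> x, \<lambda>u. c * \<psi> u) = c * T (\<phi>, \<psi>)) \<and>
     (\<exists>C N. \<forall>\<phi> \<psi>. (\<phi>, \<psi>) \<in> rp1_measures \<longrightarrow>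
        norm (T (\<phi>, \<psi>)) \<le>
          C * (\<Sum>n\<le>N. (SUP x\<in>{-1..1}. norm (nderiv n \<phi> x)) + (SUP u\<in>{-1..1}. norm (nderiv n \<psi> u))))"

text \<open>Restrictions to the domains of the two coordinates, each of which is a real line. For
  a test function \<open>\<phi>\<close> in either coordinate, the density in the other one is
  \<open>inv_density \<phi>\<close>.\<close>

definition rp1_restrict_x :: "rp1_functional \<Rightarrow> functional" where
  "rp1_restrict_x T \<phi> = T (\<phi>, inv_density \<phi>)"

definition rp1_restrict_u :: "rp1_functional \<Rightarrow> functional" where
  "rp1_restrict_u T \<psi> = T (inv_density \<psi>, \<psi>)"

definition rp1_extends :: "rp1_functional \<Rightarrow> functional \<Rightarrow> bool" where
  "rp1_extends T S \<longleftrightarrow> rp1_distribution T \<and> agree_on UNIV (rp1_restrict_x T) S"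

definition vanishes_to_order_at_infinity :: "nat \<Rightarrow> rp1_functional \<Rightarrow> bool" where
  "vanishes_to_order_at_infinity k T \<longleftrightarrow> dist_vanishes_to_order 0 k (rp1_restrict_u T)"

definition has_canonical_extension_across_infinity :: "functional \<Rightarrow> bool" where
  "has_canonical_extension_across_infinity S \<longleftrightarrow>
     (\<exists>T. rp1_extends T S \<and> (\<forall>k. vanishes_to_order_at_infinity k T))"

end

theory Submission
  imports Defs "HOL-Probability.Sinc_Integral"
begin

text \<open>Near \<open>0\<close> the hypothesis says that \<open>\<sigma>\<close> is a sum of terms \<open>x ^ k (x ^ l (d/dx) ^ l) h\<close>, up to
  the order of the factors, with \<open>h\<close> bounded and of compact support. Their Fourier transforms are
  constant multiples of \<open>(d/dy) ^ (k + l) (y ^ l g)\<close> with \<open>g\<close> bounded, again up to the order of the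
  factors. Away from \<open>0\<close>, divide \<open>\<sigma>\<close> by \<open>x ^ n\<close>: for large \<open>n\<close> the quotient has a
  function \<open>g\<close> as its Fourier transform, with growth \<open>y ^ N\<close> for an \<open>N\<close> independent of \<open>n\<close>, and
  the transform of this part of \<open>\<sigma>\<close> is a multiple of \<open>(d/dy) ^ n g\<close>; take \<open>n\<close> to exceed \<open>k + N\<close>.
  Thus the Fourier transform pairs with \<open>\<phi>\<close> as a sum of integrals of \<open>g\<^sub>i \<phi>\<^sup>(\<^sup>k\<^sup>+\<^sup>i\<^sup>)\<close> with
  \<open>g\<^sub>i = O(\<bar>y\<bar> ^ i)\<close>. Since \<open>d/dy = - u\<^sup>2 d/du\<close> for \<open>u = 1/y\<close>, such a pairing makes sense on the
  projective line and has the form required of a distribution vanishing to order \<open>k\<close> at \<open>u = 0\<close>.\<close>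

subsection \<open>Iterated derivatives\<close>

text \<open>The exponents follow from one fact: the density of a smooth measure on the projective
  line has m-th derivative O(|y|^(-m-2)). A weight of growth |y|^i therefore pairs absolutely with a
  derivative of order k + i, and the extension is the same formula evaluated on more measures,
  without renormalisation at infinity. The excess k of derivatives over growth becomes the order of
  vanishing. Three obstacles shape the proof. Tangential operators are given only by their effect on
  ideal powers; what is extracted is that the i-th coefficient vanishes to order i, and the
  quotients of such coefficients by powers of x are merely bounded, so they are absorbed into h. The
  function g is obtained without a structure theorem for tempered distributions: \<sigma> is applied
  to exponentials cut off at a large radius, and the radius tends to infinity. Finally the
  representation depends on k, while a canonical extension must be one distribution for all k; since
  test functions on the line do not determine a distribution at infinity, the agreement of the
  representations needs a limit argument of its own.\<close>

lemma nderiv_0 [simp]: "nderiv 0 f = f"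
  by (simp add: nderiv_def)

lemma nderiv_Suc: "nderiv (Suc n) f x = vector_derivative (nderiv n f) (at x)"
  by (simp add: nderiv_def)

lemma nderiv_nderiv: "nderiv m (nderiv n f) = nderiv (m + n) f"
  by (simp add: nderiv_def funpow_add)

lemma smooth_onD:
  assumes "smooth_on U f" "x \<in> U"
  shows "(nderiv n f has_vector_derivative nderiv (Suc n) f x) (at x)"
  using assms unfolding smooth_on_def nderiv_Suc by (simp add: vector_derivative_works)

text \<open>All smoothness proofs reduce to this: it suffices to guess the successive derivatives.\<close>

lemma derivative_sequence:
  assumes U: "open U" and 0: "\<And>x. x \<in> U \<Longrightarrow> f x = F 0 x"
    and F: "\<And>n x. x \<in> U \<Longrightarrow> (F n has_vector_derivative F (Suc n) x) (at x)"
  shows smooth_on_derivative_sequence: "smooth_on U f"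
    and nderiv_derivative_sequence: "x \<in> U \<Longrightarrow> nderiv n f x = F n x"
proof -
  have *: "\<forall>x\<in>U. nderiv n f x = F n x" for n
  proof (induction n)
    case (Suc n)
    show ?case
    proof
      fix x assume x: "x \<in> U"
      have "(nderiv n f has_vector_derivative F (Suc n) x) (at x)"
        by (rule has_vector_derivative_transform_within_open[OF F[OF x] U x]) (simp add: Suc)
      then show "nderiv (Suc n) f x = F (Suc n) x"
        by (simp add: nderiv_Suc vector_derivative_at)
    qed
  qed (simp add: 0)
  then show "x \<in> U \<Longrightarrow> nderiv n f x = F n x" by blast
  show "smooth_on U f"
    unfolding smooth_on_def
  proof (intro allI ballI)
    fix n x assume x: "x \<in> U"
    have "(nderiv n f has_vector_derivative F (Suc n) x) (at x)"
      by (rule has_vector_derivative_transform_within_open[OF F[OF x] U x]) (simp add: *)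
    then show "nderiv n f differentiable at x"
      by (rule differentiableI_vector)
  qed
qed

lemma smooth_on_cong:
  assumes "open U" "\<And>x. x \<in> U \<Longrightarrow> f x = g x" "smooth_on U g"
  shows "smooth_on U f"
  by (rule smooth_on_derivative_sequence[where F = "\<lambda>n. nderiv n g"])
    (use assms smooth_onD in auto)

lemma nderiv_cong:
  assumes "open U" "\<And>x. x \<in> U \<Longrightarrow> f x = g x" "smooth_on U g" "x \<in> U"
  shows "nderiv n f x = nderiv n g x"
  by (rule nderiv_derivative_sequence[where F = "\<lambda>n. nderiv n g" and U = U])
    (use assms smooth_onD in auto)

lemma smooth_on_subset: "smooth_on U f \<Longrightarrow> V \<subseteq> U \<Longrightarrow> smooth_on V f"
  by (auto simp: smooth_on_def)

lemma smooth_on_nderiv: "smooth_on U f \<Longrightarrow> smooth_on U (nderiv n f)"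
  by (auto simp: smooth_on_def nderiv_nderiv)

lemma smooth_on_continuous: "smooth_on U f \<Longrightarrow> continuous_on U (nderiv n f)"
  unfolding smooth_on_def
  by (meson continuous_at_imp_continuous_on differentiable_imp_continuous_within)

lemma smooth_on_continuous0: "smooth_on U f \<Longrightarrow> continuous_on U f"
  using smooth_on_continuous[of U f 0] by simp

lemma smooth_on_bounded:
  assumes "smooth_on U f" "{a..b} \<subseteq> U"
  obtains B where "\<And>x. x \<in> {a..b} \<Longrightarrow> norm (nderiv n f x) \<le> B"
proof -
  have "bounded (nderiv n f ` {a..b})"
    by (intro compact_imp_bounded compact_continuous_image
        continuous_on_subset[OF smooth_on_continuous[OF assms(1)] assms(2)]) auto
  then show ?thesis using that unfolding bounded_iff by blast
qed

lemma
  assumes "open U"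
  shows smooth_on_const: "smooth_on U (\<lambda>_. c)"
    and nderiv_const: "x \<in> U \<Longrightarrow> nderiv n (\<lambda>_. c) x = (if n = 0 then c else 0)"
proof -
  have *: "((\<lambda>_. if n = 0 then c else 0) has_vector_derivative (if Suc n = 0 then c else 0)) (at x)"
    for n :: nat and x :: real by simp
  show "smooth_on U (\<lambda>_. c)"
    by (rule smooth_on_derivative_sequence[where F = "\<lambda>n x. if n = 0 then c else 0"])
      (use assms * in auto)
  show "x \<in> U \<Longrightarrow> nderiv n (\<lambda>_. c) x = (if n = 0 then c else 0)"
    by (rule nderiv_derivative_sequence[where F = "\<lambda>n x. if n = 0 then c else 0" and U = U])
      (use assms * in auto)
qed

lemma
  assumes "open U" "\<And>i. i \<in> I \<Longrightarrow> smooth_on U (f i)"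
  shows smooth_on_sum: "smooth_on U (\<lambda>x. \<Sum>i\<in>I. f i x)"
    and nderiv_sum: "x \<in> U \<Longrightarrow> nderiv n (\<lambda>x. \<Sum>i\<in>I. f i x) x = (\<Sum>i\<in>I. nderiv n (f i) x)"
proof -
  have *: "((\<lambda>x. \<Sum>i\<in>I. nderiv n (f i) x) has_vector_derivative (\<Sum>i\<in>I. nderiv (Suc n) (f i) x)) (at x)"
    if "x \<in> U" for n x
    using assms(2) smooth_onD[OF _ that] by (intro has_vector_derivative_sum) auto
  show "smooth_on U (\<lambda>x. \<Sum>i\<in>I. f i x)"
    by (rule smooth_on_derivative_sequence[where F = "\<lambda>n x. \<Sum>i\<in>I. nderiv n (f i) x"])
      (use assms * in auto)
  show "x \<in> U \<Longrightarrow> nderiv n (\<lambda>x. \<Sum>i\<in>I. f i x) x = (\<Sum>i\<in>I. nderiv n (f i) x)"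
    by (rule nderiv_derivative_sequence[where F = "\<lambda>n x. \<Sum>i\<in>I. nderiv n (f i) x" and U = U])
      (use assms * in auto)
qed

lemma
  assumes "open U" "smooth_on U f" "smooth_on U g"
  shows smooth_on_add: "smooth_on U (\<lambda>x. f x + g x)"
    and nderiv_add: "x \<in> U \<Longrightarrow> nderiv n (\<lambda>x. f x + g x) x = nderiv n f x + nderiv n g x"
proof -
  have *: "((\<lambda>x. nderiv n f x + nderiv n g x) has_vector_derivative
      nderiv (Suc n) f x + nderiv (Suc n) g x) (at x)"
    if "x \<in> U" for n x
    using assms smooth_onD[OF _ that] by (intro has_vector_derivative_add) auto
  show "smooth_on U (\<lambda>x. f x + g x)"
    by (rule smooth_on_derivative_sequence[where F = "\<lambda>n x. nderiv n f x + nderiv n g x"])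
      (use assms * in auto)
  show "x \<in> U \<Longrightarrow> nderiv n (\<lambda>x. f x + g x) x = nderiv n f x + nderiv n g x"
    by (rule nderiv_derivative_sequence[where F = "\<lambda>n x. nderiv n f x + nderiv n g x" and U = U])
      (use assms * in auto)
qed

lemma
  assumes "open U" "smooth_on U f"
  shows smooth_on_cmult: "smooth_on U (\<lambda>x. c * f x)"
    and nderiv_cmult: "x \<in> U \<Longrightarrow> nderiv n (\<lambda>x. c * f x) x = c * nderiv n f x"
proof -
  have *: "((\<lambda>x. c * nderiv n f x) has_vector_derivative c * nderiv (Suc n) f x) (at x)"
    if "x \<in> U" for n x
    using has_vector_derivative_mult_right[OF smooth_onD[OF assms(2) that]] by simp
  show "smooth_on U (\<lambda>x. c * f x)"
    by (rule smooth_on_derivative_sequence[where F = "\<lambda>n x. c * nderiv n f x"])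
      (use assms * in auto)
  show "x \<in> U \<Longrightarrow> nderiv n (\<lambda>x. c * f x) x = c * nderiv n f x"
    by (rule nderiv_derivative_sequence[where F = "\<lambda>n x. c * nderiv n f x" and U = U])
      (use assms * in auto)
qed

lemma
  assumes "open U" "smooth_on U f" "smooth_on U g"
  shows smooth_on_diff: "smooth_on U (\<lambda>x. f x - g x)"
    and nderiv_diff: "x \<in> U \<Longrightarrow> nderiv n (\<lambda>x. f x - g x) x = nderiv n f x - nderiv n g x"
  using smooth_on_add[OF assms(1,2) smooth_on_cmult[OF assms(1,3), of "-1"]]
    nderiv_add[OF assms(1,2) smooth_on_cmult[OF assms(1,3), of "-1"], of x n]
    nderiv_cmult[OF assms(1,3), of x n "-1"] by auto

text \<open>Pascal's rule. It is the inductive step of the Leibniz formula, with \<open>a j\<close>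
  and \<open>b j\<close> standing for the j-th derivatives of the two factors at one point.\<close>

lemma binomial_convolution_Suc:
  fixes a b :: "nat \<Rightarrow> complex"
  shows "(\<Sum>j\<le>n. of_nat (n choose j) * (a j * b (Suc (n - j)) + a (Suc j) * b (n - j))) =
    (\<Sum>j\<le>Suc n. of_nat (Suc n choose j) * (a j * b (Suc n - j)))"
proof -
  have "(\<Sum>j\<le>Suc n. of_nat (Suc n choose j) * (a j * b (Suc n - j))) =
      a 0 * b (Suc n) + (\<Sum>j\<le>n. of_nat (n choose j) * (a (Suc j) * b (n - j)))
      + (\<Sum>j\<le>n. of_nat (n choose Suc j) * (a (Suc j) * b (n - j)))"
    by (subst sum.atMost_Suc_shift) (simp add: distrib_right sum.distrib)
  moreover have "a 0 * b (Suc n) + (\<Sum>j\<le>n. of_nat (n choose Suc j) * (a (Suc j) * b (n - j)))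
      = (\<Sum>j\<le>Suc n. of_nat (n choose j) * (a j * b (Suc n - j)))"
    by (subst sum.atMost_Suc_shift) simp
  moreover have "\<dots> = (\<Sum>j\<le>n. of_nat (n choose j) * (a j * b (Suc (n - j))))"
    by (simp add: Suc_diff_le)
  ultimately show ?thesis
    by (simp add: distrib_left sum.distrib algebra_simps)
qed

lemma
  assumes "open U" "smooth_on U f" "smooth_on U g"
  shows smooth_on_mult: "smooth_on U (\<lambda>x. f x * g x)"
    and nderiv_mult: "x \<in> U \<Longrightarrow> nderiv n (\<lambda>x. f x * g x) x =
      (\<Sum>j\<le>n. of_nat (n choose j) * (nderiv j f x * nderiv (n - j) g x))"
proof -
  define F where "F n x = (\<Sum>j\<le>n. of_nat (n choose j) * (nderiv j f x * nderiv (n - j) g x))" for n x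
  have *: "(F n has_vector_derivative F (Suc n) x) (at x)" if "x \<in> U" for n x
  proof -
    have "(F n has_vector_derivative (\<Sum>j\<le>n. of_nat (n choose j) *
        (nderiv j f x * nderiv (Suc (n - j)) g x + nderiv (Suc j) f x * nderiv (n - j) g x))) (at x)"
      unfolding F_def[abs_def] using assms smooth_onD[OF _ that]
      by (intro has_vector_derivative_sum has_vector_derivative_mult_right has_vector_derivative_mult) auto
    then show ?thesis
      unfolding F_def
        binomial_convolution_Suc[where a = "\<lambda>j. nderiv j f x" and b = "\<lambda>j. nderiv j g x"] .
  qed
  have 0: "f x * g x = F 0 x" for x by (simp add: F_def)
  show "smooth_on U (\<lambda>x. f x * g x)"
    by (rule smooth_on_derivative_sequence[where F = F, OF assms(1) 0 *])
  show "x \<in> U \<Longrightarrow> nderiv n (\<lambda>x. f x * g x) x =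
      (\<Sum>j\<le>n. of_nat (n choose j) * (nderiv j f x * nderiv (n - j) g x))"
    using nderiv_derivative_sequence[where F = F, OF assms(1) 0 *] by (simp add: F_def)
qed

text \<open>The product \<open>\<Prod>j<n. m - j\<close> is a falling factorial with truncated
  subtraction. For n > m it contains the factor 0, so the formula also covers the derivatives that
  vanish, where the exponent m - n is cut off at 0.\<close>

lemma
  assumes "open U"
  shows smooth_on_power: "smooth_on U (\<lambda>x. of_real (x ^ m))"
    and nderiv_power: "x \<in> U \<Longrightarrow> nderiv n (\<lambda>x. of_real (x ^ m)) x =
      of_nat (\<Prod>j<n. m - j) * of_real (x ^ (m - n))"
proof -
  define F :: "nat \<Rightarrow> real \<Rightarrow> complex" where "F n x = of_nat (\<Prod>j<n. m - j) * of_real (x ^ (m - n))" for n x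
  have *: "(F n has_vector_derivative F (Suc n) x) (at x)" if "x \<in> U" for n x
  proof -
    have "((\<lambda>x. of_real (x ^ (m - n)) :: complex) has_vector_derivative
        of_real (of_nat (m - n) * x ^ (m - n - 1))) (at x)"
      by (rule has_vector_derivative_of_real) (auto intro!: derivative_eq_intros)
    from has_vector_derivative_mult_right[OF this, of "of_nat (\<Prod>j<n. m - j)"] show ?thesis
      by (simp add: F_def[abs_def] mult_ac)
  qed
  have 0: "of_real (x ^ m) = F 0 x" for x by (simp add: F_def)
  show "smooth_on U (\<lambda>x. of_real (x ^ m))"
    by (rule smooth_on_derivative_sequence[where F = F, OF assms(1) 0 *])
  show "x \<in> U \<Longrightarrow> nderiv n (\<lambda>x. of_real (x ^ m)) x = of_nat (\<Prod>j<n. m - j) * of_real (x ^ (m - n))"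
    using nderiv_derivative_sequence[where F = F, OF assms(1) 0 *] by (simp add: F_def)
qed

text \<open>This rescales cutoff functions. Arguments such as \<open>c * x + 0\<close> further on
  are written in this way to match its form.\<close>

lemma
  assumes "smooth_on UNIV f"
  shows smooth_on_affine: "smooth_on UNIV (\<lambda>x. f (c * x + d))"
    and nderiv_affine: "nderiv n (\<lambda>x. f (c * x + d)) x = of_real (c ^ n) * nderiv n f (c * x + d)"
proof -
  define F where "F n x = of_real (c ^ n) * nderiv n f (c * x + d)" for n x
  have *: "(F n has_vector_derivative F (Suc n) x) (at x)" for n x
  proof -
    have "((\<lambda>x. c * x + d) has_vector_derivative c) (at x)"
      by (auto intro!: derivative_eq_intros simp: has_real_derivative_iff_has_vector_derivative[symmetric])
    from vector_diff_chain_at[OF this smooth_onD[OF assms UNIV_I]]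
    have "((\<lambda>x. nderiv n f (c * x + d)) has_vector_derivative c *\<^sub>R nderiv (Suc n) f (c * x + d)) (at x)"
      by (simp add: o_def)
    from has_vector_derivative_mult_right[OF this, of "of_real (c ^ n)"] show ?thesis
      by (simp add: F_def[abs_def] scaleR_conv_of_real algebra_simps)
  qed
  have 0: "f (c * x + d) = F 0 x" for x by (simp add: F_def)
  show "smooth_on UNIV (\<lambda>x. f (c * x + d))"
    by (rule smooth_on_derivative_sequence[where F = F, OF open_UNIV 0 *])
  show "nderiv n (\<lambda>x. f (c * x + d)) x = of_real (c ^ n) * nderiv n f (c * x + d)"
    using nderiv_derivative_sequence[where F = F, OF open_UNIV 0 *] by (simp add: F_def)
qed

lemma nderiv_eq_0:
  assumes "open V" "x \<in> V" "\<And>y. y \<in> V \<Longrightarrow> f y = 0"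
  shows "nderiv n f x = 0"
  using nderiv_cong[OF assms(1,3) smooth_on_const[OF assms(1)] assms(2), where n = n]
    nderiv_const[OF assms(1,2), where n = n and c = 0] by simp

text \<open>The mean value inequality. A closed segment instead of an interval leaves the order of a
  and b open.\<close>

lemma vector_derivative_bound:
  fixes f :: "real \<Rightarrow> 'a::real_normed_vector"
  assumes f: "\<And>x. x \<in> closed_segment a b \<Longrightarrow> (f has_vector_derivative f' x) (at x within closed_segment a b)"
    and B: "\<And>x. x \<in> closed_segment a b \<Longrightarrow> norm (f' x) \<le> B"
  shows "norm (f b - f a) \<le> B * \<bar>b - a\<bar>"
proof -
  have "0 \<le> B" using B[of a] norm_ge_zero[of "f' a"] by (simp del: norm_ge_zero)
  then have "onorm (\<lambda>h. h *\<^sub>R f' x) \<le> B" if "x \<in> closed_segment a b" for x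
    using B[OF that] by (intro onorm_bound) (auto simp: mult.commute[of B] intro!: mult_left_mono)
  then show ?thesis
    using differentiable_bound[OF convex_closed_segment, of a b f "\<lambda>x h. h *\<^sub>R f' x" B b a] f
    by (simp add: has_vector_derivative_def)
qed

subsection \<open>Order of vanishing of smooth functions\<close>

text \<open>A substitute for membership in \<open>point_ideal_power\<close> that exhibits no
  generators. It follows from membership, passes through sums, differences and products, and
  suffices for the estimate \<open>zero_of_order_bound\<close>.\<close>

definition zero_of_order :: "real set \<Rightarrow> real \<Rightarrow> nat \<Rightarrow> (real \<Rightarrow> complex) \<Rightarrow> bool" where
  "zero_of_order U p n f \<longleftrightarrow> smooth_on U f \<and> (\<forall>j<n. nderiv j f p = 0)"

lemma zero_of_order_smooth: "zero_of_order U p n f \<Longrightarrow> smooth_on U f"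
  by (simp add: zero_of_order_def)

lemma zero_of_order_cong:
  assumes "open U" "p \<in> U" "\<And>x. x \<in> U \<Longrightarrow> f x = g x" "zero_of_order U p n g"
  shows "zero_of_order U p n f"
  using assms nderiv_cong[OF assms(1,3) _ assms(2)] smooth_on_cong[OF assms(1,3)]
  by (simp add: zero_of_order_def)

lemma zero_of_order_sum:
  assumes "open U" "p \<in> U" "\<And>i. i \<in> I \<Longrightarrow> zero_of_order U p n (f i)"
  shows "zero_of_order U p n (\<lambda>x. \<Sum>i\<in>I. f i x)"
  using assms by (auto simp: zero_of_order_def nderiv_sum intro!: smooth_on_sum)

lemma zero_of_order_diff:
  assumes "open U" "p \<in> U" "zero_of_order U p n f" "zero_of_order U p n g"
  shows "zero_of_order U p n (\<lambda>x. f x - g x)"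
  using assms by (auto simp: zero_of_order_def nderiv_diff intro!: smooth_on_diff)

lemma zero_of_order_mult:
  assumes "open U" "p \<in> U" "zero_of_order U p m f" "zero_of_order U p n g"
  shows "zero_of_order U p (m + n) (\<lambda>x. f x * g x)"
  unfolding zero_of_order_def
proof (intro conjI allI impI)
  show "smooth_on U (\<lambda>x. f x * g x)"
    using assms by (auto simp: zero_of_order_def intro!: smooth_on_mult)
  fix j assume j: "j < m + n"
  have "i < m \<or> j - i < n" if "i \<le> j" for i using j that by arith
  then show "nderiv j (\<lambda>x. f x * g x) p = 0"
    using assms unfolding zero_of_order_def
    by (subst nderiv_mult[where U = U]) (auto intro!: sum.neutral, blast)
qed

lemma zero_of_order_cmult:
  assumes "open U" "p \<in> U" "zero_of_order U p n f"
  shows "zero_of_order U p n (\<lambda>x. c * f x)"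
  using assms by (auto simp: zero_of_order_def nderiv_cmult intro!: smooth_on_cmult)

lemma zero_of_order_nderiv:
  "zero_of_order U p (m + n) f \<Longrightarrow> zero_of_order U p n (nderiv m f)"
  by (auto simp: zero_of_order_def nderiv_nderiv smooth_on_nderiv)

lemma zero_of_order_power:
  assumes "open U" "0 \<in> U"
  shows "zero_of_order U 0 m (\<lambda>x. of_real (x ^ m))"
  using assms by (simp add: zero_of_order_def smooth_on_power nderiv_power del: of_real_power)

section \<open>Calculus of the ideal powers\<close>

lemma point_ideal_power_SucE:
  assumes "f \<in> point_ideal_power U p (Suc k)"
  obtains N :: nat and g h where
    "\<forall>j<N. smooth_on U (g j) \<and> g j p = 0 \<and> h j \<in> point_ideal_power U p k"
    "\<forall>x\<in>U. f x = (\<Sum>j<N. g j x * h j x)"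
  using assms unfolding point_ideal_power.simps mem_Collect_eq by blast

lemma point_ideal_power_smooth:
  assumes "open U" "f \<in> point_ideal_power U p k"
  shows "smooth_on U f"
  using assms(2)
proof (induction k arbitrary: f)
  case (Suc k)
  from Suc.prems obtain N :: nat and g h where
    "\<forall>j<N. smooth_on U (g j) \<and> g j p = 0 \<and> h j \<in> point_ideal_power U p k"
      "\<forall>x\<in>U. f x = (\<Sum>j<N. g j x * h j x)" by (rule point_ideal_power_SucE)
  note * = this[rule_format]
  show ?case
    by (rule smooth_on_cong[OF assms(1) *(2)])
      (use assms(1) Suc.IH * in \<open>auto intro!: smooth_on_sum smooth_on_mult\<close>)
qed auto

lemma point_ideal_power_zero_of_order:
  assumes "open U" "p \<in> U" "f \<in> point_ideal_power U p k"
  shows "zero_of_order U p k f"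
  using assms(3)
proof (induction k arbitrary: f)
  case (Suc k)
  from Suc.prems obtain N :: nat and g h where
    "\<forall>j<N. smooth_on U (g j) \<and> g j p = 0 \<and> h j \<in> point_ideal_power U p k"
      "\<forall>x\<in>U. f x = (\<Sum>j<N. g j x * h j x)" by (rule point_ideal_power_SucE)
  note * = this[rule_format]
  have "zero_of_order U p (1 + k) (\<lambda>x. g j x * h j x)" if "j < N" for j
    by (rule zero_of_order_mult) (use assms *(1)[OF that] Suc.IH in \<open>auto simp: zero_of_order_def\<close>)
  then show ?case
    by (intro zero_of_order_cong[OF assms(1,2) *(2)] zero_of_order_sum assms) auto
qed (auto simp: zero_of_order_def)

lemma point_ideal_power_cong:
  assumes "open U" "\<And>x. x \<in> U \<Longrightarrow> f x = g x" "g \<in> point_ideal_power U p k"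
  shows "f \<in> point_ideal_power U p k"
  using assms by (cases k) (auto intro: smooth_on_cong)

lemma point_ideal_power_mult_step:
  assumes "open U" "smooth_on U g" "g p = 0" "h \<in> point_ideal_power U p k"
  shows "(\<lambda>x. g x * h x) \<in> point_ideal_power U p (Suc k)"
  unfolding point_ideal_power.simps mem_Collect_eq
  by (rule exI[of _ 1], rule exI[of _ "\<lambda>_. g"], rule exI[of _ "\<lambda>_. h"]) (use assms in auto)

lemma sum_lessThan_add:
  fixes f :: "nat \<Rightarrow> 'a::comm_monoid_add"
  shows "(\<Sum>j<N + M. f j) = (\<Sum>j<N. f j) + (\<Sum>j<M. f (N + j))"
  by (induction M) (simp_all add: add.assoc)

lemma point_ideal_power_add:
  assumes "open U" "f \<in> point_ideal_power U p k" "g \<in> point_ideal_power U p k"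
  shows "(\<lambda>x. f x + g x) \<in> point_ideal_power U p k"
proof (cases k)
  case 0
  then show ?thesis using assms by (auto intro: smooth_on_add)
next
  case (Suc k')
  from assms(2)[unfolded Suc] obtain N :: nat and a b where
    "\<forall>j<N. smooth_on U (a j) \<and> a j p = 0 \<and> b j \<in> point_ideal_power U p k'"
      "\<forall>x\<in>U. f x = (\<Sum>j<N. a j x * b j x)" by (rule point_ideal_power_SucE)
  note f = this[rule_format]
  from assms(3)[unfolded Suc] obtain M :: nat and c d where
    "\<forall>j<M. smooth_on U (c j) \<and> c j p = 0 \<and> d j \<in> point_ideal_power U p k'"
      "\<forall>x\<in>U. g x = (\<Sum>j<M. c j x * d j x)" by (rule point_ideal_power_SucE)
  note g = this[rule_format]
  define a' where "a' j = (if j < N then a j else c (j - N))" for j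
  define b' where "b' j = (if j < N then b j else d (j - N))" for j
  have "f x + g x = (\<Sum>j<N + M. a' j x * b' j x)" if "x \<in> U" for x
  proof -
    have "(\<Sum>j<N + M. a' j x * b' j x) = (\<Sum>j<N. a' j x * b' j x) + (\<Sum>j<M. a' (N + j) x * b' (N + j) x)"
      by (rule sum_lessThan_add)
    then show ?thesis by (simp add: a'_def b'_def f(2)[OF that] g(2)[OF that])
  qed
  moreover have "smooth_on U (a' j) \<and> a' j p = 0 \<and> b' j \<in> point_ideal_power U p k'" if "j < N + M" for j
    using f(1)[of j] g(1)[of "j - N"] that by (auto simp: a'_def b'_def)
  ultimately show ?thesis unfolding Suc point_ideal_power.simps by blast
qed

lemma point_ideal_power_smult:
  assumes "open U" "smooth_on U s" "f \<in> point_ideal_power U p k"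
  shows "(\<lambda>x. s x * f x) \<in> point_ideal_power U p k"
proof (cases k)
  case 0
  then show ?thesis using assms by (auto intro: smooth_on_mult)
next
  case (Suc k')
  from assms(3)[unfolded Suc] obtain N :: nat and a b where
    "\<forall>j<N. smooth_on U (a j) \<and> a j p = 0 \<and> b j \<in> point_ideal_power U p k'"
      "\<forall>x\<in>U. f x = (\<Sum>j<N. a j x * b j x)" by (rule point_ideal_power_SucE)
  note f = this[rule_format]
  have "s x * f x = (\<Sum>j<N. (s x * a j x) * b j x)" if "x \<in> U" for x
    by (simp add: f(2)[OF that] sum_distrib_left mult_ac)
  moreover have "smooth_on U ((\<lambda>j x. s x * a j x) j) \<and> (\<lambda>j x. s x * a j x) j p = 0 \<and> b j \<in> point_ideal_power U p k'"
    if "j < N" for j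
    using f(1)[OF that] assms by (auto intro: smooth_on_mult)
  ultimately show ?thesis unfolding Suc point_ideal_power.simps mem_Collect_eq
    by (intro exI[of _ N] exI[of _ "\<lambda>j x. s x * a j x"] exI[of _ b] conjI allI impI ballI) simp_all
qed

lemma point_ideal_power_sum:
  assumes "open U" "p \<in> U" "finite I" "\<And>i. i \<in> I \<Longrightarrow> f i \<in> point_ideal_power U p k"
  shows "(\<lambda>x. \<Sum>i\<in>I. f i x) \<in> point_ideal_power U p k"
  using assms(3,4)
proof (induction I rule: finite_induct)
  case empty
  have "(\<lambda>x. 0) \<in> point_ideal_power U p k"
    by (cases k) (auto intro: smooth_on_const assms(1) exI[of _ "0 :: nat"])
  then show ?case by simp
next
  case (insert i I)
  then show ?case using point_ideal_power_add[OF assms(1), of "f i" p k "\<lambda>x. \<Sum>i\<in>I. f i x"]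
    by simp
qed

text \<open>For a product g h with g in the ideal and h in its power k + 1, both parts of g' h + g
  h' lie in the power k + 1: the first because h does, the second because h' lies in the power k by
  induction and g adds one.\<close>

lemma point_ideal_power_nderiv_1:
  assumes "open U" "p \<in> U" "f \<in> point_ideal_power U p (Suc k)"
  shows "nderiv 1 f \<in> point_ideal_power U p k"
  using assms(3)
proof (induction k arbitrary: f)
  case 0
  show ?case
    using point_ideal_power_smooth[OF assms(1) 0] by (simp add: smooth_on_nderiv)
next
  case (Suc k)
  from Suc.prems obtain N :: nat and g h where
    "\<forall>j<N. smooth_on U (g j) \<and> g j p = 0 \<and> h j \<in> point_ideal_power U p (Suc k)"
      "\<forall>x\<in>U. f x = (\<Sum>j<N. g j x * h j x)" by (rule point_ideal_power_SucE)
  note * = this[rule_format]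
  have sm: "smooth_on U (g j)" "smooth_on U (h j)" if "j < N" for j
    using *(1)[OF that] point_ideal_power_smooth[OF assms(1)] by blast+
  have "nderiv 1 f x = (\<Sum>j<N. nderiv 1 (g j) x * h j x + g j x * nderiv 1 (h j) x)" if x: "x \<in> U" for x
  proof -
    have "nderiv 1 f x = nderiv 1 (\<lambda>x. \<Sum>j<N. g j x * h j x) x"
      by (rule nderiv_cong[OF assms(1) *(2) _ x]) (use sm assms in \<open>auto intro!: smooth_on_sum smooth_on_mult\<close>)
    also have "\<dots> = (\<Sum>j<N. nderiv 1 (\<lambda>x. g j x * h j x) x)"
      by (rule nderiv_sum[OF assms(1) _ x]) (use sm assms in \<open>auto intro!: smooth_on_mult\<close>)
    also have "\<dots> = (\<Sum>j<N. nderiv 1 (g j) x * h j x + g j x * nderiv 1 (h j) x)"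
      by (intro sum.cong refl) (use sm assms in \<open>simp add: nderiv_mult[OF _ _ _ x]\<close>)
    finally show ?thesis .
  qed
  moreover have "(\<lambda>x. \<Sum>j<N. nderiv 1 (g j) x * h j x + g j x * nderiv 1 (h j) x) \<in> point_ideal_power U p (Suc k)"
  proof (intro point_ideal_power_sum point_ideal_power_add assms finite_lessThan)
    fix j assume "j \<in> {..<N}"
    then have j: "j < N" by simp
    show "(\<lambda>x. nderiv 1 (g j) x * h j x) \<in> point_ideal_power U p (Suc k)"
      using *(1)[OF j] sm[OF j] assms(1) by (intro point_ideal_power_smult smooth_on_nderiv) auto
    show "(\<lambda>x. g j x * nderiv 1 (h j) x) \<in> point_ideal_power U p (Suc k)"
      using *(1)[OF j] sm[OF j] assms(1) Suc.IH by (intro point_ideal_power_mult_step) auto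
  qed
  ultimately show ?case
    by (rule point_ideal_power_cong[OF assms(1)])
qed

lemma point_ideal_power_nderiv:
  assumes "open U" "p \<in> U" "f \<in> point_ideal_power U p (m + k)"
  shows "nderiv m f \<in> point_ideal_power U p k"
  using assms(3)
proof (induction m arbitrary: f)
  case (Suc m)
  then have "nderiv m (nderiv 1 f) \<in> point_ideal_power U p k"
    using point_ideal_power_nderiv_1[OF assms(1,2), of f "m + k"] by simp
  then show ?case by (simp add: nderiv_nderiv)
qed simp

lemma point_ideal_power_power_mult:
  assumes "open U" "f \<in> point_ideal_power U 0 k"
  shows "(\<lambda>x. of_real (x ^ m) * f x) \<in> point_ideal_power U 0 (m + k)"
proof (induction m)
  case (Suc m)
  have "(\<lambda>x. of_real x * (of_real (x ^ m) * f x)) \<in> point_ideal_power U 0 (Suc (m + k))"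
    using smooth_on_power[OF assms(1), of 1] assms(1) Suc by (intro point_ideal_power_mult_step) auto
  then show ?case by (simp add: mult_ac)
qed (use assms in simp)

lemma power_in_point_ideal_power:
  assumes "open U"
  shows "(\<lambda>x. of_real (x ^ k)) \<in> point_ideal_power U 0 k"
  using point_ideal_power_power_mult[OF assms, of "\<lambda>_. 1" 0 k] smooth_on_const[OF assms] by simp

text \<open>If i \<le> k, the i derivatives lower the order to k - i and the factor x^i restores it.
  If i > k, the factor x^k alone gives the order and the rest, x^(i-k) times a derivative, need only
  be smooth.\<close>

lemma power_mult_nderiv_in_point_ideal_power:
  assumes "open U" "0 \<in> U" "f \<in> point_ideal_power U 0 k"
  shows "(\<lambda>x. of_real (x ^ i) * nderiv i f x) \<in> point_ideal_power U 0 k"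
proof (cases "i \<le> k")
  case True
  then have "nderiv i f \<in> point_ideal_power U 0 (k - i)"
    using assms by (intro point_ideal_power_nderiv) auto
  from point_ideal_power_power_mult[OF assms(1) this, of i] True show ?thesis by simp
next
  case False
  have "(\<lambda>x. of_real (x ^ (i - k)) * nderiv i f x) \<in> point_ideal_power U 0 0"
    using point_ideal_power_smooth[OF assms(1,3)] assms(1)
    by (auto intro!: smooth_on_mult smooth_on_power[simplified] smooth_on_nderiv)
  from point_ideal_power_power_mult[OF assms(1) this, of k] False show ?thesis
    by (simp add: power_add[symmetric] mult.assoc[symmetric] flip: of_real_power of_real_mult)
qed

subsection \<open>Tangential operators\<close>

text \<open>The model tangential operators at 0: x^i (d/dx)^i is the falling factorial of degree i
  in the Euler field x d/dx.\<close>

definition euler_op :: "nat \<Rightarrow> diff_op" where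
  "euler_op i = replicate i (\<lambda>_. 0) @ [\<lambda>x. of_real (x ^ i)]"

lemma apply_euler_op: "apply_op (euler_op i) f x = of_real (x ^ i) * nderiv i f x"
  by (simp add: apply_op_def euler_op_def nth_append)

lemma diff_op_on_euler_op: "open U \<Longrightarrow> diff_op_on U (euler_op i)"
  using smooth_on_power[of U i] smooth_on_const[of U 0] by (auto simp: diff_op_on_def euler_op_def)

lemma transpose_euler_op:
  "transpose_op (euler_op i) f x = (- 1) ^ i * nderiv i (\<lambda>t. of_real (t ^ i) * f t) x"
  using nderiv_const[OF open_UNIV, of x _ 0]
  by (simp add: transpose_op_def euler_op_def nth_append)

lemma tangential_euler_op: "tangential U 0 (euler_op i)"
  unfolding tangential_def fun_vanishes_to_order_def apply_euler_op[abs_def]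
  by (blast intro: power_mult_nderiv_in_point_ideal_power)

text \<open>Applying a tangential operator to \<open>x ^ i\<close> isolates its \<open>i\<close>-th coefficient modulo
  lower ones.\<close>

lemma tangential_coefficient:
  assumes U: "open U" "0 \<in> U" and D: "diff_op_on U D" "tangential U 0 D" and i: "i < length D"
  shows "zero_of_order U 0 i (D ! i)"
  using i
proof (induction i rule: less_induct)
  case (less i)
  \<comment> \<open>On x^i the l-th derivative gives \<open>P l\<close> times x^(i-l). Truncated
    subtraction makes \<open>P l\<close> zero for l > i. For l < i the order l of the coefficient,
    known by induction, and the order i - l of the power add up to i. What remains is the term l = i
    with the nonzero constant \<open>P i\<close>.\<close>
  define P :: "nat \<Rightarrow> nat" where "P l = (\<Prod>j<l. i - j)" for l
  define q :: "nat \<Rightarrow> real \<Rightarrow> complex" where "q l x = (D ! l) x * (of_nat (P l) * of_real (x ^ (i - l)))" for l x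
  have sm: "smooth_on U (D ! l)" if "l < length D" for l
    using D(1) that by (auto simp: diff_op_on_def)
  have P0: "P l = 0" if "l > i" for l
    using that by (auto simp: P_def)
  have Pi: "P i \<noteq> 0" by (auto simp: P_def)
  have q: "zero_of_order U 0 i (q l)" if l: "l < length D" "l \<noteq> i" for l
  proof (cases "l < i")
    case True
    have "zero_of_order U 0 (l + (i - l)) (q l)"
      unfolding q_def using less.IH[OF True l(1)] U
      by (intro zero_of_order_mult zero_of_order_cmult zero_of_order_power) auto
    then show ?thesis using True by simp
  next
    case False
    then show ?thesis using l P0[of l] U
      by (simp add: q_def[abs_def] zero_of_order_def smooth_on_const nderiv_const[OF U])
  qed
  have "apply_op D (\<lambda>x. of_real (x ^ i)) \<in> point_ideal_power U 0 i"
    using D(2) U power_in_point_ideal_power[OF U(1), of i]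
    by (auto simp: tangential_def fun_vanishes_to_order_def)
  then have z: "zero_of_order U 0 i (apply_op D (\<lambda>x. of_real (x ^ i)))"
    using U by (intro point_ideal_power_zero_of_order)
  have eq: "(D ! i) x = (1 / of_nat (P i)) * (apply_op D (\<lambda>x. of_real (x ^ i)) x - (\<Sum>l\<in>{..<length D} - {i}. q l x))"
    if "x \<in> U" for x
  proof -
    have "apply_op D (\<lambda>x. of_real (x ^ i)) x = (\<Sum>l<length D. q l x)"
      unfolding apply_op_def q_def P_def using nderiv_power[OF U(1) that, where m = i] by simp
    also have "\<dots> = q i x + (\<Sum>l\<in>{..<length D} - {i}. q l x)"
      using less.prems by (subst sum.remove[of _ i]) auto
    finally show ?thesis using Pi by (simp add: q_def)
  qed
  have "zero_of_order U 0 i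
      (\<lambda>x. (1 / of_nat (P i)) * (apply_op D (\<lambda>x. of_real (x ^ i)) x - (\<Sum>l\<in>{..<length D} - {i}. q l x)))"
    by (intro zero_of_order_cmult zero_of_order_diff zero_of_order_sum U z q) auto
  from zero_of_order_cong[OF U eq this] show ?case .
qed

text \<open>Induction on n for all f at once: f' vanishes to order n, and the mean value inequality
  on the segment from 0 to x turns its bound C |x|^n into one of order n + 1 for f.\<close>

lemma zero_of_order_bound:
  assumes U: "{-e..e} \<subseteq> U" and f: "zero_of_order U 0 n f"
  shows "\<exists>C. \<forall>x\<in>{-e..e}. norm (f x) \<le> C * \<bar>x\<bar> ^ n"
  using f
proof (induction n arbitrary: f)
  case 0
  obtain B where "\<And>x. x \<in> {-e..e} \<Longrightarrow> norm (nderiv 0 f x) \<le> B"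
    by (rule smooth_on_bounded[OF zero_of_order_smooth[OF 0] U]) blast
  then have "\<forall>x\<in>{-e..e}. norm (f x) \<le> B * \<bar>x\<bar> ^ 0" by simp
  then show ?case ..
next
  case (Suc n)
  have "zero_of_order U 0 n (nderiv 1 f)"
    using Suc.prems zero_of_order_nderiv[of U 0 1 n f] by simp
  then obtain C where C: "\<And>x. x \<in> {-e..e} \<Longrightarrow> norm (nderiv 1 f x) \<le> C * \<bar>x\<bar> ^ n"
    using Suc.IH by blast
  show ?case
  proof (intro exI[of _ "\<bar>C\<bar>"] ballI)
    fix x assume x: "x \<in> {-e..e}"
    have seg: "y \<in> {-e..e} \<and> \<bar>y\<bar> \<le> \<bar>x\<bar>" if "y \<in> closed_segment 0 x" for y
      using that x by (auto simp: closed_segment_eq_real_ivl split: if_splits)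
    have "norm (f x - f 0) \<le> (\<bar>C\<bar> * \<bar>x\<bar> ^ n) * \<bar>x - 0\<bar>"
    proof (rule vector_derivative_bound)
      fix y assume y: "y \<in> closed_segment 0 x"
      show "(f has_vector_derivative nderiv 1 f y) (at y within closed_segment 0 x)"
      proof (rule has_vector_derivative_at_within)
        have "y \<in> U" using seg[OF y] U by blast
        from smooth_onD[OF zero_of_order_smooth[OF Suc.prems] this, of 0]
        show "(f has_vector_derivative nderiv 1 f y) (at y)"
          unfolding nderiv_0 One_nat_def .
      qed
      have "norm (nderiv 1 f y) \<le> C * \<bar>y\<bar> ^ n" using C seg[OF y] by blast
      also have "\<dots> \<le> \<bar>C\<bar> * \<bar>x\<bar> ^ n"
        using seg[OF y] by (intro mult_mono power_mono) auto
      finally show "norm (nderiv 1 f y) \<le> \<bar>C\<bar> * \<bar>x\<bar> ^ n" .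
    qed
    moreover have "nderiv 0 f 0 = 0"
      using Suc.prems unfolding zero_of_order_def by blast
    ultimately show "norm (f x) \<le> \<bar>C\<bar> * \<bar>x\<bar> ^ Suc n" by (simp add: mult.assoc mult.commute[of "\<bar>x\<bar>"])
  qed
qed

subsection \<open>Moving powers across derivatives\<close>

lemma sum_atMost_pad:
  fixes a :: "nat \<Rightarrow> 'a::comm_monoid_add"
  assumes "M \<le> M'"
  shows "(\<Sum>i\<le>M. a i) = (\<Sum>i\<le>M'. if i \<le> M then a i else 0)"
proof -
  have "{..M'} \<inter> {i. i \<le> M} = {..M}" using assms by auto
  then show ?thesis by (simp add: sum.If_cases)
qed

text \<open>A normal form with all derivatives outside, which suits both of its uses. On the one
  hand (d/dx)^i x^i is up to sign the transpose of \<open>euler_op i\<close>. On the other hand,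
  under the Fourier transform the inner power differentiates the test function, while the outer
  derivative only multiplies by a power of y.\<close>

definition euler_form :: "nat \<Rightarrow> ((real \<Rightarrow> complex) \<Rightarrow> real \<Rightarrow> complex) \<Rightarrow> bool" where
  "euler_form k L \<longleftrightarrow> (\<exists>c M. \<forall>f. smooth_on UNIV f \<longrightarrow>
     (\<forall>x. L f x = (\<Sum>i\<le>M. c i * nderiv i (\<lambda>t. of_real (t ^ (k + i)) * f t) x)))"

lemma euler_form_base: "euler_form k (\<lambda>f. nderiv i (\<lambda>t. of_real (t ^ (k + i)) * f t))"
  unfolding euler_form_def
  by (rule exI[of _ "\<lambda>j. if j = i then 1 else 0"], rule exI[of _ i])
    (auto simp: sum.delta if_distrib[of "\<lambda>z. z * _"] cong: if_cong)

lemma euler_form_cmult: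
  assumes "euler_form k L"
  shows "euler_form k (\<lambda>f x. a * L f x)"
proof -
  from assms obtain c M where
    "\<And>f x. smooth_on UNIV f \<Longrightarrow> L f x = (\<Sum>i\<le>M. c i * nderiv i (\<lambda>t. of_real (t ^ (k + i)) * f t) x)"
    unfolding euler_form_def by blast
  then show ?thesis unfolding euler_form_def
    by (intro exI[of _ "\<lambda>i. a * c i"] exI[of _ M]) (simp add: sum_distrib_left mult.assoc)
qed

lemma euler_form_add:
  assumes "euler_form k L" "euler_form k L'"
  shows "euler_form k (\<lambda>f x. L f x + L' f x)"
proof -
  from assms(1) obtain c M where
    1: "\<And>f x. smooth_on UNIV f \<Longrightarrow> L f x = (\<Sum>i\<le>M. c i * nderiv i (\<lambda>t. of_real (t ^ (k + i)) * f t) x)"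
    unfolding euler_form_def by blast
  from assms(2) obtain c' M' where
    2: "\<And>f x. smooth_on UNIV f \<Longrightarrow> L' f x = (\<Sum>i\<le>M'. c' i * nderiv i (\<lambda>t. of_real (t ^ (k + i)) * f t) x)"
    unfolding euler_form_def by blast
  show ?thesis unfolding euler_form_def
  proof (intro exI allI impI)
    fix f x assume f: "smooth_on UNIV f"
    show "L f x + L' f x = (\<Sum>i\<le>max M M'. ((if i \<le> M then c i else 0) + (if i \<le> M' then c' i else 0)) *
        nderiv i (\<lambda>t. of_real (t ^ (k + i)) * f t) x)"
      unfolding 1[OF f] 2[OF f] distrib_right sum.distrib
      by (subst sum_atMost_pad[of M "max M M'"], simp, subst sum_atMost_pad[of M' "max M M'"], simp)
        (intro arg_cong2[where f = "(+)"] sum.cong; simp)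
  qed
qed

lemma euler_form_sum:
  assumes "finite I" "\<And>j. j \<in> I \<Longrightarrow> euler_form k (L j)"
  shows "euler_form k (\<lambda>f x. \<Sum>j\<in>I. L j f x)"
  using assms
proof (induction I rule: finite_induct)
  case empty
  show ?case using euler_form_cmult[OF euler_form_base, of k 0 0] by simp
next
  case (insert j I)
  then show ?case using euler_form_add[of k "L j" "\<lambda>f x. \<Sum>j\<in>I. L j f x"] by simp
qed

lemma euler_form_cong:
  assumes "euler_form k L" "\<And>f x. smooth_on UNIV f \<Longrightarrow> L' f x = L f x"
  shows "euler_form k L'"
  using assms unfolding euler_form_def by simp

text \<open>The Leibniz formula for the m-th derivative of x^(k+m) f is solved for its term x^(k+m)
  f^(m). Every other term has the form x^(k+m-j) f^(m-j), which is the same operator for a smaller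
  m, so strong induction applies.\<close>

lemma euler_form_power_nderiv: "euler_form k (\<lambda>f x. of_real (x ^ (k + m)) * nderiv m f x)"
proof (induction m rule: less_induct)
  case (less m)
  define b :: "nat \<Rightarrow> complex" where "b j = of_nat (m choose j) * of_nat (\<Prod>l<j. k + m - l)" for j
  have "euler_form k (\<lambda>f x. nderiv m (\<lambda>t. of_real (t ^ (k + m)) * f t) x +
      (\<Sum>j\<in>{1..m}. (- b j) * (of_real (x ^ (k + (m - j))) * nderiv (m - j) f x)))"
    by (intro euler_form_add euler_form_base euler_form_sum euler_form_cmult less) auto
  then show ?case
  proof (rule euler_form_cong)
    fix f x assume f: "smooth_on UNIV f"
    have "nderiv m (\<lambda>t. of_real (t ^ (k + m)) * f t) x =
        (\<Sum>j\<le>m. b j * (of_real (x ^ (k + (m - j))) * nderiv (m - j) f x))"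
      unfolding nderiv_mult[OF open_UNIV smooth_on_power[OF open_UNIV] f UNIV_I]
        nderiv_power[OF open_UNIV UNIV_I] b_def by (intro sum.cong) (auto simp: mult_ac)
    also have "\<dots> = of_real (x ^ (k + m)) * nderiv m f x +
        (\<Sum>j\<in>{1..m}. b j * (of_real (x ^ (k + (m - j))) * nderiv (m - j) f x))"
      by (simp add: atMost_atLeast0 sum.atLeast_Suc_atMost[of 0] b_def)
    finally show "of_real (x ^ (k + m)) * nderiv m f x =
        nderiv m (\<lambda>t. of_real (t ^ (k + m)) * f t) x +
        (\<Sum>j\<in>{1..m}. (- b j) * (of_real (x ^ (k + (m - j))) * nderiv (m - j) f x))"
      by (simp add: sum_negf)
  qed
qed

subsection \<open>A smooth cutoff function\<close>

lemma poly_times_exp_tendsto_0: "((\<lambda>t::real. poly p t * exp (- t)) \<longlongrightarrow> 0) at_top"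
proof -
  have "((\<lambda>t::real. \<Sum>i\<le>degree p. coeff p i * (t ^ i / exp t)) \<longlongrightarrow> (\<Sum>i\<le>degree p. coeff p i * 0)) at_top"
    by (intro tendsto_intros tendsto_power_div_exp_0)
  then show ?thesis
    by (simp add: poly_altdef sum_distrib_right exp_minus divide_inverse mult.assoc)
qed

text \<open>The function exp(-1/x) for x > 0, continued by 0. The real function r is returned
  together with f so that positivity can be stated; it shows in \<open>smooth_step\<close> that the
  normalising integral is not zero.\<close>

lemma flat_function:
  obtains f :: "real \<Rightarrow> complex" and r :: "real \<Rightarrow> real" where "smooth_on UNIV f" "\<And>x. f x = of_real (r x)"
    "\<And>x. x \<le> 0 \<Longrightarrow> r x = 0" "\<And>x. x > 0 \<Longrightarrow> r x > 0"
proof -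
  \<comment> \<open>With t = 1/x, the x-derivative of p(t) exp(-t) is t^2 (p(t) - p'(t)) exp(-t);
    the polynomial \<open>[:0, 0, 1:]\<close> is t^2.\<close>
  define P :: "nat \<Rightarrow> real poly" where "P = rec_nat 1 (\<lambda>_ p. [:0, 0, 1:] * (p - pderiv p))"
  have P_Suc: "P (Suc n) = [:0, 0, 1:] * (P n - pderiv (P n))" for n by (simp add: P_def)
  define R where "R n x = (if x > 0 then poly (P n) (1 / x) * exp (- (1 / x)) else 0)" for n and x :: real
  have der: "(R n has_real_derivative R (Suc n) x) (at x)" for n x
  proof (cases x "0 :: real" rule: linorder_cases)
    case greater
    have "((\<lambda>x. poly (P n) (1 / x) * exp (- (1 / x))) has_real_derivative
        poly (pderiv (P n)) (1 / x) * (- 1 / x ^ 2) * exp (- (1 / x)) +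
        exp (- (1 / x)) * (1 / x ^ 2) * poly (P n) (1 / x)) (at x)"
      using greater
      by (auto intro!: derivative_eq_intros DERIV_chain2[OF poly_DERIV] simp: power2_eq_square)
    also have "poly (pderiv (P n)) (1 / x) * (- 1 / x ^ 2) * exp (- (1 / x)) +
        exp (- (1 / x)) * (1 / x ^ 2) * poly (P n) (1 / x) = R (Suc n) x"
      using greater by (simp add: R_def P_Suc power2_eq_square field_simps)
    finally show ?thesis
      by (rule has_field_derivative_transform_within_open[where S = "{0<..}"]) (use greater in \<open>auto simp: R_def\<close>)
  next
    case less
    have "((\<lambda>_. 0) has_real_derivative R (Suc n) x) (at x)" using less by (simp add: R_def)
    then show ?thesis
      by (rule has_field_derivative_transform_within_open[where S = "{..<0}"]) (use less in \<open>auto simp: R_def\<close>)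
  next
    case equal
    have "((\<lambda>h. R n h / h) \<longlongrightarrow> 0) (at_right 0)"
    proof -
      \<comment> \<open>The difference quotient at 0 is again a polynomial in 1/h times exp(-1/h),
        with the additional factor 1/h written as \<open>[:0, 1:]\<close>.\<close>
      have "((\<lambda>h. poly ([:0, 1:] * P n) (inverse h) * exp (- inverse h)) \<longlongrightarrow> 0) (at_right (0::real))"
        by (rule filterlim_compose[OF poly_times_exp_tendsto_0 filterlim_inverse_at_top_right])
      then show ?thesis
        by (rule Lim_transform_eventually)
          (auto simp: eventually_at_right_less R_def field_simps intro!: eventually_mono[OF eventually_at_right_less[of 0]])
    qed
    moreover have "((\<lambda>h. R n h / h) \<longlongrightarrow> 0) (at_left 0)"
    proof -
      have "((\<lambda>h::real. 0 :: real) \<longlongrightarrow> 0) (at_left 0)" by simp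
      then show ?thesis
        by (rule Lim_transform_eventually)
          (auto simp: R_def eventually_at_filter)
    qed
    ultimately have "((\<lambda>h. R n h / h) \<longlongrightarrow> 0) (at 0)"
      by (simp add: filterlim_at_split)
    then show ?thesis by (simp add: equal DERIV_def R_def)
  qed
  have "smooth_on UNIV (\<lambda>x. of_real (R 0 x))"
  proof (rule smooth_on_derivative_sequence[where F = "\<lambda>n x. of_real (R n x)"])
    show "((\<lambda>x. of_real (R n x)) has_vector_derivative (of_real (R (Suc n) x) :: complex)) (at x)" for n x
      using der[of n x] by (intro has_vector_derivative_of_real)
        (simp add: has_real_derivative_iff_has_vector_derivative)
  qed auto
  then show ?thesis
    by (rule that[where r = "R 0"]) (auto simp: R_def P_def)
qed

lemma smooth_step:
  obtains s :: "real \<Rightarrow> complex" where "smooth_on UNIV s" "\<And>x. x \<le> 0 \<Longrightarrow> s x = 0" "\<And>x. x \<ge> 1 \<Longrightarrow> s x = 1"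
proof -
  obtain f r where f: "smooth_on UNIV f" "\<And>x. f x = of_real (r x)"
    "\<And>x. x \<le> 0 \<Longrightarrow> r x = 0" "\<And>x. x > 0 \<Longrightarrow> r x > 0" by (rule flat_function) blast
  have r0: "r x \<ge> 0" for x using f(3,4)[of x] by (cases "x \<le> 0") auto
  define b where "b x = f x * f (- 1 * x + 1)" for x
  have b: "smooth_on UNIV b"
    unfolding b_def[abs_def] by (intro smooth_on_mult smooth_on_affine f) auto
  note cb = continuous_on_subset[OF smooth_on_continuous0[OF b] subset_UNIV]
  \<comment> \<open>The bump b is supported in [0, 1]. Integrating from -1 instead of 0 makes x = 0
    an interior point of \<open>{-1..x + 1}\<close>, so that the fundamental theorem gives a
    two-sided derivative there.\<close>
  define p where "p x = integral {-1..x} b" for x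
  have p0: "p x = 0" if "x \<le> 0" for x
  proof -
    have "p x = integral {-1..x} (\<lambda>_. 0)"
      unfolding p_def by (intro integral_cong) (use that f in \<open>auto simp: b_def\<close>)
    then show ?thesis by simp
  qed
  have p1: "p x = p 1" if "x \<ge> 1" for x
  proof -
    have "p x = p 1 + integral {1..x} b"
      unfolding p_def using that
      by (intro Henstock_Kurzweil_Integration.integral_combine[symmetric] integrable_continuous_real cb) auto
    also have "integral {1..x} b = integral {1..x} (\<lambda>_. 0)"
      by (intro integral_cong) (use that f in \<open>auto simp: b_def\<close>)
    finally show ?thesis by simp
  qed
  have nz: "p 1 \<noteq> 0"
  proof
    assume "p 1 = 0"
    have br: "b x = of_real (r x * r (1 - x))" for x by (simp add: b_def f(2))
    have c: "continuous_on {-1..1} (\<lambda>x. r x * r (1 - x))"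
      using continuous_on_Re[OF cb[of "{-1..1}"]] by (simp add: br)
    have "p 1 = of_real (integral {-1..1} (\<lambda>x. r x * r (1 - x)))"
      unfolding p_def br
      by (rule integral_unique, rule has_integral_of_real, rule integrable_integral,
        rule integrable_continuous_real, rule c)
    then have "integral (cbox (-1) 1) (\<lambda>x. r x * r (1 - x)) = 0" using \<open>p 1 = 0\<close> by simp
    then have "r (1/2) * r (1 - 1/2) = 0"
      using c r0 integral_eq_0_iff[of "-1" "1::real" "\<lambda>x. r x * r (1 - x)"] by auto
    then show False using f(4)[of "1/2"] by simp
  qed
  have dp: "(p has_vector_derivative b x) (at x)" for x
  proof (cases "x < 0")
    case True
    have "((\<lambda>_. 0) has_vector_derivative b x) (at x)"
      using True f by (simp add: b_def)
    then show ?thesis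
      by (rule has_vector_derivative_transform_within_open[where S = "{..<0}"]) (use True p0 in auto)
  next
    case False
    have "(p has_vector_derivative b x) (at x within {-1..x + 1})"
      unfolding p_def by (rule integral_has_vector_derivative) (use False cb in auto)
    then show ?thesis
      using False by (subst (asm) at_within_interior) (auto simp: interior_cbox[of "-1" "x+1", simplified])
  qed
  have sp: "smooth_on UNIV p"
  proof (rule smooth_on_derivative_sequence[where F = "\<lambda>n. if n = 0 then p else nderiv (n - 1) b"])
    show "((if n = 0 then p else nderiv (n - 1) b) has_vector_derivative
        (if Suc n = 0 then p else nderiv (Suc n - 1) b) x) (at x)" for n x
      using dp[of x] smooth_onD[OF b UNIV_I, of "n - 1" x] by (cases n) auto
  qed auto
  show ?thesis
  proof (rule that)
    show "smooth_on UNIV (\<lambda>x. (1 / p 1) * p x)" by (intro smooth_on_cmult sp) auto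
    show "1 / p 1 * p x = 0" if "x \<le> 0" for x using p0[OF that] by simp
    show "1 / p 1 * p x = 1" if "x \<ge> 1" for x using p1[OF that] nz by simp
  qed
qed

lemma smooth_cutoff:
  obtains \<kappa> :: "real \<Rightarrow> complex" where "smooth_on UNIV \<kappa>"
    "\<And>x. \<bar>x\<bar> \<le> 1 \<Longrightarrow> \<kappa> x = 1" "\<And>x. \<bar>x\<bar> \<ge> 2 \<Longrightarrow> \<kappa> x = 0"
proof -
  obtain s where s: "smooth_on UNIV s" "\<And>x. x \<le> 0 \<Longrightarrow> s x = 0" "\<And>x. x \<ge> 1 \<Longrightarrow> s x = 1"
    by (rule smooth_step) blast
  show ?thesis
  proof (rule that)
    show "smooth_on UNIV (\<lambda>x. s (1 * x + 2) * s (- 1 * x + 2))"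
      by (intro smooth_on_mult smooth_on_affine s) auto
  qed (use s in \<open>auto simp: abs_if split: if_splits\<close>)
qed

subsection \<open>Smooth measures in the coordinate at infinity\<close>

lemma inverse_has_real_derivative:
  fixes y :: real
  assumes "y \<noteq> 0"
  shows "((\<lambda>y. 1 / y) has_real_derivative - ((1 / y) ^ 2)) (at y)"
  using assms by (auto intro!: derivative_eq_intros simp: power2_eq_square)

lemma inverse_power_has_vector_derivative:
  fixes y :: real
  assumes "y \<noteq> 0"
  shows "((\<lambda>y. of_real ((1 / y) ^ p) :: complex) has_vector_derivative
    - of_nat p * of_real ((1 / y) ^ (p + 1))) (at y)"
proof -
  have "((\<lambda>y. (1 / y) ^ p) has_real_derivative of_nat p * (1 / y) ^ (p - 1) * - ((1 / y) ^ 2)) (at y)"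
    by (rule DERIV_power[OF inverse_has_real_derivative[OF assms], THEN DERIV_cong]) (simp add: mult_ac)
  also have "of_nat p * (1 / y) ^ (p - 1) * - ((1 / y) ^ 2) = - of_nat p * (1 / y) ^ (p + 1)"
    using assms by (cases p) (simp_all add: power2_eq_square field_simps)
  finally have "((\<lambda>y. of_real ((1 / y) ^ p) :: complex) has_vector_derivative
      of_real (- of_nat p * (1 / y) ^ (p + 1))) (at y)"
    by (intro has_vector_derivative_of_real) (simp add: has_real_derivative_iff_has_vector_derivative)
  then show ?thesis by simp
qed

text \<open>The coefficients of the m-th y-derivative of u^2 \<psi>(u), where u = 1/y and d/dy = -
  u^2 d/du. Differentiating u^(m+i+2) gives the first summand of the recursion; differentiating the
  i-th derivative of \<psi> brings in - u^2, moves i to i + 1 and gives the second.\<close>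

fun inv_coeff :: "nat \<Rightarrow> nat \<Rightarrow> complex" where
  "inv_coeff 0 i = (if i = 0 then 1 else 0)"
| "inv_coeff (Suc m) i = - of_nat (m + i + 2) * inv_coeff m i - (if i = 0 then 0 else inv_coeff m (i - 1))"

lemma inv_coeff_eq_0: "i > m \<Longrightarrow> inv_coeff m i = 0"
  by (induction m arbitrary: i) auto

text \<open>The part m + 2 of the exponent m + i + 2 is the source of the decay at infinity; the
  remaining u^i accompanies the i-th derivative of \<psi>, as in an Euler operator at u = 0.\<close>

lemma
  assumes \<psi>: "smooth_on UNIV \<psi>" and \<phi>: "\<And>y. y \<noteq> 0 \<Longrightarrow> \<phi> y = inv_density \<psi> y"
  shows smooth_on_inv_density: "smooth_on (- {0}) \<phi>"
    and nderiv_inv_density: "y \<noteq> 0 \<Longrightarrow> nderiv m \<phi> y = (\<Sum>i\<le>m. inv_coeff m i * (of_real ((1 / y) ^ (m + i + 2)) * nderiv i \<psi> (1 / y)))"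
proof -
  define F where "F m y = (\<Sum>i\<le>m. inv_coeff m i * (of_real ((1 / y) ^ (m + i + 2)) * nderiv i \<psi> (1 / y)))" for m y
  have F: "(F m has_vector_derivative F (Suc m) y) (at y)" if y: "y \<in> - {0}" for m y
  proof -
    define a where "a i = of_real ((1 / y) ^ (m + i + 3)) * nderiv i \<psi> (1 / y)" for i
    have y': "y \<noteq> 0" using y by simp
    have ps: "((\<lambda>y. nderiv i \<psi> (1 / y)) has_vector_derivative
        - of_real ((1 / y) ^ 2) * nderiv (Suc i) \<psi> (1 / y)) (at y)" for i
      using vector_diff_chain_at[OF inverse_has_real_derivative[OF y', unfolded has_real_derivative_iff_has_vector_derivative]
          smooth_onD[OF \<psi> UNIV_I]]
      by (simp add: o_def scaleR_conv_of_real)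
    have "((\<lambda>y. inv_coeff m i * (of_real ((1 / y) ^ (m + i + 2)) * nderiv i \<psi> (1 / y))) has_vector_derivative
        (- of_nat (m + i + 2) * inv_coeff m i) * a i - inv_coeff m i * a (Suc i)) (at y)" for i
    proof -
      have "inv_coeff m i * (of_real ((1 / y) ^ (m + i + 2)) * (- of_real ((1 / y) ^ 2) * nderiv (Suc i) \<psi> (1 / y)) +
            (- of_nat (m + i + 2) * of_real ((1 / y) ^ (m + i + 2 + 1))) * nderiv i \<psi> (1 / y)) =
          (- of_nat (m + i + 2) * inv_coeff m i) * a i - inv_coeff m i * a (Suc i)"
        by (simp add: a_def algebra_simps power_add eval_nat_numeral del: inv_coeff.simps of_nat_Suc)
      then show ?thesis
        using has_vector_derivative_mult_right[OF has_vector_derivative_mult[OF inverse_power_has_vector_derivative[OF y', of "m + i + 2"] ps], of "inv_coeff m i" i]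
        by simp
    qed
    then have "(F m has_vector_derivative (\<Sum>i\<le>m. (- of_nat (m + i + 2) * inv_coeff m i) * a i - inv_coeff m i * a (Suc i))) (at y)"
      unfolding F_def[abs_def] by (intro has_vector_derivative_sum)
    \<comment> \<open>The term i = \<open>Suc m\<close> may be added to the first sum since
      \<open>inv_coeff m\<close> vanishes there; the second sum is shifted by one.\<close>
    also have "(\<Sum>i\<le>m. (- of_nat (m + i + 2) * inv_coeff m i) * a i - inv_coeff m i * a (Suc i)) =
        (\<Sum>i\<le>Suc m. (- of_nat (m + i + 2) * inv_coeff m i) * a i) -
        (\<Sum>i\<le>Suc m. (if i = 0 then 0 else inv_coeff m (i - 1)) * a i)"
      by (subst (2) sum.atMost_Suc_shift) (simp add: sum_subtractf inv_coeff_eq_0)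
    also have "\<dots> = (\<Sum>i\<le>Suc m. inv_coeff (Suc m) i * a i)"
      by (simp only: inv_coeff.simps left_diff_distrib sum_subtractf)
    also have "\<dots> = F (Suc m) y"
    proof -
      have e: "m + i + 3 = Suc m + i + 2" for i by simp
      show ?thesis unfolding F_def a_def e ..
    qed
    finally show ?thesis .
  qed
  have 0: "\<phi> y = F 0 y" if "y \<in> - {0}" for y
    using \<phi>[of y] that by (simp add: F_def inv_density_def power_divide power2_eq_square)
  show "smooth_on (- {0}) \<phi>"
    by (rule smooth_on_derivative_sequence[OF _ 0 F]) auto
  show "nderiv m \<phi> y = (\<Sum>i\<le>m. inv_coeff m i * (of_real ((1 / y) ^ (m + i + 2)) * nderiv i \<psi> (1 / y)))"
    if "y \<noteq> 0"
    using nderiv_derivative_sequence[of "- {0}" \<phi> F y m, OF _ 0 F] that by (simp add: F_def open_Compl)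
qed

lemma rp1_measures_inv_density:
  assumes "(\<phi>, \<psi>) \<in> rp1_measures" "y \<noteq> 0"
  shows "\<phi> y = inv_density \<psi> y"
proof -
  have "\<psi> (1 / y) = inv_density \<phi> (1 / y)" using assms by (auto simp: rp1_measures_def)
  then show ?thesis using assms(2) by (simp add: inv_density_def power_divide)
qed

text \<open>If \<psi> vanishes beyond R, the density in the other coordinate vanishes for |y| < 1/R,
  the value at y = 0 being 0 because division by zero yields 0. So the singularity of the coordinate
  change is harmless.\<close>

lemma inv_density_rp1_measures:
  assumes \<psi>: "\<psi> \<in> test_functions UNIV"
  shows "(inv_density \<psi>, \<psi>) \<in> rp1_measures"
proof -
  have s: "smooth_on UNIV \<psi>" using \<psi> by (auto simp: test_functions_def)
  obtain K where "compact K" "\<And>x. x \<notin> K \<Longrightarrow> \<psi> x = 0" using \<psi> by (auto simp: test_functions_def)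
  then obtain R where R: "R > 0" "\<And>x. \<bar>x\<bar> > R \<Longrightarrow> \<psi> x = 0"
    by (metis bounded_pos compact_imp_bounded not_le real_norm_def)
  have "smooth_on {-(1/R)<..<1/R} (inv_density \<psi>)"
  proof (rule smooth_on_cong[OF _ _ smooth_on_const[where c = 0]])
    fix y assume y: "y \<in> {-(1/R)<..<1/R}"
    have "R < \<bar>1 / y\<bar>" if "y \<noteq> 0"
      using y that R(1) by (simp add: abs_less_iff field_simps abs_if split: if_splits)
    then show "inv_density \<psi> y = 0" using R(2) by (cases "y = 0") (auto simp: inv_density_def)
  qed auto
  moreover have "smooth_on (- {0}) (inv_density \<psi>)"
    by (rule smooth_on_inv_density[OF s]) simp
  ultimately have "smooth_on UNIV (inv_density \<psi>)"
    using R(1) unfolding smooth_on_def by (metis Compl_iff UNIV_I divide_pos_pos greaterThanLessThan_iff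
      neg_less_0_iff_less singletonD zero_less_one)
  then show ?thesis using s by (auto simp: rp1_measures_def inv_density_def power_divide)
qed

section \<open>Decay of smooth measures at infinity\<close>

lemma integrable_inverse_square: "integrable lborel (\<lambda>x::real. 1 / (1 + x ^ 2))"
  using integrable_inverse_1_plus_square by (simp add: set_integrable_def inverse_eq_divide)

lemma rp1_measures_smooth:
  assumes "(\<phi>, \<psi>) \<in> rp1_measures"
  shows "smooth_on UNIV \<phi>" "smooth_on UNIV \<psi>"
  using assms by (auto simp: rp1_measures_def)

lemma norm_nderiv_le_SUP:
  assumes "smooth_on UNIV f" "x \<in> {-1..1::real}"
  shows "norm (nderiv n f x) \<le> (SUP x\<in>{-1..1}. norm (nderiv n f x))"
proof (rule cSUP_upper[OF assms(2)])
  have "continuous_on {-1..1} (\<lambda>x. norm (nderiv n f x))"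
    by (intro continuous_intros continuous_on_subset[OF smooth_on_continuous[OF assms(1)]]) auto
  then have "compact ((\<lambda>x. norm (nderiv n f x)) ` {-1..1})"
    by (intro compact_continuous_image) auto
  then show "bdd_above ((\<lambda>x. norm (nderiv n f x)) ` {-1..1})"
    by (intro bounded_imp_bdd_above compact_imp_bounded)
qed

lemma SUP_norm_nderiv_nonneg:
  assumes "smooth_on UNIV f"
  shows "0 \<le> (SUP x\<in>{-1..1}. norm (nderiv n f x))"
  by (rule order_trans[OF norm_ge_zero norm_nderiv_le_SUP[OF assms, of 0]]) simp

definition rp1_seminorm :: "nat \<Rightarrow> (real \<Rightarrow> complex) \<Rightarrow> (real \<Rightarrow> complex) \<Rightarrow> real" where
  "rp1_seminorm m \<phi> \<psi> =
     (\<Sum>n\<le>m. (SUP x\<in>{-1..1}. norm (nderiv n \<phi> x)) + (SUP u\<in>{-1..1}. norm (nderiv n \<psi> u)))"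

lemma norm_nderiv_le_rp1_seminorm:
  assumes "smooth_on UNIV \<phi>" "smooth_on UNIV \<psi>" "n \<le> m" "x \<in> {-1..1}"
  shows "norm (nderiv n \<phi> x) + norm (nderiv n \<psi> x) \<le> rp1_seminorm m \<phi> \<psi>"
proof -
  have "norm (nderiv n \<phi> x) + norm (nderiv n \<psi> x) \<le>
      (SUP x\<in>{-1..1}. norm (nderiv n \<phi> x)) + (SUP u\<in>{-1..1}. norm (nderiv n \<psi> u))"
    by (intro add_mono norm_nderiv_le_SUP assms)
  also have "\<dots> \<le> rp1_seminorm m \<phi> \<psi>"
    unfolding rp1_seminorm_def
    using assms(3)
    by (intro member_le_sum[of n "{..m}" "\<lambda>n. (SUP x\<in>{-1..1}. norm (nderiv n \<phi> x)) + (SUP u\<in>{-1..1}. norm (nderiv n \<psi> u))"])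
      (auto intro!: add_nonneg_nonneg SUP_norm_nderiv_nonneg assms)
  finally show ?thesis .
qed

lemma rp1_seminorm_mono:
  assumes "smooth_on UNIV \<phi>" "smooth_on UNIV \<psi>" "m \<le> m'"
  shows "rp1_seminorm m \<phi> \<psi> \<le> rp1_seminorm m' \<phi> \<psi>"
  unfolding rp1_seminorm_def
  using assms(3)
  by (intro sum_mono2) (auto intro!: add_nonneg_nonneg SUP_norm_nderiv_nonneg assms)

text \<open>The power of 2 comes from 1 + |y| \<le> 2 where |y| \<le> 1, and from 1 + |y| \<le> 2
  |y| elsewhere. The summand 1 serves the first region, the sum of coefficients the second.\<close>

definition decay_const :: "nat \<Rightarrow> real" where
  "decay_const m = 2 ^ (m + 2) * (1 + (\<Sum>i\<le>m. norm (inv_coeff m i)))"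

text \<open>For |y| > 1 the derivative is expressed through \<psi> at 1/y, a point of [-1, 1] where
  the seminorm controls \<psi>, and the powers of 1/y supply the decay. For |y| \<le> 1 the seminorm
  controls the derivative directly.\<close>

lemma rp1_measures_decay:
  assumes "(\<phi>, \<psi>) \<in> rp1_measures"
  shows "norm (nderiv m \<phi> y) * (1 + \<bar>y\<bar>) ^ (m + 2) \<le> decay_const m * rp1_seminorm m \<phi> \<psi>"
proof -
  note sm = rp1_measures_smooth[OF assms]
  define A where "A = rp1_seminorm m \<phi> \<psi>"
  define S where "S = (\<Sum>i\<le>m. norm (inv_coeff m i))"
  have A\<phi>: "norm (nderiv n \<phi> x) \<le> A" and A\<psi>: "norm (nderiv n \<psi> x) \<le> A"
    if "n \<le> m" "x \<in> {-1..1}" for n x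
    using norm_nderiv_le_rp1_seminorm[OF sm that] norm_ge_zero[of "nderiv n \<phi> x"]
      norm_ge_zero[of "nderiv n \<psi> x"] unfolding A_def by linarith+
  have A0: "A \<ge> 0" by (rule order_trans[OF norm_ge_zero A\<phi>[of 0 0]]) auto
  have S0: "S \<ge> 0" unfolding S_def by (intro sum_nonneg) auto
  show ?thesis
  proof (cases "\<bar>y\<bar> \<le> 1")
    case True
    have "norm (nderiv m \<phi> y) * (1 + \<bar>y\<bar>) ^ (m + 2) \<le> A * 2 ^ (m + 2)"
      using True A0 by (intro mult_mono power_mono A\<phi>) auto
    also have "\<dots> \<le> A * 2 ^ (m + 2) * (1 + S)"
      using A0 S0 by (simp add: mult_left_le distrib_left)
    finally show ?thesis by (simp add: decay_const_def A_def S_def mult_ac)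
  next
    case False
    then have y: "y \<noteq> 0" by auto
    have "norm (nderiv m \<phi> y) * (1 + \<bar>y\<bar>) ^ (m + 2) \<le>
        (\<Sum>i\<le>m. norm (inv_coeff m i) * (\<bar>1 / y\<bar> ^ (m + 2) * A)) * (2 * \<bar>y\<bar>) ^ (m + 2)"
    proof (rule mult_mono)
      have "norm (nderiv m \<phi> y) \<le> (\<Sum>i\<le>m. norm (inv_coeff m i * (of_real ((1 / y) ^ (m + i + 2)) * nderiv i \<psi> (1 / y))))"
        by (subst nderiv_inv_density[where \<phi> = \<phi> and \<psi> = \<psi>, OF sm(2) rp1_measures_inv_density[OF assms] y])
          (simp_all only: norm_sum not_False_eq_True)
      also have "\<dots> \<le> (\<Sum>i\<le>m. norm (inv_coeff m i) * (\<bar>1 / y\<bar> ^ (m + 2) * A))"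
      proof (intro sum_mono)
        fix i assume i: "i \<in> {..m}"
        have "norm (of_real ((1 / y) ^ (m + i + 2)) :: complex) = \<bar>1 / y\<bar> ^ (m + i + 2)"
          by (simp only: norm_of_real power_abs)
        also have "\<dots> \<le> \<bar>1 / y\<bar> ^ (m + 2)"
          using False by (intro power_decreasing) auto
        finally show "norm (inv_coeff m i * (of_real ((1 / y) ^ (m + i + 2)) * nderiv i \<psi> (1 / y)))
            \<le> norm (inv_coeff m i) * (\<bar>1 / y\<bar> ^ (m + 2) * A)"
          using i False unfolding norm_mult
          by (intro mult_left_mono mult_mono A\<psi>) (auto simp: abs_if field_simps split: if_splits)
      qed
      finally show "norm (nderiv m \<phi> y) \<le> (\<Sum>i\<le>m. norm (inv_coeff m i) * (\<bar>1 / y\<bar> ^ (m + 2) * A))" .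
      show "(1 + \<bar>y\<bar>) ^ (m + 2) \<le> (2 * \<bar>y\<bar>) ^ (m + 2)" using False by (intro power_mono) auto
    qed (use A0 in \<open>auto intro!: sum_nonneg mult_nonneg_nonneg\<close>)
    also have "\<dots> = S * (\<bar>1 / y\<bar> ^ (m + 2) * \<bar>y\<bar> ^ (m + 2)) * A * 2 ^ (m + 2)"
      unfolding S_def sum_distrib_right[symmetric] power_mult_distrib by (simp only: mult_ac)
    also have "\<bar>1 / y\<bar> ^ (m + 2) * \<bar>y\<bar> ^ (m + 2) = 1"
      unfolding power_mult_distrib[symmetric] abs_mult[symmetric] using y by simp
    also have "S * 1 * A * 2 ^ (m + 2) \<le> (1 + S) * A * 2 ^ (m + 2)"
      using A0 by (intro mult_right_mono) auto
    finally show ?thesis by (simp add: decay_const_def A_def S_def mult_ac)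
  qed
qed

subsection \<open>Pairings with derivatives against weights of polynomial growth\<close>

definition weights :: "(nat \<Rightarrow> real \<Rightarrow> complex) \<Rightarrow> bool" where
  "weights G \<longleftrightarrow> (\<forall>i. G i \<in> borel_measurable borel \<and> (\<exists>C. \<forall>y. norm (G i y) \<le> C * (1 + \<bar>y\<bar>) ^ i))"

text \<open>Up to signs this is the sum of the distributional derivatives of order k + i of the
  functions \<open>G i\<close>. On smooth measures of the projective line, growth of order i meets
  decay of order k + i + 2, so each integrand is O((1 + |y|)^(-k-2)), integrable even for k =
  0.\<close>

definition deriv_pairing :: "nat \<Rightarrow> nat \<Rightarrow> (nat \<Rightarrow> real \<Rightarrow> complex) \<Rightarrow> (real \<Rightarrow> complex) \<Rightarrow> complex" where
  "deriv_pairing k M G \<phi> = (\<Sum>i\<le>M. integral\<^sup>L lborel (\<lambda>y. G i y * nderiv (k + i) \<phi> y))"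

lemma weighted_pointwise_bound:
  fixes g f :: "real \<Rightarrow> complex"
  assumes g: "\<And>y. norm (g y) \<le> C * (1 + \<bar>y\<bar>) ^ i" and f: "\<And>y. norm (f y) * (1 + \<bar>y\<bar>) ^ (k + i + 2) \<le> B"
  shows "norm (g y * f y) \<le> C * B * (1 / (1 + y ^ 2))"
proof -
  have C: "C \<ge> 0" using order_trans[OF norm_ge_zero g[of 0]] by simp
  have "norm (g y * f y) * (1 + y ^ 2) \<le> (C * (1 + \<bar>y\<bar>) ^ i) * norm (f y) * (1 + \<bar>y\<bar>) ^ (k + 2)"
    unfolding norm_mult
  proof (intro mult_mono g order_refl)
    have "1 + y ^ 2 \<le> (1 + \<bar>y\<bar>) ^ 2" by (simp add: power2_eq_square algebra_simps)
    also have "\<dots> \<le> (1 + \<bar>y\<bar>) ^ (k + 2)" by (intro power_increasing) auto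
    finally show "1 + y ^ 2 \<le> (1 + \<bar>y\<bar>) ^ (k + 2)" .
  qed (use C in auto)
  also have "\<dots> = C * (norm (f y) * (1 + \<bar>y\<bar>) ^ (k + i + 2))"
    by (simp add: power_add mult_ac)
  also have "\<dots> \<le> C * B" by (intro mult_left_mono f C)
  finally show ?thesis by (simp add: pos_le_divide_eq add_pos_nonneg)
qed

lemma
  fixes g f :: "real \<Rightarrow> complex"
  assumes g: "g \<in> borel_measurable borel" "\<And>y. norm (g y) \<le> C * (1 + \<bar>y\<bar>) ^ i"
    and f: "continuous_on UNIV f" "\<And>y. norm (f y) * (1 + \<bar>y\<bar>) ^ (k + i + 2) \<le> B"
  shows integrable_weighted: "integrable lborel (\<lambda>y. g y * f y)"
    and norm_integral_weighted: "norm (integral\<^sup>L lborel (\<lambda>y. g y * f y)) \<le> C * B * (LBINT y. 1 / (1 + y ^ 2))"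
proof -
  have m: "(\<lambda>y. g y * f y) \<in> borel_measurable lborel"
    using g(1) borel_measurable_continuous_onI[OF f(1)] by measurable
  note bd = weighted_pointwise_bound[where g = g and f = f, OF g(2) f(2)]
  have i: "integrable lborel (\<lambda>y::real. C * B * (1 / (1 + y ^ 2)))"
    by (intro integrable_mult_right integrable_inverse_square)
  show I: "integrable lborel (\<lambda>y. g y * f y)"
    by (rule Bochner_Integration.integrable_bound[OF i m])
      (use bd order_trans[OF _ abs_ge_self] in \<open>auto simp del: times_divide_eq_right\<close>)
  have "norm (integral\<^sup>L lborel (\<lambda>y. g y * f y)) \<le> (LBINT y. C * B * (1 / (1 + y ^ 2)))"
    by (rule Bochner_Integration.integral_norm_bound_integral[OF I i bd])
  then show "norm (integral\<^sup>L lborel (\<lambda>y. g y * f y)) \<le> C * B * (LBINT y. 1 / (1 + y ^ 2))"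
    by (simp only: integral_mult_right_zero)
qed

lemma integrable_rp1:
  assumes "weights G" "(\<phi>, \<psi>) \<in> rp1_measures"
  shows "integrable lborel (\<lambda>y. G i y * nderiv (k + i) \<phi> y)"
  using assms(1) integrable_weighted[where f = "nderiv (k + i) \<phi>" and k = k and i = i,
      OF _ _ smooth_on_continuous[OF rp1_measures_smooth(1)[OF assms(2)]] rp1_measures_decay[OF assms(2)]]
  unfolding weights_def by blast

lemma test_functions_rp1_measures:
  assumes "\<phi> \<in> test_functions UNIV"
  shows "(\<phi>, inv_density \<phi>) \<in> rp1_measures"
  using inv_density_rp1_measures[OF assms] assms
  by (auto simp: rp1_measures_def test_functions_def)

text \<open>The density in the coordinate x determines the measure, so \<psi> may be ignored in the
  formula. It enters only the continuity estimate, through the decay that it forces on the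
  derivatives of \<phi>.\<close>

lemma rp1_distribution_deriv_pairing:
  assumes G: "weights G"
  shows "rp1_distribution (\<lambda>(\<phi>, \<psi>). deriv_pairing k M G \<phi>)"
  unfolding rp1_distribution_def prod.case
proof (intro conjI allI impI)
  fix \<phi> \<psi> \<phi>' \<psi>' :: "real \<Rightarrow> complex"
  assume *: "(\<phi>, \<psi>) \<in> rp1_measures \<and> (\<phi>', \<psi>') \<in> rp1_measures"
  then have s: "smooth_on UNIV \<phi>" "smooth_on UNIV \<phi>'" by (auto dest: rp1_measures_smooth)
  show "deriv_pairing k M G (\<lambda>x. \<phi> x + \<phi>' x) = deriv_pairing k M G \<phi> + deriv_pairing k M G \<phi>'"
    unfolding deriv_pairing_def nderiv_add[OF open_UNIV s UNIV_I] distrib_left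
    using * by (subst Bochner_Integration.integral_add) (auto intro!: integrable_rp1[OF G] sum.distrib)
next
  fix c :: complex and \<phi> \<psi> :: "real \<Rightarrow> complex"
  assume *: "(\<phi>, \<psi>) \<in> rp1_measures"
  then have s: "smooth_on UNIV \<phi>" by (auto dest: rp1_measures_smooth)
  show "deriv_pairing k M G (\<lambda>x. c * \<phi> x) = c * deriv_pairing k M G \<phi>"
    unfolding deriv_pairing_def nderiv_cmult[OF open_UNIV s UNIV_I] mult.left_commute[of _ c]
    by (simp add: sum_distrib_left)
next
  obtain C where C: "\<And>i y. norm (G i y) \<le> C i * (1 + \<bar>y\<bar>) ^ i"
    using G unfolding weights_def by metis
  define J where "J = (LBINT y::real. 1 / (1 + y ^ 2))"
  have J0: "J \<ge> 0" unfolding J_def by (intro integral_nonneg_AE) (auto simp: add_nonneg_nonneg)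
  have C0: "C i \<ge> 0" for i using order_trans[OF norm_ge_zero C[of i 0]] by simp
  have d0: "decay_const m \<ge> 0" for m
    by (auto simp: decay_const_def intro!: mult_nonneg_nonneg add_nonneg_nonneg sum_nonneg)
  show "\<exists>B N. \<forall>\<phi> \<psi>. (\<phi>, \<psi>) \<in> rp1_measures \<longrightarrow> norm (deriv_pairing k M G \<phi>) \<le>
      B * (\<Sum>n\<le>N. (SUP x\<in>{-1..1}. norm (nderiv n \<phi> x)) + (SUP u\<in>{-1..1}. norm (nderiv n \<psi> u)))"
  proof (intro exI allI impI)
    fix \<phi> \<psi> :: "real \<Rightarrow> complex"
    assume *: "(\<phi>, \<psi>) \<in> rp1_measures"
    note sm = rp1_measures_smooth[OF *]
    have "norm (deriv_pairing k M G \<phi>) \<le> (\<Sum>i\<le>M. C i * decay_const (k + i) * J * rp1_seminorm (k + M) \<phi> \<psi>)"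
      unfolding deriv_pairing_def
    proof (rule order_trans[OF norm_sum sum_mono])
      fix i assume i: "i \<in> {..M}"
      have "norm (LBINT y. G i y * nderiv (k + i) \<phi> y) \<le> C i * (decay_const (k + i) * rp1_seminorm (k + i) \<phi> \<psi>) * J"
        unfolding J_def
        by (rule norm_integral_weighted[OF _ C smooth_on_continuous[OF sm(1)] rp1_measures_decay[OF *]])
          (use G in \<open>auto simp: weights_def\<close>)
      also have "\<dots> \<le> C i * (decay_const (k + i) * rp1_seminorm (k + M) \<phi> \<psi>) * J"
        using i by (intro mult_right_mono mult_left_mono rp1_seminorm_mono sm C0 J0 d0) auto
      finally show "norm (LBINT y. G i y * nderiv (k + i) \<phi> y) \<le>
          C i * decay_const (k + i) * J * rp1_seminorm (k + M) \<phi> \<psi>"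
        by (simp add: mult_ac)
    qed
    then show "norm (deriv_pairing k M G \<phi>) \<le> (\<Sum>i\<le>M. C i * decay_const (k + i) * J) *
        (\<Sum>n\<le>k + M. (SUP x\<in>{-1..1}. norm (nderiv n \<phi> x)) + (SUP u\<in>{-1..1}. norm (nderiv n \<psi> u)))"
      unfolding rp1_seminorm_def[symmetric] sum_distrib_right .
  qed
qed

lemma test_functions_smooth: "\<phi> \<in> test_functions U \<Longrightarrow> smooth_on UNIV \<phi>"
  by (auto simp: test_functions_def)

lemma test_functions_mono: "U \<subseteq> V \<Longrightarrow> test_functions U \<subseteq> test_functions V"
  unfolding test_functions_def by (intro Collect_mono) (meson order_trans)

lemma test_functions_nderiv_outside:
  assumes "\<phi> \<in> test_functions U" "x \<notin> U"
  shows "nderiv n (\<lambda>t. g t * \<phi> t) x = 0"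
proof -
  from assms(1) obtain K where K: "compact K" "K \<subseteq> U" "\<And>x. x \<notin> K \<Longrightarrow> \<phi> x = 0"
    by (auto simp: test_functions_def)
  show ?thesis
    by (rule nderiv_eq_0[of "- K"]) (use K assms(2) compact_imp_closed in \<open>auto simp: open_Compl\<close>)
qed

lemma integrable_bounded_times_continuous:
  fixes w f :: "real \<Rightarrow> complex"
  assumes w: "w \<in> borel_measurable borel" and f: "continuous_on UNIV f"
    and out: "\<And>x. x \<notin> {a..b} \<Longrightarrow> w x * f x = 0" and B: "\<And>x. f x \<noteq> 0 \<Longrightarrow> norm (w x) \<le> B"
  shows "integrable lborel (\<lambda>x. w x * f x)"
proof -
  have "bounded (f ` {a..b})"
    by (intro compact_imp_bounded compact_continuous_image continuous_on_subset[OF f]) auto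
  then obtain A where A: "\<And>x. x \<in> {a..b} \<Longrightarrow> norm (f x) \<le> A"
    unfolding bounded_iff by blast
  show ?thesis
  proof (rule Bochner_Integration.integrable_bound)
    show "integrable lborel (\<lambda>x. \<bar>B\<bar> * \<bar>A\<bar> * indicat_real {a..b} x)"
      by (intro integrable_mult_right integrable_real_indicator) (auto simp: emeasure_lborel_Icc_eq)
    show "(\<lambda>x. w x * f x) \<in> borel_measurable lborel"
      using w borel_measurable_continuous_onI[OF f] by measurable
    show "AE x in lborel. norm (w x * f x) \<le> norm (\<bar>B\<bar> * \<bar>A\<bar> * indicat_real {a..b} x)"
    proof (rule AE_I2)
      fix x
      show "norm (w x * f x) \<le> norm (\<bar>B\<bar> * \<bar>A\<bar> * indicat_real {a..b} x)"
      proof (cases "w x * f x = 0")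
        case False
        then have x: "x \<in> {a..b}" and "f x \<noteq> 0" using out[of x] by auto
        then have "norm (w x * f x) \<le> \<bar>B\<bar> * \<bar>A\<bar>"
          unfolding norm_mult
          by (intro mult_mono order_trans[OF B] order_trans[OF A]) auto
        then show ?thesis using x by (simp add: abs_mult)
      next
        case True
        show ?thesis unfolding True by simp
      qed
    qed
  qed
qed

section \<open>Integrals over the line and the inversion u = 1/y\<close>

lemma integral_lebesgue_on_eq_lborel:
  fixes f :: "real \<Rightarrow> complex"
  assumes "f \<in> borel_measurable borel" "open U" "\<And>x. x \<notin> U \<Longrightarrow> f x = 0"
  shows "integral\<^sup>L (lebesgue_on U) f = integral\<^sup>L lborel f"
proof -
  have "integral\<^sup>L (lebesgue_on U) f = integral\<^sup>L lebesgue (\<lambda>x. indicator U x *\<^sub>R f x)"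
    by (rule integral_restrict_space) (use assms(2) in auto)
  also have "(\<lambda>x. indicator U x *\<^sub>R f x) = f"
    using assms(3) by (auto simp: indicator_def)
  also have "integral\<^sup>L lebesgue f = integral\<^sup>L lborel f"
    by (rule integral_completion) (use assms(1) in simp)
  finally show ?thesis .
qed

lemma
  fixes f :: "real \<Rightarrow> real"
  assumes f: "integrable lborel f"
  shows absolutely_integrable_on_nonzero: "f absolutely_integrable_on (- {0})"
    and integral_nonzero: "integral (- {0}) f = integral\<^sup>L lborel f"
proof -
  have "integrable lebesgue f" using f by (simp add: integrable_completion)
  then show "f absolutely_integrable_on (- {0})"
    unfolding set_integrable_def by (intro integrable_mult_indicator) auto
  have "integral (- {0}) f = integral UNIV f"
    by (intro integral_spike_set) (auto intro: negligible_subset[of "{0}"])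
  then show "integral (- {0}) f = integral\<^sup>L lborel f"
    using integral_lborel[OF f] by simp
qed

text \<open>The inversion maps the punctured line injectively onto itself with derivative - 1/x^2,
  and the removed point is a null set.\<close>

lemma integral_inversion_real:
  fixes q :: "real \<Rightarrow> real"
  assumes q: "integrable lborel q" and qi: "integrable lborel (\<lambda>y. q (1 / y) / y ^ 2)"
  shows "(LBINT y. q (1 / y) / y ^ 2) = (LBINT u. q u)"
proof -
  have eq: "(\<lambda>x. \<bar>- (1 / x ^ 2)\<bar> * q (1 / x)) = (\<lambda>y. q (1 / y) / y ^ 2)"
    by (auto simp: fun_eq_iff)
  have "x \<in> (\<lambda>x::real. 1 / x) ` (- {0})" if "x \<noteq> 0" for x
    using that by (intro image_eqI[of _ _ "1 / x"]) auto
  then have im: "(\<lambda>x::real. 1 / x) ` (- {0}) = - {0}" by auto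
  have "((\<lambda>x. \<bar>- (1 / x ^ 2)\<bar> * q (1 / x)) absolutely_integrable_on (- {0}) \<and>
      integral (- {0}) (\<lambda>x. \<bar>- (1 / x ^ 2)\<bar> * q (1 / x)) = (LBINT y. q (1 / y) / y ^ 2)) \<longleftrightarrow>
      (q absolutely_integrable_on ((\<lambda>x. 1 / x) ` (- {0})) \<and> integral ((\<lambda>x. 1 / x) ` (- {0})) q = (LBINT y. q (1 / y) / y ^ 2))"
    by (rule has_absolute_integral_change_of_variables_1')
      (auto intro!: derivative_eq_intros simp: power2_eq_square inj_on_def)
  then show ?thesis
    unfolding eq im
    using absolutely_integrable_on_nonzero[OF qi] integral_nonzero[OF qi] integral_nonzero[OF q] by simp
qed

lemma integral_inversion:
  fixes q :: "real \<Rightarrow> complex"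
  assumes q: "integrable lborel q" and qi: "integrable lborel (\<lambda>y. q (1 / y) / of_real (y ^ 2))"
  shows "(LBINT y. q (1 / y) / of_real (y ^ 2)) = (LBINT u. q u)"
proof (rule complex_eqI)
  have "Re (LBINT y. q (1 / y) / of_real (y ^ 2)) = (LBINT y. Re (q (1 / y)) / y ^ 2)"
    by (subst integral_Re[OF qi, symmetric]) (simp only: Re_divide_of_real)
  also have "\<dots> = (LBINT u. Re (q u))"
    by (rule integral_inversion_real)
      (use integrable_Re[OF q] integrable_Re[OF qi] in \<open>simp_all only: Re_divide_of_real\<close>)
  also have "\<dots> = Re (LBINT u. q u)" by (rule integral_Re[OF q])
  finally show "Re (LBINT y. q (1 / y) / of_real (y ^ 2)) = Re (LBINT u. q u)" .
  have "Im (LBINT y. q (1 / y) / of_real (y ^ 2)) = (LBINT y. Im (q (1 / y)) / y ^ 2)"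
    by (subst integral_Im[OF qi, symmetric]) (simp only: Im_divide_of_real)
  also have "\<dots> = (LBINT u. Im (q u))"
    by (rule integral_inversion_real)
      (use integrable_Im[OF q] integrable_Im[OF qi] in \<open>simp_all only: Im_divide_of_real\<close>)
  also have "\<dots> = Im (LBINT u. q u)" by (rule integral_Im[OF q])
  finally show "Im (LBINT y. q (1 / y) / of_real (y ^ 2)) = Im (LBINT u. q u)" .
qed

text \<open>The factor u^i compensates the growth: (1 + 1/|u|) |u| = 1 + |u| \<le> 2 for u \<noteq>
  0. At u = 0 the convention 1/0 = 0 makes the product 0, so the bound persists.\<close>

lemma weight_inversion_bound:
  assumes C: "\<And>y. norm (g y :: complex) \<le> C * (1 + \<bar>y\<bar>) ^ i" and u: "\<bar>u\<bar> \<le> 1"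
  shows "norm (g (1 / u) * of_real (u ^ i)) \<le> C * 2 ^ i"
proof -
  have C0: "0 \<le> C" using order_trans[OF norm_ge_zero C[of 0]] by simp
  have "norm (g (1 / u) * of_real (u ^ i)) \<le> C * (1 + \<bar>1 / u\<bar>) ^ i * \<bar>u\<bar> ^ i"
    unfolding norm_mult norm_of_real power_abs by (intro mult_right_mono C) auto
  also have "\<dots> = C * ((1 + \<bar>1 / u\<bar>) * \<bar>u\<bar>) ^ i" by (simp add: power_mult_distrib)
  also have "\<dots> \<le> C * 2 ^ i"
    using u by (intro mult_left_mono power_mono C0) (auto simp: distrib_right abs_divide)
  finally show ?thesis .
qed

lemma borel_measurable_inversion:
  fixes g :: "real \<Rightarrow> complex"
  assumes "g \<in> borel_measurable borel"
  shows "(\<lambda>u. g (1 / u) * of_real (u ^ i)) \<in> borel_measurable borel"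
proof (rule borel_measurable_times)
  show "(\<lambda>u. g (1 / u)) \<in> borel_measurable borel"
    by (rule measurable_compose[OF _ assms]) measurable
  show "(\<lambda>u::real. of_real (u ^ i) :: complex) \<in> borel_measurable borel"
    by (intro borel_measurable_continuous_onI continuous_intros)
qed

text \<open>After y = 1/u, the derivative of order k + i becomes a combination of u^(k+i+j+2)
  \<psi>^(j)(u), where \<psi>^(j) is the j-th derivative. Here u^2 is the Jacobian, u^i makes the
  weight bounded near u = 0, and u^(k+j) \<psi>^(j) is brought to Euler form. The result is the
  transpose of u^k times Euler operators applied to bounded functions.\<close>

lemma deriv_pairing_vanishes:
  assumes G: "weights G"
  shows "dist_vanishes_to_order 0 k (\<lambda>\<psi>. deriv_pairing k M G (inv_density \<psi>))"
proof -
  define U where "U = {-1<..<1::real}"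
  obtain C where C: "\<And>i y. norm (G i y) \<le> C i * (1 + \<bar>y\<bar>) ^ i"
    using G unfolding weights_def by metis
  have Gm: "G i \<in> borel_measurable borel" for i using G by (simp add: weights_def)
  define w where "w i u = G i (1 / u) * of_real (u ^ i)" for i u
  have wm: "w i \<in> borel_measurable borel" for i
    unfolding w_def[abs_def] by (rule borel_measurable_inversion[OF Gm])
  have wb: "norm (w i u) \<le> C i * 2 ^ i" if "u \<in> U" for i u
    using weight_inversion_bound[of "G i" "C i" i u, OF C] that by (auto simp: w_def U_def abs_if)
  define D where "D l \<psi> = nderiv l (\<lambda>t. of_real (t ^ (k + l)) * \<psi> t)" for l \<psi>
  \<comment> \<open>This is \<open>euler_form\<close> for the derivative of order k + i, with
    coefficients and length as arguments, so that they can be chosen for all i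
    simultaneously.\<close>
  define Q where "Q i e L \<longleftrightarrow> (\<forall>f. smooth_on UNIV f \<longrightarrow> (\<forall>x. (\<Sum>j\<le>k + i. inv_coeff (k + i) j *
     (of_real (x ^ (k + j)) * nderiv j f x)) = (\<Sum>l\<le>L. e l * D l f x)))" for i e and L :: nat
  have "\<exists>e L. Q i e L" for i
    unfolding Q_def D_def euler_form_def[symmetric]
    by (intro euler_form_sum euler_form_cmult euler_form_power_nderiv) auto
  then obtain e and L :: "nat \<Rightarrow> nat" where "\<And>i. Q i (e i) (L i)"
    by metis
  then have E: "(\<Sum>j\<le>k + i. inv_coeff (k + i) j * (of_real (x ^ (k + j)) * nderiv j f x)) =
      (\<Sum>l\<le>L i. e i l * D l f x)" if "smooth_on UNIV f" for i f x
    using that unfolding Q_def by blast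
  define L' where "L' = (\<Sum>i\<le>M. L i)"
  have L': "L i \<le> L'" if "i \<le> M" for i unfolding L'_def using that by (intro member_le_sum) auto
  \<comment> \<open>Padding with zeros up to the common length \<open>L'\<close> allows the sums
    over i and l to be exchanged.\<close>
  define e' where "e' i l = (if l \<le> L i then e i l else 0)" for i l
  \<comment> \<open>The sign cancels the one in \<open>transpose_euler_op\<close>.\<close>
  define h where "h l u = (\<Sum>i\<le>M. e' i l * (- 1) ^ l * w i u)" for l u
  have hm: "h l \<in> borel_measurable borel" for l
    unfolding h_def[abs_def] using wm by measurable
  have "Linf_loc U (h l)" for l
    unfolding Linf_loc_def
  proof (intro conjI allI impI exI)
    show "h l \<in> borel_measurable (lebesgue_on U)"
      using hm by (intro measurable_restrict_space1 measurable_completion) simp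
    fix K
    show "AE x in lebesgue_on U. x \<in> K \<longrightarrow> norm (h l x) \<le> (\<Sum>i\<le>M. norm (e' i l) * (C i * 2 ^ i))"
    proof (rule AE_I2, rule impI)
      fix x assume "x \<in> space (lebesgue_on U)"
      then have x: "x \<in> U" by (simp add: space_restrict_space)
      show "norm (h l x) \<le> (\<Sum>i\<le>M. norm (e' i l) * (C i * 2 ^ i))"
        unfolding h_def by (rule order_trans[OF norm_sum sum_mono])
          (auto simp: norm_mult norm_power intro!: mult_left_mono wb[OF x])
    qed
  qed
  \<comment> \<open>The order of vanishing is defined with terms numbered from 1, while the
    operators \<open>euler_op l\<close> start at l = 0; hence \<open>Suc L'\<close> terms and the
    shift j - 1.\<close>
  moreover have "agree_on U (\<lambda>\<psi>. deriv_pairing k M G (inv_density \<psi>))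
      (\<lambda>\<psi>. \<Sum>j = 1..Suc L'. dist_mult (\<lambda>x. of_real (x ^ k)) (dist_op (euler_op (j - 1)) (dist_of_fun U (h (j - 1)))) \<psi>)"
    unfolding agree_on_def
  proof
    fix \<psi> assume \<psi>: "\<psi> \<in> test_functions U"
    then have \<psi>': "\<psi> \<in> test_functions UNIV" using test_functions_mono[of U UNIV] by blast
    note s = test_functions_smooth[OF \<psi>]
    note rp = inv_density_rp1_measures[OF \<psi>']
    have Dc: "continuous_on UNIV (D l \<psi>)" for l
      unfolding D_def by (intro smooth_on_continuous smooth_on_mult smooth_on_power s) auto
    have D0: "D l \<psi> x = 0" if "x \<notin> U" for l x
      unfolding D_def by (rule test_functions_nderiv_outside[OF \<psi> that])
    have int: "integrable lborel (\<lambda>u. w i u * D l \<psi> u)" for i l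
      by (rule integrable_bounded_times_continuous[where a = "-1" and b = 1 and B = "C i * 2 ^ i", OF wm Dc])
        (use D0 wb in \<open>auto simp: U_def\<close>)
    let ?T = "\<lambda>l. dist_mult (\<lambda>x. of_real (x ^ k)) (dist_op (euler_op l) (dist_of_fun U (h l))) \<psi>"
    let ?I = "\<lambda>i l. LBINT u. w i u * D l \<psi> u"
    have "(LBINT y. G i y * nderiv (k + i) (inv_density \<psi>) y) =
        (\<Sum>l\<le>L'. e' i l * ?I i l)" if i: "i \<le> M" for i
    proof -
      \<comment> \<open>The integrand in the coordinate u, with the Jacobian split off.\<close>
      define q where "q u = (\<Sum>l\<le>L i. e i l * (w i u * D l \<psi> u))" for u
      have qeq: "q (1 / y) / of_real (y ^ 2) = G i y * nderiv (k + i) (inv_density \<psi>) y" if y: "y \<noteq> 0" for y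
      proof -
        let ?S = "\<Sum>j\<le>k + i. inv_coeff (k + i) j * (of_real ((1 / y) ^ (k + j)) * nderiv j \<psi> (1 / y))"
        have "q (1 / y) = w i (1 / y) * (\<Sum>l\<le>L i. e i l * D l \<psi> (1 / y))"
          by (simp add: q_def sum_distrib_left mult_ac)
        also have "\<dots> = G i y * (of_real ((1 / y) ^ i) * ?S)"
          by (simp only: E[OF s, symmetric] w_def) simp
        finally have "q (1 / y) / of_real (y ^ 2) =
            G i y * (of_real ((1 / y) ^ i) * of_real ((1 / y) ^ 2) * ?S)"
          by (simp add: power_divide)
        also have "of_real ((1 / y) ^ i) * of_real ((1 / y) ^ 2) * ?S
            = nderiv (k + i) (inv_density \<psi>) y"
          unfolding nderiv_inv_density[OF s refl y] sum_distrib_left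
        proof (intro sum.cong refl)
          fix j
          have "k + i + j + 2 = i + 2 + (k + j)" by simp
          then show "of_real ((1 / y) ^ i) * of_real ((1 / y) ^ 2) * (inv_coeff (k + i) j * (of_real ((1 / y) ^ (k + j)) * nderiv j \<psi> (1 / y))) =
            inv_coeff (k + i) j * (of_real ((1 / y) ^ (k + i + j + 2)) * nderiv j \<psi> (1 / y))"
            by (simp only: power_add of_real_mult mult_ac)
        qed
        finally show ?thesis .
      qed
      have qint: "integrable lborel q"
        unfolding q_def[abs_def] by (intro Bochner_Integration.integrable_sum integrable_mult_right int)
      have ae: "AE y in lborel. G i y * nderiv (k + i) (inv_density \<psi>) y = q (1 / y) / of_real (y ^ 2)"
        using AE_lborel_singleton[of 0] by eventually_elim (use qeq in auto)
      have qm: "(\<lambda>y. q (1 / y) / of_real (y ^ 2)) \<in> borel_measurable lborel"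
      proof -
        have "q \<in> borel_measurable borel" using borel_measurable_integrable[OF qint] by simp
        then show ?thesis by measurable
      qed
      note gi = integrable_rp1[OF G rp, of i k]
      have "(LBINT y. G i y * nderiv (k + i) (inv_density \<psi>) y) = (LBINT y. q (1 / y) / of_real (y ^ 2))"
        by (rule integral_cong_AE[OF borel_measurable_integrable[OF gi] qm ae])
      also have "\<dots> = integral\<^sup>L lborel q"
        by (rule integral_inversion[OF qint]) (rule integrable_cong_AE_imp[OF gi qm], use ae in \<open>auto elim: AE_mp\<close>)
      also have "\<dots> = (\<Sum>l\<le>L i. e i l * ?I i l)"
        unfolding q_def[abs_def] by (subst Bochner_Integration.integral_sum) (auto intro!: integrable_mult_right int)
      also have "\<dots> = (\<Sum>l\<le>L'. if l \<le> L i then e i l * ?I i l else 0)"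
        by (rule sum_atMost_pad[OF L'[OF i]])
      also have "\<dots> = (\<Sum>l\<le>L'. e' i l * ?I i l)"
        by (intro sum.cong) (auto simp: e'_def)
      finally show ?thesis .
    qed
    then have "deriv_pairing k M G (inv_density \<psi>) = (\<Sum>i\<le>M. \<Sum>l\<le>L'. e' i l * ?I i l)"
      unfolding deriv_pairing_def by simp
    also have "\<dots> = (\<Sum>l\<le>L'. \<Sum>i\<le>M. e' i l * ?I i l)"
      by (rule sum.swap)
    also have "\<dots> = (\<Sum>l\<le>L'. ?T l)"
    proof (intro sum.cong refl)
      fix l
      have p: "(\<lambda>t. of_real (t ^ l) * (of_real (t ^ k) * \<psi> t)) = (\<lambda>t. of_real (t ^ (k + l)) * \<psi> t)"
        by (simp add: fun_eq_iff power_add mult_ac)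
      have "?T l =
          integral\<^sup>L (lebesgue_on U) (\<lambda>x. h l x * ((- 1) ^ l * D l \<psi> x))"
        unfolding dist_mult_def dist_op_def dist_of_fun_def transpose_euler_op p D_def ..
      also have "(\<lambda>x. h l x * ((- 1) ^ l * D l \<psi> x)) = (\<lambda>x. \<Sum>i\<le>M. e' i l * (w i x * D l \<psi> x))"
      proof
        fix x
        have "(- 1) ^ l * ((- 1) ^ l :: complex) = 1" by (simp flip: power_add)
        then have c: "e' i l * (- 1) ^ l * w i x * ((- 1) ^ l * D l \<psi> x) = e' i l * (w i x * D l \<psi> x)" for i
          by (metis (no_types, opaque_lifting) mult.assoc mult.commute mult_1)
        show "h l x * ((- 1) ^ l * D l \<psi> x) = (\<Sum>i\<le>M. e' i l * (w i x * D l \<psi> x))"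
          unfolding h_def sum_distrib_right c ..
      qed
      also have "integral\<^sup>L (lebesgue_on U) \<dots> = integral\<^sup>L lborel \<dots>"
      proof (rule integral_lebesgue_on_eq_lborel)
        show "(\<lambda>x. \<Sum>i\<le>M. e' i l * (w i x * D l \<psi> x)) \<in> borel_measurable borel"
          using wm borel_measurable_continuous_onI[OF Dc] by measurable
      qed (use D0 in \<open>auto simp: U_def\<close>)
      also have "\<dots> = (\<Sum>i\<le>M. e' i l * ?I i l)"
        by (subst Bochner_Integration.integral_sum) (auto intro!: integrable_mult_right int)
      finally show "(\<Sum>i\<le>M. e' i l * ?I i l) =
          ?T l" ..
    qed
    also have "\<dots> = (\<Sum>j = 1..Suc L'. ?T (j - 1))"
      by (rule sum.reindex_bij_witness[of _ "\<lambda>j. j - 1" Suc]) auto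
    finally show "deriv_pairing k M G (inv_density \<psi>) =
      (\<Sum>j = 1..Suc L'. ?T (j - 1))" .
  qed
  moreover have "open U" "0 \<in> U" by (auto simp: U_def)
  ultimately show ?thesis
    unfolding dist_vanishes_to_order_def
    by (intro exI[of _ U] exI[of _ "Suc L'"] exI[of _ "\<lambda>_ x. of_real (x ^ k)"]
        exI[of _ "\<lambda>j. euler_op (j - 1)"] exI[of _ "\<lambda>j. h (j - 1)"])
      (simp only: diff_op_on_euler_op tangential_euler_op smooth_on_power fun_vanishes_to_order_def
        power_in_point_ideal_power, simp)
qed

section \<open>Approximation by compactly supported measures, and uniqueness\<close>

lemma one_plus_abs_pos_bound:
  fixes y :: real
  assumes "r \<ge> 1" "\<bar>y\<bar> \<le> 2 * r"
  shows "(1 + \<bar>y\<bar>) * (1 / r) \<le> 3"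
  using assms by (simp add: pos_divide_le_eq)

text \<open>This yields the uniqueness of the canonical extension, and hence a single extension for
  all orders \<open>k\<close>.\<close>

lemma truncation_limit:
  assumes G: "weights G" and \<phi>: "(\<phi>, \<psi>) \<in> rp1_measures"
    and \<kappa>: "smooth_on UNIV \<kappa>" "\<And>x. \<bar>x\<bar> \<le> 1 \<Longrightarrow> \<kappa> x = 1" "\<And>x. \<bar>x\<bar> \<ge> 2 \<Longrightarrow> \<kappa> x = 0"
  shows "(\<lambda>n. deriv_pairing k M G (\<lambda>y. \<phi> y * \<kappa> (1 / real (Suc n) * y + 0))) \<longlonglongrightarrow> deriv_pairing k M G \<phi>"
  unfolding deriv_pairing_def
proof (rule tendsto_sum)
  fix i
  define m where "m = k + i"
  note s = rp1_measures_smooth(1)[OF \<phi>]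
  define t where "t n y = \<phi> y * \<kappa> (1 / real (Suc n) * y + 0)" for n y
  have ks: "smooth_on UNIV (\<lambda>y. \<kappa> (1 / real (Suc n) * y + 0))" for n by (rule smooth_on_affine[OF \<kappa>(1)])
  have ts: "smooth_on UNIV (t n)" for n
    unfolding t_def[abs_def] by (intro smooth_on_mult s ks) auto
  obtain C where C: "\<And>y. norm (G i y) \<le> C * (1 + \<bar>y\<bar>) ^ i" using G unfolding weights_def by blast
  have Gm: "G i \<in> borel_measurable borel" using G by (simp add: weights_def)
  have "\<exists>B. \<forall>x. norm (nderiv q \<kappa> x) \<le> B \<and> (\<bar>x\<bar> > 2 \<longrightarrow> nderiv q \<kappa> x = 0)" for q
  proof -
    obtain B where B: "\<And>x. x \<in> {-2..2} \<Longrightarrow> norm (nderiv q \<kappa> x) \<le> B"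
      by (rule smooth_on_bounded[OF \<kappa>(1) subset_UNIV]) blast
    have z: "nderiv q \<kappa> x = 0" if "\<bar>x\<bar> > 2" for x
      by (rule nderiv_eq_0[of "- {-2..2}"]) (use that \<kappa>(3) in \<open>auto simp: open_Compl abs_if split: if_splits\<close>)
    have "0 \<le> B" by (rule order_trans[OF norm_ge_zero B[of 0]]) auto
    then have "norm (nderiv q \<kappa> x) \<le> B" for x
      using B[of x] z[of x] by (cases "\<bar>x\<bar> > 2") (auto simp: abs_if split: if_splits)
    then show ?thesis using z by blast
  qed
  then obtain K where K: "\<And>q x. norm (nderiv q \<kappa> x) \<le> K q" "\<And>q x. \<bar>x\<bar> > 2 \<Longrightarrow> nderiv q \<kappa> x = 0"
    by metis
  define P where "P j = decay_const j * rp1_seminorm j \<phi> \<psi>" for j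
  have P: "norm (nderiv j \<phi> y) * (1 + \<bar>y\<bar>) ^ (j + 2) \<le> P j" for j y
    unfolding P_def by (rule rp1_measures_decay[OF \<phi>])
  define B where "B = (\<Sum>j\<le>m. real (m choose j) * (P j * (K (m - j) * 3 ^ (m - j))))"
  \<comment> \<open>The bound must not depend on n. A derivative of order l of the cutoff at scale r
    carries the factor r^(-l) and vanishes for |y| > 2r; where |y| \<le> 2r, 1 + |y| \<le> 3r. So it
    is O((1 + |y|)^(-l)), and a derivative falling on the cutoff gains as much decay as one falling
    on \<phi>.\<close>
  have bd: "norm (nderiv m (t n) y) * (1 + \<bar>y\<bar>) ^ (m + 2) \<le> B" for n y
  proof -
    define r where "r = real (Suc n)"
    have r: "r \<ge> 1" by (simp add: r_def)
    define p where "p j = of_real ((1 / r) ^ j) * nderiv j \<kappa> (1 / r * y)" for j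
    have "nderiv m (t n) y = (\<Sum>j\<le>m. of_nat (m choose j) * (nderiv j \<phi> y * p (m - j)))"
      unfolding t_def[abs_def] nderiv_mult[OF open_UNIV s ks UNIV_I] nderiv_affine[OF \<kappa>(1)] r_def p_def by simp
    then have "norm (nderiv m (t n) y) * (1 + \<bar>y\<bar>) ^ (m + 2) \<le>
        (\<Sum>j\<le>m. norm (of_nat (m choose j) * (nderiv j \<phi> y * p (m - j)))) * (1 + \<bar>y\<bar>) ^ (m + 2)"
      by (simp only:) (intro mult_right_mono norm_sum, simp)
    also have "\<dots> \<le> B"
      unfolding B_def sum_distrib_right
    proof (rule sum_mono)
      fix j assume j: "j \<in> {..m}"
      have kb: "norm (p (m - j)) * (1 + \<bar>y\<bar>) ^ (m - j) \<le> K (m - j) * 3 ^ (m - j)"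
      proof (cases "\<bar>y\<bar> \<le> 2 * r")
        case True
        have "norm (p (m - j)) * (1 + \<bar>y\<bar>) ^ (m - j) =
            norm (nderiv (m - j) \<kappa> (1 / r * y)) * ((1 + \<bar>y\<bar>) * (1 / r)) ^ (m - j)"
          using r unfolding p_def norm_mult norm_of_real power_mult_distrib by simp
        also have "\<dots> \<le> K (m - j) * 3 ^ (m - j)"
          using r by (intro mult_mono K(1) power_mono one_plus_abs_pos_bound True order_trans[OF norm_ge_zero K(1)]) auto
        finally show ?thesis .
      next
        case False
        then have "\<bar>1 / r * y\<bar> > 2" using r by (simp add: abs_mult field_simps)
        from K(2)[OF this] show ?thesis
          using order_trans[OF norm_ge_zero K(1)[of "m - j" 0]] by (simp add: p_def)
      qed
      have "norm (of_nat (m choose j) * (nderiv j \<phi> y * p (m - j))) * (1 + \<bar>y\<bar>) ^ (m + 2)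
        = real (m choose j) * ((norm (nderiv j \<phi> y) * (1 + \<bar>y\<bar>) ^ (j + 2)) * (norm (p (m - j)) * (1 + \<bar>y\<bar>) ^ (m - j)))"
      proof -
        have "m + 2 = (j + 2) + (m - j)" using j by simp
        then have "(1 + \<bar>y\<bar>) ^ (m + 2) = (1 + \<bar>y\<bar>) ^ (j + 2) * (1 + \<bar>y\<bar>) ^ (m - j)" by (metis power_add)
        then show ?thesis by (simp only: norm_mult norm_of_nat mult_ac)
      qed
      also have "\<dots> \<le> real (m choose j) * (P j * (K (m - j) * 3 ^ (m - j)))"
        by (intro mult_left_mono mult_mono P kb order_trans[OF _ P]) auto
      finally show "norm (of_nat (m choose j) * (nderiv j \<phi> y * p (m - j))) * (1 + \<bar>y\<bar>) ^ (m + 2)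
        \<le> real (m choose j) * (P j * (K (m - j) * 3 ^ (m - j)))" .
    qed
    finally show ?thesis .
  qed
  have "(\<lambda>n. LBINT y. G i y * nderiv m (t n) y) \<longlonglongrightarrow> (LBINT y. G i y * nderiv m \<phi> y)"
  proof (rule integral_dominated_convergence[where w = "\<lambda>y. C * B * (1 / (1 + y ^ 2))"])
    show "(\<lambda>y. G i y * nderiv m \<phi> y) \<in> borel_measurable lborel"
      using Gm borel_measurable_continuous_onI[OF smooth_on_continuous[OF s]] by measurable
    show "(\<lambda>y. G i y * nderiv m (t n) y) \<in> borel_measurable lborel" for n
      using Gm borel_measurable_continuous_onI[OF smooth_on_continuous[OF ts]] by measurable
    show "integrable lborel (\<lambda>y. C * B * (1 / (1 + y ^ 2)))"
      by (intro integrable_mult_right integrable_inverse_square)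
    show "AE y in lborel. norm (G i y * nderiv m (t n) y) \<le> C * B * (1 / (1 + y ^ 2))" for n
      unfolding m_def by (rule AE_I2, rule weighted_pointwise_bound[where k = k, OF C bd[unfolded m_def]])
    show "AE y in lborel. (\<lambda>n. G i y * nderiv m (t n) y) \<longlonglongrightarrow> G i y * nderiv m \<phi> y"
    proof (rule AE_I2, rule tendsto_eventually)
      fix y :: real
      obtain n0 :: nat where n0: "\<bar>y\<bar> < real n0" using reals_Archimedean2 by blast
      show "\<forall>\<^sub>F n in sequentially. G i y * nderiv m (t n) y = G i y * nderiv m \<phi> y"
        using eventually_ge_at_top[of n0]
      proof eventually_elim
        case (elim n)
        have "nderiv m (t n) y = nderiv m \<phi> y"
        proof (rule nderiv_cong[of "{- real (Suc n)<..<real (Suc n)}"])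
          show "t n x = \<phi> x" if "x \<in> {- real (Suc n)<..<real (Suc n)}" for x
            using that \<kappa>(2)[of "1 / real (Suc n) * x + 0"] by (auto simp: t_def abs_mult abs_if field_simps)
          show "y \<in> {- real (Suc n)<..<real (Suc n)}" using n0 elim by (auto simp: abs_if split: if_splits)
        qed (use smooth_on_subset[OF s] in auto)
        then show ?case by simp
      qed
    qed
  qed
  then show "(\<lambda>n. LBINT y. G i y * nderiv (k + i) (\<lambda>y. \<phi> y * \<kappa> (1 / real (Suc n) * y + 0)) y)
      \<longlonglongrightarrow> (LBINT y. G i y * nderiv (k + i) \<phi> y)"
    by (simp only: m_def t_def[abs_def])
qed

text \<open>This fails for general distributions on the projective line, which may differ by a term
  supported at infinity. Pairings are determined by test functions because they are continuous along
  truncations.\<close>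

lemma deriv_pairing_unique:
  assumes G: "weights G" "weights G'" and \<phi>: "(\<phi>, \<psi>) \<in> rp1_measures"
    and eq: "\<And>\<phi>. \<phi> \<in> test_functions UNIV \<Longrightarrow> deriv_pairing k M G \<phi> = deriv_pairing k' M' G' \<phi>"
  shows "deriv_pairing k M G \<phi> = deriv_pairing k' M' G' \<phi>"
proof -
  obtain \<kappa> where \<kappa>: "smooth_on UNIV \<kappa>" "\<And>x. \<bar>x\<bar> \<le> 1 \<Longrightarrow> \<kappa> x = 1" "\<And>x. \<bar>x\<bar> \<ge> 2 \<Longrightarrow> \<kappa> x = 0"
    by (rule smooth_cutoff) blast
  have "(\<lambda>y. \<phi> y * \<kappa> (1 / real (Suc n) * y + 0)) \<in> test_functions UNIV" for n
    unfolding test_functions_def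
  proof (intro CollectI conjI exI[of _ "{- (2 * real (Suc n))..2 * real (Suc n)}"] allI impI)
    show "smooth_on UNIV (\<lambda>y. \<phi> y * \<kappa> (1 / real (Suc n) * y + 0))"
      by (intro smooth_on_mult smooth_on_affine \<kappa>(1) rp1_measures_smooth(1)[OF \<phi>]) auto
    fix y assume "y \<notin> {- (2 * real (Suc n))..2 * real (Suc n)}"
    then have "\<bar>1 / real (Suc n) * y + 0\<bar> \<ge> 2" by (auto simp: abs_if field_simps)
    from \<kappa>(3)[OF this] show "\<phi> y * \<kappa> (1 / real (Suc n) * y + 0) = 0" by simp
  qed auto
  then have e: "(\<lambda>n. deriv_pairing k M G (\<lambda>y. \<phi> y * \<kappa> (1 / real (Suc n) * y + 0))) =
      (\<lambda>n. deriv_pairing k' M' G' (\<lambda>y. \<phi> y * \<kappa> (1 / real (Suc n) * y + 0)))"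
    using eq by blast
  show ?thesis
    using truncation_limit[OF G(1) \<phi> \<kappa>, of k M] truncation_limit[OF G(2) \<phi> \<kappa>, of k' M']
    unfolding e by (rule LIMSEQ_unique)
qed

subsection \<open>Reduction to a representation of the Fourier transform\<close>

text \<open>The property to which both claims of the theorem are reduced. It is linear in S, so
  \<sigma> may be split by a cutoff and the two parts treated by different methods with unrelated G
  and M.\<close>

definition representable :: "nat \<Rightarrow> functional \<Rightarrow> bool" where
  "representable k S \<longleftrightarrow> (\<exists>G M. weights G \<and> (\<forall>\<phi>\<in>test_functions UNIV. S \<phi> = deriv_pairing k M G \<phi>))"

lemma representable_extends:
  assumes "weights G" "\<And>\<phi>. \<phi> \<in> test_functions UNIV \<Longrightarrow> S \<phi> = deriv_pairing k M G \<phi>"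
  shows "rp1_extends (\<lambda>(\<phi>, \<psi>). deriv_pairing k M G \<phi>) S"
  using rp1_distribution_deriv_pairing[OF assms(1)] assms(2)
  by (simp add: rp1_extends_def agree_on_def rp1_restrict_x_def)

lemma representable_imp_extension:
  assumes "representable k S"
  shows "\<exists>T. rp1_extends T S \<and> vanishes_to_order_at_infinity k T"
proof -
  obtain G M where G: "weights G" "\<And>\<phi>. \<phi> \<in> test_functions UNIV \<Longrightarrow> S \<phi> = deriv_pairing k M G \<phi>"
    using assms unfolding representable_def by blast
  show ?thesis
    using representable_extends[OF G] deriv_pairing_vanishes[OF G(1), of k M]
    by (intro exI[of _ "\<lambda>(\<phi>, \<psi>). deriv_pairing k M G \<phi>"])
      (simp add: vanishes_to_order_at_infinity_def rp1_restrict_u_def[abs_def])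
qed

lemma dist_vanishes_to_order_cong:
  assumes "dist_vanishes_to_order p k S" "\<And>\<phi>. \<phi> \<in> test_functions UNIV \<Longrightarrow> S \<phi> = S' \<phi>"
  shows "dist_vanishes_to_order p k S'"
proof -
  have "agree_on U S' R" if "agree_on U S R" for U R
    using that assms(2)[symmetric] test_functions_mono[of U UNIV] by (auto simp: agree_on_def subset_iff)
  then show ?thesis using assms(1) unfolding dist_vanishes_to_order_def by (elim ex_forward conj_forward) auto
qed

text \<open>The representation for k = 0 serves as the extension. For each k, the representation of
  that order gives the same values on measures supported in the coordinate u, by uniqueness, so its
  order of vanishing carries over.\<close>

lemma representable_imp_canonical_extension:
  assumes "\<And>k. representable k S"
  shows "has_canonical_extension_across_infinity S"
proof -
  obtain G M where G: "weights G" "\<And>\<phi>. \<phi> \<in> test_functions UNIV \<Longrightarrow> S \<phi> = deriv_pairing 0 M G \<phi>"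
    using assms[of 0] unfolding representable_def by blast
  have "vanishes_to_order_at_infinity k (\<lambda>(\<phi>, \<psi>). deriv_pairing 0 M G \<phi>)" for k
  proof -
    obtain G' M' where G': "weights G'" "\<And>\<phi>. \<phi> \<in> test_functions UNIV \<Longrightarrow> S \<phi> = deriv_pairing k M' G' \<phi>"
      using assms[of k] unfolding representable_def by blast
    have "deriv_pairing k M' G' (inv_density \<psi>) = deriv_pairing 0 M G (inv_density \<psi>)" if "\<psi> \<in> test_functions UNIV" for \<psi>
      by (rule deriv_pairing_unique[OF G'(1) G(1) inv_density_rp1_measures[OF that]]) (metis G(2) G'(2))
    from dist_vanishes_to_order_cong[OF deriv_pairing_vanishes[OF G'(1)] this]
    show ?thesis
      by (simp add: vanishes_to_order_at_infinity_def rp1_restrict_u_def[abs_def])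
  qed
  then show ?thesis
    using representable_extends[OF G] unfolding has_canonical_extension_across_infinity_def by blast
qed

section \<open>Sums and multiples of representable functionals\<close>

lemma representable_cong:
  assumes "representable k S" "\<And>\<phi>. \<phi> \<in> test_functions UNIV \<Longrightarrow> S' \<phi> = S \<phi>"
  shows "representable k S'"
  using assms unfolding representable_def by auto

lemma weights_measurable: "weights G \<Longrightarrow> G i \<in> borel_measurable borel"
  by (simp add: weights_def)

lemma integrable_test:
  assumes "weights G" "\<phi> \<in> test_functions UNIV"
  shows "integrable lborel (\<lambda>y. G i y * nderiv (k + i) \<phi> y)"
  using integrable_rp1[OF assms(1) test_functions_rp1_measures[OF assms(2)]] .

text \<open>Two pairings of different lengths are padded with zero weights to a common length before
  they are added.\<close>

lemma weights_truncate:
  assumes "weights G"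
  shows "weights (\<lambda>i y. if i \<le> M then G i y else 0)"
  unfolding weights_def
proof (intro allI conjI)
  fix i
  obtain C where C: "\<And>y. norm (G i y) \<le> C * (1 + \<bar>y\<bar>) ^ i" using assms unfolding weights_def by blast
  have m: "G i \<in> borel_measurable borel" using assms by (simp add: weights_def)
  show "(\<lambda>y. if i \<le> M then G i y else 0) \<in> borel_measurable borel"
    using m by (cases "i \<le> M") auto
  show "\<exists>C. \<forall>y. norm (if i \<le> M then G i y else 0) \<le> C * (1 + \<bar>y\<bar>) ^ i"
    by (intro exI[of _ C] allI) (use C order_trans[OF norm_ge_zero C] in auto)
qed

lemma weights_add:
  assumes "weights G" "weights H"
  shows "weights (\<lambda>i y. G i y + H i y)"
  unfolding weights_def
proof (intro allI conjI)
  fix i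
  obtain C where C: "\<And>y. norm (G i y) \<le> C * (1 + \<bar>y\<bar>) ^ i" using assms(1) unfolding weights_def by blast
  obtain C' where C': "\<And>y. norm (H i y) \<le> C' * (1 + \<bar>y\<bar>) ^ i" using assms(2) unfolding weights_def by blast
  show "(\<lambda>y. G i y + H i y) \<in> borel_measurable borel"
    by (intro borel_measurable_add weights_measurable assms)
  show "\<exists>C. \<forall>y. norm (G i y + H i y) \<le> C * (1 + \<bar>y\<bar>) ^ i"
    by (intro exI[of _ "C + C'"] allI order_trans[OF norm_triangle_ineq])
      (auto simp: distrib_right intro!: add_mono C C')
qed

lemma deriv_pairing_truncate:
  assumes "M \<le> M'"
  shows "deriv_pairing k M' (\<lambda>i y. if i \<le> M then G i y else 0) \<phi> = deriv_pairing k M G \<phi>"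
  unfolding deriv_pairing_def sum_atMost_pad[OF assms]
  by (intro sum.cong) auto

lemma representable_add:
  assumes "representable k S" "representable k S'"
  shows "representable k (\<lambda>\<phi>. S \<phi> + S' \<phi>)"
proof -
  obtain G M where G: "weights G" "\<And>\<phi>. \<phi> \<in> test_functions UNIV \<Longrightarrow> S \<phi> = deriv_pairing k M G \<phi>"
    using assms(1) unfolding representable_def by blast
  obtain G' M' where G': "weights G'" "\<And>\<phi>. \<phi> \<in> test_functions UNIV \<Longrightarrow> S' \<phi> = deriv_pairing k M' G' \<phi>"
    using assms(2) unfolding representable_def by blast
  define H where "H i y = (if i \<le> M then G i y else 0)" for i y
  define H' where "H' i y = (if i \<le> M' then G' i y else 0)" for i y
  have w: "weights H" "weights H'"
    unfolding H_def[abs_def] H'_def[abs_def] by (intro weights_truncate G G')+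
  show ?thesis
    unfolding representable_def
  proof (intro exI conjI ballI)
    show "weights (\<lambda>i y. H i y + H' i y)" by (rule weights_add[OF w])
    fix \<phi> :: "real \<Rightarrow> complex" assume \<phi>: "\<phi> \<in> test_functions UNIV"
    have "S \<phi> + S' \<phi> = deriv_pairing k (max M M') H \<phi> + deriv_pairing k (max M M') H' \<phi>"
      unfolding H_def[abs_def] H'_def[abs_def] by (simp add: deriv_pairing_truncate G(2)[OF \<phi>] G'(2)[OF \<phi>])
    also have "\<dots> = deriv_pairing k (max M M') (\<lambda>i y. H i y + H' i y) \<phi>"
      unfolding deriv_pairing_def distrib_right sum.distrib[symmetric]
      by (intro sum.cong refl Bochner_Integration.integral_add[symmetric] integrable_test w \<phi>)
    finally show "S \<phi> + S' \<phi> = deriv_pairing k (max M M') (\<lambda>i y. H i y + H' i y) \<phi>" .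
  qed
qed

lemma representable_term:
  assumes g: "g \<in> borel_measurable borel" "\<And>y. norm (g y) \<le> C * (1 + \<bar>y\<bar>) ^ i"
  shows "representable k (\<lambda>\<phi>. integral\<^sup>L lborel (\<lambda>y. g y * nderiv (k + i) \<phi> y))"
  unfolding representable_def
proof (intro exI conjI ballI)
  show "weights (\<lambda>j y. if j = i then g y else 0)"
    unfolding weights_def
  proof (intro allI conjI)
    fix j
    show "(\<lambda>y. if j = i then g y else 0) \<in> borel_measurable borel" using g(1) by (cases "j = i") auto
    show "\<exists>C. \<forall>y. norm (if j = i then g y else 0) \<le> C * (1 + \<bar>y\<bar>) ^ j"
    proof (cases "j = i")
      case False
      then show ?thesis by (intro exI[of _ 0]) auto
    qed (use g(2) in auto)
  qed
  fix \<phi> :: "real \<Rightarrow> complex"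
  have "deriv_pairing k i (\<lambda>j y. if j = i then g y else 0) \<phi> =
      (\<Sum>j\<le>i. if j = i then integral\<^sup>L lborel (\<lambda>y. g y * nderiv (k + j) \<phi> y) else 0)"
    unfolding deriv_pairing_def by (intro sum.cong) auto
  then show "integral\<^sup>L lborel (\<lambda>y. g y * nderiv (k + i) \<phi> y) = deriv_pairing k i (\<lambda>j y. if j = i then g y else 0) \<phi>"
    by simp
qed

lemma representable_cmult:
  assumes "representable k S"
  shows "representable k (\<lambda>\<phi>. c * S \<phi>)"
proof -
  obtain G M where G: "weights G" "\<And>\<phi>. \<phi> \<in> test_functions UNIV \<Longrightarrow> S \<phi> = deriv_pairing k M G \<phi>"
    using assms(1) unfolding representable_def by blast
  show ?thesis
    unfolding representable_def
  proof (intro exI conjI ballI)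
    show "weights (\<lambda>i y. c * G i y)"
      unfolding weights_def
    proof (intro allI conjI)
      fix i
      obtain C where C: "\<And>y. norm (G i y) \<le> C * (1 + \<bar>y\<bar>) ^ i" using G(1) unfolding weights_def by blast
      show "(\<lambda>y. c * G i y) \<in> borel_measurable borel"
        by (intro borel_measurable_times borel_measurable_const weights_measurable G(1))
      show "\<exists>C. \<forall>y. norm (c * G i y) \<le> C * (1 + \<bar>y\<bar>) ^ i"
        by (intro exI[of _ "norm c * C"] allI) (simp add: norm_mult mult.assoc mult_left_mono C)
    qed
    fix \<phi> :: "real \<Rightarrow> complex" assume "\<phi> \<in> test_functions UNIV"
    then show "c * S \<phi> = deriv_pairing k M (\<lambda>i y. c * G i y) \<phi>"
      by (simp add: G(2) deriv_pairing_def sum_distrib_left mult.assoc)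
  qed
qed

lemma representable_sum:
  assumes "finite I" "\<And>j. j \<in> I \<Longrightarrow> representable k (S j)"
  shows "representable k (\<lambda>\<phi>. \<Sum>j\<in>I. S j \<phi>)"
  using assms
proof (induction I rule: finite_induct)
  case empty
  show ?case using representable_term[of "\<lambda>_. 0" 0 0 k] by simp
next
  case (insert j I)
  then show ?case using representable_add[of k "S j" "\<lambda>\<phi>. \<Sum>j\<in>I. S j \<phi>"] by simp
qed

subsection \<open>The Fourier transform of test functions\<close>

definition two_pi_i :: complex where "two_pi_i = 2 * of_real pi * \<i>"

text \<open>The constant 8 is just a convenient bound from \<open>pi < 4\<close>.\<close>

lemma norm_two_pi_i: "norm two_pi_i \<le> 8" and two_pi_i_nonzero: "two_pi_i \<noteq> 0"
  using pi_less_4 by (simp_all add: two_pi_i_def norm_mult)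

lemma norm_e_char [simp]: "norm (e_char u) = 1"
proof -
  have "e_char u = exp (\<i> * of_real (2 * pi * u))" by (simp add: e_char_def mult_ac)
  then show ?thesis by (simp only: norm_exp_i_times)
qed

lemma continuous_on_e_char [continuous_intros]:
  "continuous_on S f \<Longrightarrow> continuous_on S (\<lambda>x. e_char (f x))"
  unfolding e_char_def by (intro continuous_intros)

lemma e_char_has_vector_derivative:
  "((\<lambda>y. e_char (- (x * y))) has_vector_derivative (- two_pi_i * of_real x) * e_char (- (x * y))) (at y within S)"
proof -
  have "((\<lambda>y. 2 * of_real pi * \<i> * of_real (- (x * y)) :: complex) has_vector_derivative 2 * of_real pi * \<i> * of_real (- x)) (at y within S)"
    by (intro has_vector_derivative_mult_right has_vector_derivative_of_real)
      (auto intro!: derivative_eq_intros simp: has_real_derivative_iff_has_vector_derivative[symmetric])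
  from field_vector_diff_chain_within[OF this, of exp "exp (2 * of_real pi * \<i> * of_real (- (x * y)))"]
  show ?thesis
    by (simp add: o_def e_char_def two_pi_i_def DERIV_exp has_field_derivative_at_within mult_ac)
qed

lemma
  shows smooth_on_e_char: "smooth_on UNIV (\<lambda>x. e_char (- (x * y)))"
    and nderiv_e_char: "nderiv n (\<lambda>x. e_char (- (x * y))) x = (- two_pi_i * of_real y) ^ n * e_char (- (x * y))"
proof -
  define F where "F n x = (- two_pi_i * of_real y) ^ n * e_char (- (x * y))" for n x
  have F: "(F n has_vector_derivative F (Suc n) x) (at x)" for n x
    using has_vector_derivative_mult_right[OF e_char_has_vector_derivative[of y x], of "(- two_pi_i * of_real y) ^ n"]
    by (simp add: F_def[abs_def] mult_ac)
  have 0: "e_char (- (x * y)) = F 0 x" for x by (simp add: F_def)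
  show "smooth_on UNIV (\<lambda>x. e_char (- (x * y)))"
    by (rule smooth_on_derivative_sequence[OF open_UNIV 0 F])
  show "nderiv n (\<lambda>x. e_char (- (x * y))) x = (- two_pi_i * of_real y) ^ n * e_char (- (x * y))"
    using nderiv_derivative_sequence[OF open_UNIV 0 F] by (simp add: F_def)
qed

text \<open>The index j counts derivatives in x taken under the integral sign. The limits are
  arguments because \<open>compact_functional_fourier\<close> differentiates with respect to the
  upper one.\<close>

definition fourier_integral :: "real \<Rightarrow> real \<Rightarrow> (real \<Rightarrow> complex) \<Rightarrow> nat \<Rightarrow> real \<Rightarrow> complex" where
  "fourier_integral a b f j x = integral {a..b} (\<lambda>y. (- two_pi_i * of_real y) ^ j * f y * e_char (- (x * y)))"

lemma
  assumes f: "continuous_on UNIV f"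
  shows smooth_on_fourier_integral: "smooth_on UNIV (fourier_integral a b f 0)"
    and nderiv_fourier_integral: "nderiv n (fourier_integral a b f 0) x = fourier_integral a b f n x"
proof -
  note cf [continuous_intros] = continuous_on_subset[OF f subset_UNIV]
  have F: "(fourier_integral a b f n has_vector_derivative fourier_integral a b f (Suc n) x) (at x)" for n x
  proof -
    have "((\<lambda>x. integral (cbox a b) (\<lambda>y. (- two_pi_i * of_real y) ^ n * f y * e_char (- (x * y)))) has_vector_derivative
        integral (cbox a b) (\<lambda>y. (- two_pi_i * of_real y) ^ n * f y * ((- two_pi_i * of_real y) * e_char (- (x * y))))) (at x within UNIV)"
    proof (rule leibniz_rule_vector_derivative)
      show "((\<lambda>x. (- two_pi_i * of_real y) ^ n * f y * e_char (- (x * y))) has_vector_derivative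
          (- two_pi_i * of_real y) ^ n * f y * ((- two_pi_i * of_real y) * e_char (- (x * y)))) (at x within UNIV)" for x y
        using has_vector_derivative_mult_right[OF e_char_has_vector_derivative[of y x UNIV], of "(- two_pi_i * of_real y) ^ n * f y"]
        by (simp only: mult.commute[of y])
      show "(\<lambda>y. (- two_pi_i * of_real y) ^ n * f y * e_char (- (x * y))) integrable_on cbox a b" for x
        by (intro integrable_continuous continuous_intros)
      show "continuous_on (UNIV \<times> cbox a b) (\<lambda>(x, y). (- two_pi_i * of_real y) ^ n * f y * ((- two_pi_i * of_real y) * e_char (- (x * y))))"
        unfolding case_prod_beta
        by (intro continuous_intros continuous_on_compose2[OF f]) auto
    qed auto
    then show ?thesis
      by (simp add: fourier_integral_def[abs_def] mult_ac)
  qed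
  show "smooth_on UNIV (fourier_integral a b f 0)"
    by (rule smooth_on_derivative_sequence[where F = "fourier_integral a b f", OF open_UNIV refl F])
  show "nderiv n (fourier_integral a b f 0) x = fourier_integral a b f n x"
    by (rule nderiv_derivative_sequence[where F = "fourier_integral a b f", OF open_UNIV refl F UNIV_I])
qed

lemma test_functions_support:
  assumes "\<phi> \<in> test_functions U"
  obtains a where "a > 0" "\<And>n x. \<bar>x\<bar> \<ge> a \<Longrightarrow> nderiv n \<phi> x = 0"
proof -
  from assms obtain K where K: "compact K" "\<And>x. x \<notin> K \<Longrightarrow> \<phi> x = 0" by (auto simp: test_functions_def)
  then obtain R where R: "R > 0" "\<And>x. x \<in> K \<Longrightarrow> \<bar>x\<bar> \<le> R"
    by (metis bounded_pos compact_imp_bounded real_norm_def)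
  have z: "\<phi> y = 0" if "y \<in> - {-R..R}" for y
    using K(2)[of y] R(2)[of y] that by (cases "y \<in> K") (auto simp: abs_le_iff)
  \<comment> \<open>The margin 1 puts these points into an open set on which \<phi> is zero, so that
    all derivatives vanish as well.\<close>
  have "nderiv n \<phi> x = 0" if "\<bar>x\<bar> \<ge> R + 1" for n x
    by (rule nderiv_eq_0[of "- {-R..R}", OF _ _ z]) (use that R(1) in \<open>auto simp: open_Compl\<close>)
  with R(1) show ?thesis by (intro that[of "R + 1"]) auto
qed

lemma test_functionsI:
  assumes "smooth_on UNIV f" "\<And>x. \<bar>x\<bar> > a \<Longrightarrow> f x = 0"
  shows "f \<in> test_functions UNIV"
  unfolding test_functions_def using assms
  by (auto intro!: exI[of _ "{-a..a}"] simp: abs_if)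

lemma test_functions_nderiv:
  assumes "\<phi> \<in> test_functions UNIV"
  shows "nderiv n \<phi> \<in> test_functions UNIV"
proof -
  obtain a where "a > 0" "\<And>n x. \<bar>x\<bar> \<ge> a \<Longrightarrow> nderiv n \<phi> x = 0" by (rule test_functions_support[OF assms]) blast
  then show ?thesis
    by (intro test_functionsI[of _ a] smooth_on_nderiv test_functions_smooth[OF assms]) auto
qed

lemma test_functions_mult:
  assumes "\<phi> \<in> test_functions UNIV" "smooth_on UNIV c"
  shows "(\<lambda>x. c x * \<phi> x) \<in> test_functions UNIV"
  using assms unfolding test_functions_def by (auto intro!: smooth_on_mult)

lemma
  fixes f :: "real \<Rightarrow> complex"
  assumes f: "continuous_on UNIV f" "\<And>x. \<bar>x\<bar> \<ge> a \<Longrightarrow> f x = 0"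
  shows integrable_compact_support: "integrable lborel f"
    and integral_compact_support: "integral\<^sup>L lborel f = integral {-a..a} f"
proof -
  have 0: "f x = 0" if "x \<notin> {-a..a}" for x
    using f(2)[of x] that by (auto simp: abs_if)
  show i: "integrable lborel f"
    using integrable_bounded_times_continuous[of "\<lambda>_. 1" f "-a" a 1] f(1) 0 by simp
  have "integral\<^sup>L lborel f = integral UNIV f"
    using integral_lborel[OF i] by simp
  also have "\<dots> = integral UNIV (\<lambda>x. if x \<in> {-a..a} then f x else 0)"
    by (intro integral_cong) (use 0 in auto)
  also have "\<dots> = integral {-a..a} f"
    by (rule integral_restrict_UNIV)
  finally show "integral\<^sup>L lborel f = integral {-a..a} f" .
qed

lemma fourier_eq_fourier_integral:
  assumes \<phi>: "continuous_on UNIV \<phi>" "\<And>x. \<bar>x\<bar> \<ge> a \<Longrightarrow> \<phi> x = 0"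
  shows "fourier \<phi> = fourier_integral (-a) a \<phi> 0"
proof
  fix y
  have "fourier \<phi> y = integral {-a..a} (\<lambda>x. \<phi> x * e_char (- (x * y)))"
    unfolding fourier_def using \<phi> by (intro integral_compact_support continuous_intros) auto
  then show "fourier \<phi> y = fourier_integral (-a) a \<phi> 0 y"
    by (simp add: fourier_integral_def mult.commute[of y])
qed

lemma smooth_on_fourier:
  assumes "\<phi> \<in> test_functions UNIV"
  shows "smooth_on UNIV (fourier \<phi>)"
proof -
  obtain a where a: "\<And>n x. \<bar>x\<bar> \<ge> a \<Longrightarrow> nderiv n \<phi> x = 0" by (rule test_functions_support[OF assms]) blast
  have c: "continuous_on UNIV \<phi>" by (rule smooth_on_continuous0[OF test_functions_smooth[OF assms]])
  have "fourier \<phi> = fourier_integral (-a) a \<phi> 0"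
    using a[of _ 0] by (intro fourier_eq_fourier_integral c) auto
  then show ?thesis using smooth_on_fourier_integral[OF c] by simp
qed

lemma power_monomial: "(- two_pi_i * of_real x) ^ n = (- two_pi_i) ^ n * of_real (x ^ n)"
  unfolding power_mult_distrib of_real_power ..

lemma nderiv_fourier:
  assumes "\<phi> \<in> test_functions UNIV"
  shows "nderiv n (fourier \<phi>) x = (- two_pi_i) ^ n * fourier (\<lambda>y. of_real (y ^ n) * \<phi> y) x"
proof -
  obtain a where a: "\<And>n x. \<bar>x\<bar> \<ge> a \<Longrightarrow> nderiv n \<phi> x = 0" by (rule test_functions_support[OF assms]) blast
  have c: "continuous_on UNIV \<phi>" by (rule smooth_on_continuous0[OF test_functions_smooth[OF assms]])
  have z: "\<phi> x = 0" if "\<bar>x\<bar> \<ge> a" for x using a[OF that, of 0] by simp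
  have "nderiv n (fourier \<phi>) x = fourier_integral (-a) a \<phi> n x"
    by (simp only: fourier_eq_fourier_integral[where a = a, OF c z] nderiv_fourier_integral[OF c])
  also have "\<dots> = (- two_pi_i) ^ n * fourier_integral (-a) a (\<lambda>y. of_real (y ^ n) * \<phi> y) 0 x"
    unfolding fourier_integral_def integral_mult_right[symmetric] power_monomial by (simp add: mult.assoc)
  also have "fourier_integral (-a) a (\<lambda>y. of_real (y ^ n) * \<phi> y) 0 = fourier (\<lambda>y. of_real (y ^ n) * \<phi> y)"
    by (rule fourier_eq_fourier_integral[symmetric]) (use c z in \<open>auto intro!: continuous_intros\<close>)
  finally show ?thesis .
qed

text \<open>Integration by parts, in the form that the derivative of \<phi> times the exponential
  integrates to its boundary values, which are 0.\<close>

lemma fourier_nderiv_1: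
  assumes "\<phi> \<in> test_functions UNIV"
  shows "fourier (nderiv 1 \<phi>) y = two_pi_i * of_real y * fourier \<phi> y"
proof -
  obtain a where a: "a > 0" "\<And>n x. \<bar>x\<bar> \<ge> a \<Longrightarrow> nderiv n \<phi> x = 0" by (rule test_functions_support[OF assms]) blast
  note s = test_functions_smooth[OF assms]
  have c: "continuous_on S (nderiv n \<phi>)" for n S by (rule continuous_on_subset[OF smooth_on_continuous[OF s]]) auto
  note c0 = c[of _ 0, unfolded nderiv_0] c[of _ 1]
  have f0: "fourier (nderiv n \<phi>) = fourier_integral (-a) a (nderiv n \<phi>) 0" for n
    by (rule fourier_eq_fourier_integral[OF c a(2)])
  have "((\<lambda>x. \<phi> x * ((- two_pi_i * of_real y) * e_char (- (y * x))) + nderiv 1 \<phi> x * e_char (- (y * x))) has_integral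
      (\<phi> a * e_char (- (y * a)) - \<phi> (- a) * e_char (- (y * - a)))) {-a..a}"
  proof (rule fundamental_theorem_of_calculus)
    fix x
    have "(\<phi> has_vector_derivative nderiv 1 \<phi> x) (at x)"
      using smooth_onD[OF s UNIV_I, of 0] by simp
    then show "((\<lambda>x. \<phi> x * e_char (- (y * x))) has_vector_derivative
        \<phi> x * ((- two_pi_i * of_real y) * e_char (- (y * x))) + nderiv 1 \<phi> x * e_char (- (y * x))) (at x within {-a..a})"
      by (intro has_vector_derivative_mult e_char_has_vector_derivative) (rule has_vector_derivative_at_within)
  qed (use a in auto)
  moreover have "\<phi> a = 0" "\<phi> (- a) = 0" using a(2)[of a 0] a(2)[of "-a" 0] a(1) by auto
  ultimately have "integral {-a..a} (\<lambda>x. \<phi> x * ((- two_pi_i * of_real y) * e_char (- (y * x))) + nderiv 1 \<phi> x * e_char (- (y * x))) = 0"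
    by (simp add: integral_unique)
  moreover have "integral {-a..a} (\<lambda>x. \<phi> x * ((- two_pi_i * of_real y) * e_char (- (y * x))) + nderiv 1 \<phi> x * e_char (- (y * x))) =
      integral {-a..a} (\<lambda>x. \<phi> x * ((- two_pi_i * of_real y) * e_char (- (y * x)))) + integral {-a..a} (\<lambda>x. nderiv 1 \<phi> x * e_char (- (y * x)))"
    by (intro Henstock_Kurzweil_Integration.integral_add integrable_continuous_real continuous_intros c0)
  moreover have "integral {-a..a} (\<lambda>x. nderiv 1 \<phi> x * e_char (- (y * x))) = fourier (nderiv 1 \<phi>) y"
    unfolding f0 by (simp add: fourier_integral_def mult.commute)
  moreover have "integral {-a..a} (\<lambda>x. \<phi> x * ((- two_pi_i * of_real y) * e_char (- (y * x)))) = (- two_pi_i * of_real y) * fourier \<phi> y"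
    unfolding f0[of 0, unfolded nderiv_0] fourier_integral_def integral_mult_right[symmetric] by (simp add: mult_ac)
  ultimately show ?thesis by (simp add: eq_neg_iff_add_eq_0 add.commute)
qed

lemma fourier_nderiv:
  assumes "\<phi> \<in> test_functions UNIV"
  shows "fourier (nderiv n \<phi>) y = two_pi_i ^ n * of_real (y ^ n) * fourier \<phi> y"
proof (induction n)
  case (Suc n)
  have "fourier (nderiv (Suc n) \<phi>) y = fourier (nderiv 1 (nderiv n \<phi>)) y" by (simp add: nderiv_nderiv)
  also have "\<dots> = two_pi_i * of_real y * fourier (nderiv n \<phi>) y"
    by (rule fourier_nderiv_1[OF test_functions_nderiv[OF assms]])
  finally show ?case by (simp add: Suc mult_ac)
qed simp

lemma norm_fourier_le: "norm (fourier f y) \<le> (LBINT x. norm (f x))"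
proof -
  have "norm (fourier f y) \<le> (LBINT x. norm (f x * e_char (- (x * y))))"
    unfolding fourier_def by (rule integral_norm_bound)
  then show ?thesis by (simp add: norm_mult)
qed

lemma power_fourier:
  assumes "\<phi> \<in> test_functions UNIV"
  shows "of_real (y ^ m) * fourier \<phi> y = (1 / two_pi_i) ^ m * fourier (nderiv m \<phi>) y"
  using two_pi_i_nonzero by (simp add: fourier_nderiv[OF assms] power_divide)

text \<open>Powers and derivatives of the transform are moved onto \<phi>: up to a constant, x^m
  times the n-th derivative is the transform of the m-th derivative of y^n \<phi>, bounded by an L1
  norm.\<close>

lemma fourier_schwartz:
  assumes "\<phi> \<in> test_functions UNIV"
  shows "fourier \<phi> \<in> schwartz"
  unfolding schwartz_def
proof (intro CollectI conjI allI smooth_on_fourier assms)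
  fix m n
  have t: "(\<lambda>y. of_real (y ^ n) * \<phi> y) \<in> test_functions UNIV"
    by (intro test_functions_mult assms smooth_on_power) auto
  have "of_real (x ^ m) * nderiv n (fourier \<phi>) x =
      ((- two_pi_i) ^ n * (1 / two_pi_i) ^ m) * fourier (nderiv m (\<lambda>y. of_real (y ^ n) * \<phi> y)) x" for x
    unfolding nderiv_fourier[OF assms] mult.left_commute[of "of_real (x ^ m)"] power_fourier[OF t] by simp
  then have "norm (of_real (x ^ m) * nderiv n (fourier \<phi>) x) \<le>
      norm ((- two_pi_i) ^ n * (1 / two_pi_i) ^ m) * (LBINT x. norm (nderiv m (\<lambda>y. of_real (y ^ n) * \<phi> y) x))" for x
    by (simp only: norm_mult) (intro mult_left_mono norm_fourier_le mult_nonneg_nonneg norm_ge_zero)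
  then show "bounded (range (\<lambda>x. of_real (x ^ m) * nderiv n (fourier \<phi>) x))"
    by (auto simp: bounded_iff)
qed

lemma test_functions_schwartz:
  assumes "\<phi> \<in> test_functions UNIV"
  shows "\<phi> \<in> schwartz"
  unfolding schwartz_def
proof (intro CollectI conjI allI test_functions_smooth[OF assms])
  fix m n
  obtain a where a: "a > 0" "\<And>n x. \<bar>x\<bar> \<ge> a \<Longrightarrow> nderiv n \<phi> x = 0" by (rule test_functions_support[OF assms]) blast
  have "range (\<lambda>x. of_real (x ^ m) * nderiv n \<phi> x) \<subseteq> insert 0 ((\<lambda>x. of_real (x ^ m) * nderiv n \<phi> x) ` {-a..a})"
  proof (rule image_subsetI)
    fix x
    show "of_real (x ^ m) * nderiv n \<phi> x \<in> insert 0 ((\<lambda>x. of_real (x ^ m) * nderiv n \<phi> x) ` {-a..a})"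
    proof (cases "\<bar>x\<bar> \<le> a")
      case True
      then show ?thesis by (intro insertI2 imageI) auto
    next
      case False
      then show ?thesis using a(2)[of x n] by simp
    qed
  qed
  moreover have "bounded (insert 0 ((\<lambda>x. of_real (x ^ m) * nderiv n \<phi> x) ` {-a..a}))"
    unfolding bounded_insert
    by (intro compact_imp_bounded compact_continuous_image continuous_intros
        continuous_on_subset[OF smooth_on_continuous[OF test_functions_smooth[OF assms]]]) auto
  ultimately show "bounded (range (\<lambda>x. of_real (x ^ m) * nderiv n \<phi> x))"
    by (rule bounded_subset[rotated])
qed

text \<open>The reason for the normal form \<open>euler_form\<close>: its terms turn into y^l
  against the derivative of order k + l, which is the balance required by
  \<open>deriv_pairing\<close>.\<close>

lemma nderiv_power_fourier:
  assumes "\<phi> \<in> test_functions UNIV"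
  shows "nderiv l (\<lambda>t. of_real (t ^ (k + l)) * fourier \<phi> t) x =
    (1 / two_pi_i) ^ (k + l) * (- two_pi_i) ^ l * fourier (\<lambda>y. of_real (y ^ l) * nderiv (k + l) \<phi> y) x"
proof -
  note t = test_functions_nderiv[OF assms, of "k + l"]
  show ?thesis
    unfolding power_fourier[OF assms]
    by (subst nderiv_cmult[OF open_UNIV smooth_on_fourier[OF t] UNIV_I]) (simp add: nderiv_fourier[OF t])
qed

subsection \<open>The part of the distribution near the origin\<close>

lemma borel_measurable_fourier:
  assumes f: "f \<in> borel_measurable borel"
  shows "fourier f \<in> borel_measurable borel"
proof -
  have e: "(\<lambda>p. e_char (- (snd p * fst p))) \<in> borel_measurable (borel \<Otimes>\<^sub>M borel)"
    unfolding borel_prod by (intro borel_measurable_continuous_onI continuous_intros)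
  have "(\<lambda>p. f (snd p) * e_char (- (snd p * fst p))) \<in> borel_measurable (borel \<Otimes>\<^sub>M borel)"
    by (intro borel_measurable_times e measurable_compose[OF measurable_snd f])
  then have "case_prod (\<lambda>y x. f x * e_char (- (x * y))) \<in> borel_measurable (borel \<Otimes>\<^sub>M lborel)"
    by (simp add: case_prod_beta cong: measurable_cong_sets)
  then show ?thesis
    unfolding fourier_def[abs_def] by (rule lborel.borel_measurable_lebesgue_integral)
qed

text \<open>Fubini's theorem, with |H(x)| |f(y)| as integrable majorant.\<close>

lemma fourier_multiplication:
  assumes H: "integrable lborel H" and f: "integrable lborel f"
  shows "(LBINT x. H x * fourier f x) = (LBINT y. fourier H y * f y)"
proof -
  define F where "F x y = H x * (f y * e_char (- (y * x)))" for x y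
  have Hm: "H \<in> borel_measurable borel" and fm: "f \<in> borel_measurable borel"
    using H f borel_measurable_integrable by auto
  have e: "(\<lambda>p. e_char (- (snd p * fst p))) \<in> borel_measurable (borel \<Otimes>\<^sub>M borel)"
    unfolding borel_prod by (intro borel_measurable_continuous_onI continuous_intros)
  have "(\<lambda>p. H (fst p) * (f (snd p) * e_char (- (snd p * fst p)))) \<in> borel_measurable (borel \<Otimes>\<^sub>M borel)"
    by (intro borel_measurable_times e measurable_compose[OF measurable_snd fm] measurable_compose[OF measurable_fst Hm])
  then have m: "case_prod F \<in> borel_measurable (lborel \<Otimes>\<^sub>M lborel)"
    unfolding F_def[abs_def] case_prod_beta by (simp cong: measurable_cong_sets)
  have fe: "integrable lborel (\<lambda>y. f y * e_char (- (y * x)))" for x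
  proof (rule Bochner_Integration.integrable_bound[OF f])
    have "(\<lambda>y. e_char (- (y * x))) \<in> borel_measurable borel"
      by (intro borel_measurable_continuous_onI continuous_intros)
    then show "(\<lambda>y. f y * e_char (- (y * x))) \<in> borel_measurable lborel"
      using fm by simp
  qed (simp add: norm_mult)
  have "integrable (lborel \<Otimes>\<^sub>M lborel) (case_prod F)"
  proof (rule lborel_pair.Fubini_integrable[OF m])
    have "integrable lborel (\<lambda>x. norm (H x) * (LBINT y. norm (f y)))"
      by (intro integrable_mult_left integrable_norm H)
    then show "integrable lborel (\<lambda>x. LBINT y. norm (case_prod F (x, y)))"
      by (simp add: F_def norm_mult)
    show "AE x in lborel. integrable lborel (\<lambda>y. case_prod F (x, y))"
      by (rule AE_I2) (simp add: F_def fe)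
  qed
  from lborel_pair.Fubini_integral[OF this]
  have "(LBINT y. LBINT x. F x y) = (LBINT x. LBINT y. F x y)" .
  moreover have "(LBINT x. LBINT y. F x y) = (LBINT x. H x * fourier f x)"
    by (simp add: F_def fourier_def)
  moreover have "(LBINT y. LBINT x. F x y) = (LBINT y. fourier H y * f y)"
  proof -
    have "(LBINT x. F x y) = fourier H y * f y" for y
    proof -
      have "(LBINT x. F x y) = (LBINT x. f y * (H x * e_char (- (x * y))))"
        by (simp add: F_def mult.commute[of y] mult.left_commute)
      then show ?thesis by (simp add: fourier_def mult.commute)
    qed
    then show ?thesis by simp
  qed
  ultimately show ?thesis by simp
qed

lemma integrable_test_function:
  assumes "f \<in> test_functions UNIV"
  shows "integrable lborel f"
proof -
  obtain a where a: "\<And>n x. \<bar>x\<bar> \<ge> a \<Longrightarrow> nderiv n f x = 0" by (rule test_functions_support[OF assms]) blast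
  show ?thesis
    by (rule integrable_compact_support[OF smooth_on_continuous0[OF test_functions_smooth[OF assms]]])
      (use a[of _ 0] in auto)
qed

text \<open>H is integrable, so its transform is bounded, and multiplication by y^l gives a weight
  of growth l.\<close>

lemma representable_fourier_term:
  assumes Hm: "H \<in> borel_measurable borel" and B: "\<And>x. norm (H x) \<le> B" and out: "\<And>x. x \<notin> {-e..e} \<Longrightarrow> H x = 0"
  shows "representable k (\<lambda>\<phi>. LBINT x. H x * nderiv l (\<lambda>t. of_real (t ^ (k + l)) * fourier \<phi> t) x)"
proof -
  have Hi: "integrable lborel H"
    using integrable_bounded_times_continuous[of H "\<lambda>_. 1" "-e" e B] Hm B out by simp
  define c where "c = (1 / two_pi_i) ^ (k + l) * (- two_pi_i) ^ l"
  define g where "g y = c * fourier H y * of_real (y ^ l)" for y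
  have g: "g \<in> borel_measurable borel"
    unfolding g_def[abs_def]
    by (intro borel_measurable_times borel_measurable_const borel_measurable_fourier Hm
        borel_measurable_continuous_onI[of "\<lambda>y. of_real (y ^ l)"] continuous_intros)
  have gb: "norm (g y) \<le> norm c * (LBINT x. norm (H x)) * (1 + \<bar>y\<bar>) ^ l" for y
    unfolding g_def norm_mult norm_of_real power_abs
    by (intro mult_mono mult_left_mono norm_fourier_le power_mono mult_nonneg_nonneg integral_nonneg_AE) auto
  show ?thesis
  proof (rule representable_cong[OF representable_term[OF g gb]])
    fix \<phi> :: "real \<Rightarrow> complex" assume \<phi>: "\<phi> \<in> test_functions UNIV"
    have t: "(\<lambda>y. of_real (y ^ l) * nderiv (k + l) \<phi> y) \<in> test_functions UNIV"
      by (intro test_functions_mult test_functions_nderiv \<phi> smooth_on_power) auto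
    note i = integrable_test_function[OF t]
    have "(LBINT x. H x * nderiv l (\<lambda>t. of_real (t ^ (k + l)) * fourier \<phi> t) x) =
        (LBINT x. c * (H x * fourier (\<lambda>y. of_real (y ^ l) * nderiv (k + l) \<phi> y) x))"
      unfolding nderiv_power_fourier[OF \<phi>] c_def by (simp add: mult_ac)
    also have "\<dots> = c * (LBINT x. H x * fourier (\<lambda>y. of_real (y ^ l) * nderiv (k + l) \<phi> y) x)"
      by (rule integral_mult_right_zero)
    also have "\<dots> = (LBINT y. c * (fourier H y * (of_real (y ^ l) * nderiv (k + l) \<phi> y)))"
      unfolding fourier_multiplication[OF Hi i] by (rule integral_mult_right_zero[symmetric])
    also have "\<dots> = (LBINT y. g y * nderiv (k + l) \<phi> y)"
      by (simp add: g_def mult.assoc)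
    finally show "(LBINT x. H x * nderiv l (\<lambda>t. of_real (t ^ (k + l)) * fourier \<phi> t) x) = (LBINT y. g y * nderiv (k + l) \<phi> y)" .
  qed
qed

text \<open>The function h is only Lebesgue measurable on U and bounded almost everywhere on compact
  sets, whereas the Fourier integrals use Borel functions on the line. The factor R confines
  everything to [-e, e], and the product h R is changed on a null set.\<close>

lemma borel_representative:
  assumes h: "Linf_loc U h" and U: "open U" "{-e..e} \<subseteq> U"
    and R: "R \<in> borel_measurable borel" "\<And>x. norm (R x) \<le> C" "\<And>x. x \<notin> {-e..e} \<Longrightarrow> R x = 0"
  obtains H B where "H \<in> borel_measurable borel" "\<And>x. norm (H x) \<le> B" "\<And>x. x \<notin> {-e..e} \<Longrightarrow> H x = 0"
    "\<And>f. continuous_on UNIV f \<Longrightarrow> integrable (lebesgue_on U) (\<lambda>x. h x * (R x * f x))"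
    "\<And>f. continuous_on UNIV f \<Longrightarrow> integral\<^sup>L (lebesgue_on U) (\<lambda>x. h x * (R x * f x)) = (LBINT x. H x * f x)"
proof -
  have Us: "U \<inter> space lebesgue \<in> sets lebesgue" using U(1) by auto
  define g where "g x = (indicator U x *\<^sub>R h x) * R x" for x
  have "h \<in> borel_measurable (lebesgue_on U)" using h by (simp add: Linf_loc_def)
  then have "(\<lambda>x. indicator U x *\<^sub>R h x) \<in> borel_measurable lebesgue"
    by (simp only: borel_measurable_restrict_space_iff[OF Us])
  moreover have "R \<in> borel_measurable lebesgue" using R(1) by (intro measurable_completion) simp
  ultimately have gm: "g \<in> borel_measurable lebesgue"
    unfolding g_def[abs_def] by (rule borel_measurable_times)
  obtain C0 where "AE x in lebesgue_on U. x \<in> {-e..e} \<longrightarrow> norm (h x) \<le> C0"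
    using h U(2) unfolding Linf_loc_def by (meson compact_Icc)
  then have hb: "AE x in lebesgue. x \<in> U \<longrightarrow> x \<in> {-e..e} \<longrightarrow> norm (h x) \<le> C0"
    by (simp only: AE_restrict_space_iff[OF Us])
  define B where "B = \<bar>C0\<bar> * C"
  have C: "C \<ge> 0" by (rule order_trans[OF norm_ge_zero R(2)[of 0]])
  have gb: "AE x in lebesgue. norm (g x) \<le> B"
    using hb
  proof eventually_elim
    case (elim x)
    show ?case
    proof (cases "x \<in> {-e..e}")
      case True
      then have "x \<in> U" using U(2) by blast
      then have "norm (h x) \<le> \<bar>C0\<bar>" using elim True by auto
      then show ?thesis
        unfolding g_def B_def norm_mult using \<open>x \<in> U\<close> by (intro mult_mono R(2)) auto
    next
      case False
      then show ?thesis using R(3)[OF False] C by (simp add: g_def B_def)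
    qed
  qed
  have "(\<lambda>x. Re (g x)) \<in> borel_measurable lebesgue" "(\<lambda>x. Im (g x)) \<in> borel_measurable lebesgue"
    using gm by measurable
  then obtain gr gi where gr: "gr \<in> borel_measurable lborel" "AE x in lborel. Re (g x) = gr x"
    and gi: "gi \<in> borel_measurable lborel" "AE x in lborel. Im (g x) = gi x"
    using completion_ex_borel_measurable_real by metis
  define g' where "g' x = Complex (gr x) (gi x)" for x
  have g'm: "g' \<in> borel_measurable borel"
    using gr(1) gi(1) unfolding g'_def[abs_def] Complex_eq by measurable
  \<comment> \<open>The Borel version may be large, or nonzero outside [-e, e], on a null set; it is
    set to 0 there.\<close>
  define H where "H x = (if norm (g' x) \<le> B \<and> x \<in> {-e..e} then g' x else 0)" for x
  have Hm: "H \<in> borel_measurable borel"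
    unfolding H_def[abs_def] using g'm by measurable
  have B0: "B \<ge> 0" using C by (simp add: B_def)
  have Hb: "norm (H x) \<le> B" for x using B0 by (simp add: H_def)
  have H0: "H x = 0" if "x \<notin> {-e..e}" for x using that by (auto simp: H_def)
  have ae: "AE x in lebesgue. g x = H x"
    using AE_completion[OF gr(2)] AE_completion[OF gi(2)] gb
  proof eventually_elim
    case (elim x)
    then have e: "g x = g' x" by (simp add: g'_def complex_eq_iff)
    show ?case
    proof (cases "x \<in> {-e..e}")
      case True
      then show ?thesis using e elim(3) by (simp add: H_def)
    next
      case False
      then show ?thesis using R(3)[OF False] H0[OF False] by (simp add: g_def)
    qed
  qed
  have main: "integrable (lebesgue_on U) (\<lambda>x. h x * (R x * f x)) \<and>
      integral\<^sup>L (lebesgue_on U) (\<lambda>x. h x * (R x * f x)) = (LBINT x. H x * f x)" if f: "continuous_on UNIV f" for f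
  proof -
    have eq: "(\<lambda>x. indicator U x *\<^sub>R (h x * (R x * f x))) = (\<lambda>x. g x * f x)"
      by (simp add: fun_eq_iff g_def mult.assoc)
    have fm: "f \<in> borel_measurable borel" by (rule borel_measurable_continuous_onI[OF f])
    have fl: "f \<in> borel_measurable lebesgue" using fm by (intro measurable_completion) simp
    have Hl: "H \<in> borel_measurable lebesgue" using Hm by (intro measurable_completion) simp
    have i: "integrable lborel (\<lambda>x. H x * f x)"
      by (rule integrable_bounded_times_continuous[OF Hm f, where a = "-e" and b = e and B = B]) (use H0 Hb in auto)
    have m1: "(\<lambda>x. g x * f x) \<in> borel_measurable lebesgue" by (intro borel_measurable_times gm fl)
    have m2: "(\<lambda>x. H x * f x) \<in> borel_measurable lebesgue" by (intro borel_measurable_times Hl fl)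
    have ae': "AE x in lebesgue. g x * f x = H x * f x" using ae by eventually_elim simp
    have il: "integrable lebesgue (\<lambda>x. H x * f x)" using i by (simp add: integrable_completion)
    have "integrable lebesgue (\<lambda>x. g x * f x)"
      using integrable_cong_AE[OF m1 m2 ae'] il by simp
    moreover have "integral\<^sup>L lebesgue (\<lambda>x. g x * f x) = (LBINT x. H x * f x)"
      using integral_cong_AE[OF m1 m2 ae'] integral_completion[of "\<lambda>x. H x * f x" lborel] borel_measurable_integrable[OF i] by simp
    ultimately show ?thesis
      by (simp only: integrable_restrict_space[OF Us] integral_restrict_space[OF Us] eq)
  qed
  show ?thesis by (rule that[OF Hm Hb H0]) (use main in auto)
qed

text \<open>Integrability accompanies representability because finite sums have to be taken out of
  the integral.\<close>

definition local_kernel :: "nat \<Rightarrow> real set \<Rightarrow> (real \<Rightarrow> complex) \<Rightarrow> ((real \<Rightarrow> complex) \<Rightarrow> real \<Rightarrow> complex) \<Rightarrow> bool" where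
  "local_kernel k U h Q \<longleftrightarrow> (\<forall>\<phi>\<in>test_functions UNIV. integrable (lebesgue_on U) (\<lambda>x. h x * Q \<phi> x)) \<and>
     representable k (\<lambda>\<phi>. integral\<^sup>L (lebesgue_on U) (\<lambda>x. h x * Q \<phi> x))"

lemma local_kernel_cmult:
  assumes "local_kernel k U h Q"
  shows "local_kernel k U h (\<lambda>\<phi> x. c * Q \<phi> x)"
  using assms representable_cmult[of k _ c] by (simp add: local_kernel_def mult.left_commute[of _ c])

lemma local_kernel_sum:
  assumes "finite I" "\<And>j. j \<in> I \<Longrightarrow> local_kernel k U h (Q j)"
  shows "local_kernel k U h (\<lambda>\<phi> x. \<Sum>j\<in>I. Q j \<phi> x)"
  unfolding local_kernel_def
proof (intro conjI ballI)
  have i: "integrable (lebesgue_on U) (\<lambda>x. h x * Q j \<phi> x)" if "j \<in> I" "\<phi> \<in> test_functions UNIV" for j \<phi>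
    using assms(2) that by (simp add: local_kernel_def)
  show "integrable (lebesgue_on U) (\<lambda>x. h x * (\<Sum>j\<in>I. Q j \<phi> x))" if "\<phi> \<in> test_functions UNIV" for \<phi>
    unfolding sum_distrib_left by (intro Bochner_Integration.integrable_sum i that)
  have "representable k (\<lambda>\<phi>. \<Sum>j\<in>I. integral\<^sup>L (lebesgue_on U) (\<lambda>x. h x * Q j \<phi> x))"
    using assms by (intro representable_sum) (auto simp: local_kernel_def)
  then show "representable k (\<lambda>\<phi>. integral\<^sup>L (lebesgue_on U) (\<lambda>x. h x * (\<Sum>j\<in>I. Q j \<phi> x)))"
    by (rule representable_cong)
      (simp only: sum_distrib_left, intro Bochner_Integration.integral_sum i, auto)
qed

lemma local_kernel_cong:
  assumes "local_kernel k U h Q" "\<And>\<phi> x. \<phi> \<in> test_functions UNIV \<Longrightarrow> Q' \<phi> x = Q \<phi> x"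
  shows "local_kernel k U h Q'"
  using assms unfolding local_kernel_def by (auto elim!: representable_cong)

lemma local_kernel_base:
  assumes h: "Linf_loc U h" and U: "open U" "{-e..e} \<subseteq> U"
    and R: "R \<in> borel_measurable borel" "\<And>x. norm (R x) \<le> C" "\<And>x. x \<notin> {-e..e} \<Longrightarrow> R x = 0"
  shows "local_kernel k U h (\<lambda>\<phi> x. R x * nderiv l (\<lambda>t. of_real (t ^ (k + l)) * fourier \<phi> t) x)"
proof (rule borel_representative[OF assms])
  fix H B assume H: "H \<in> borel_measurable borel" "\<And>x. norm (H x) \<le> B" "\<And>x. x \<notin> {-e..e} \<Longrightarrow> H x = 0"
    "\<And>f. continuous_on UNIV f \<Longrightarrow> integrable (lebesgue_on U) (\<lambda>x. h x * (R x * f x))"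
    "\<And>f. continuous_on UNIV f \<Longrightarrow> integral\<^sup>L (lebesgue_on U) (\<lambda>x. h x * (R x * f x)) = (LBINT x. H x * f x)"
  have c: "continuous_on UNIV (nderiv l (\<lambda>t. of_real (t ^ (k + l)) * fourier \<phi> t))" if "\<phi> \<in> test_functions UNIV" for \<phi>
    using that by (intro smooth_on_continuous smooth_on_mult smooth_on_power smooth_on_fourier) auto
  show ?thesis
    unfolding local_kernel_def
    by (intro conjI ballI H(4) c representable_cong[OF representable_fourier_term[where l = l, OF H(1-3)]] H(5))
qed

text \<open>In the Leibniz formula the j-th derivative of F still vanishes to order k + (i - j).
  Divided by that power of x it is bounded and can be absorbed into h; the power goes to the
  derivative of order i - j of the transform, where it gives an expression covered by
  \<open>euler_form_power_nderiv\<close>.\<close>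

lemma local_kernel_derivative:
  assumes h: "Linf_loc U h" and U: "open U" "{-e..e} \<subseteq> U"
    and F: "zero_of_order UNIV 0 (i + k) F" "\<And>x. \<bar>x\<bar> > e \<Longrightarrow> F x = 0"
  shows "local_kernel k U h (\<lambda>\<phi>. nderiv i (\<lambda>t. F t * fourier \<phi> t))"
proof -
  note Fs = zero_of_order_smooth[OF F(1)]
  define R where "R j x = nderiv j F x / of_real (x ^ (k + (i - j)))" for j x
  have Fz: "zero_of_order UNIV 0 (k + (i - j)) (nderiv j F)" if "j \<le> i" for j
    using zero_of_order_nderiv[of UNIV 0 j "k + (i - j)" F] F(1) that by (simp add: add.commute)
  \<comment> \<open>At x = 0 with a positive exponent the quotient \<open>R j\<close> is 0 by
    convention; the identity holds because the derivative of F vanishes there too. No continuity of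
    \<open>R j\<close> at 0 is claimed.\<close>
  have Fj: "nderiv j F x = R j x * of_real (x ^ (k + (i - j)))" if "j \<le> i" for j x
  proof (cases "x = 0 \<and> k + (i - j) > 0")
    case True
    then have "nderiv 0 (nderiv j F) 0 = 0" using Fz[OF that] unfolding zero_of_order_def by blast
    then show ?thesis using True by simp
  next
    case False
    then have "of_real (x ^ (k + (i - j))) \<noteq> (0 :: complex)" by (auto simp: of_real_eq_0_iff)
    then show ?thesis by (simp add: R_def del: of_real_power)
  qed
  have R0: "R j x = 0" if "x \<notin> {-e..e}" for j x
  proof -
    have "nderiv j F x = 0"
      by (rule nderiv_eq_0[of "- {-e..e}"]) (use that F(2) in \<open>auto simp: open_Compl abs_if\<close>)
    then show ?thesis by (simp add: R_def)
  qed
  have Rm: "R j \<in> borel_measurable borel" for j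
    unfolding R_def[abs_def]
    by (intro borel_measurable_divide borel_measurable_continuous_onI smooth_on_continuous Fs continuous_intros)
  have Rb: "\<exists>C. \<forall>x. norm (R j x) \<le> C" if j: "j \<le> i" for j
  proof -
    obtain C where C: "\<And>x. x \<in> {-e..e} \<Longrightarrow> norm (nderiv j F x) \<le> C * \<bar>x\<bar> ^ (k + (i - j))"
      using zero_of_order_bound[OF subset_UNIV Fz[OF j]] by blast
    have "norm (R j x) \<le> \<bar>C\<bar>" for x
    proof (cases "x \<in> {-e..e}")
      case True
      have "norm (R j x) = norm (nderiv j F x) / \<bar>x\<bar> ^ (k + (i - j))"
        by (simp only: R_def norm_divide norm_of_real power_abs)
      also have "\<dots> \<le> (C * \<bar>x\<bar> ^ (k + (i - j))) / \<bar>x\<bar> ^ (k + (i - j))"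
        by (intro divide_right_mono C True) auto
      also have "\<dots> \<le> \<bar>C\<bar>" by (cases "\<bar>x\<bar> ^ (k + (i - j)) = 0") (simp_all del: power_eq_0_iff)
      finally show ?thesis .
    qed (simp add: R0)
    then show ?thesis by blast
  qed
  define Q where "Q m c L \<longleftrightarrow> (\<forall>f. smooth_on UNIV f \<longrightarrow> (\<forall>x. of_real (x ^ (k + m)) * nderiv m f x =
      (\<Sum>l\<le>L. c l * nderiv l (\<lambda>t. of_real (t ^ (k + l)) * f t) x)))" for m c and L :: nat
  have "\<exists>c L. Q m c L" for m
    using euler_form_power_nderiv[of k m] unfolding euler_form_def Q_def .
  then obtain c and L :: "nat \<Rightarrow> nat" where "\<And>m. Q m (c m) (L m)" by metis
  then have E: "of_real (x ^ (k + m)) * nderiv m f x = (\<Sum>l\<le>L m. c m l * nderiv l (\<lambda>t. of_real (t ^ (k + l)) * f t) x)"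
    if "smooth_on UNIV f" for m f x
    using that unfolding Q_def by blast
  have "local_kernel k U h (\<lambda>\<phi> x. \<Sum>j\<le>i. of_nat (i choose j) * (\<Sum>l\<le>L (i - j). c (i - j) l *
      (R j x * nderiv l (\<lambda>t. of_real (t ^ (k + l)) * fourier \<phi> t) x)))"
  proof (intro local_kernel_sum local_kernel_cmult)
    fix j l assume "j \<in> {..i}"
    then obtain C where "\<And>x. norm (R j x) \<le> C" using Rb by auto
    then show "local_kernel k U h (\<lambda>\<phi> x. R j x * nderiv l (\<lambda>t. of_real (t ^ (k + l)) * fourier \<phi> t) x)"
      by (intro local_kernel_base[OF h U Rm _ R0])
  qed auto
  then show ?thesis
  proof (rule local_kernel_cong)
    fix \<phi> :: "real \<Rightarrow> complex" and x assume \<phi>: "\<phi> \<in> test_functions UNIV"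
    note s = smooth_on_fourier[OF \<phi>]
    show "nderiv i (\<lambda>t. F t * fourier \<phi> t) x = (\<Sum>j\<le>i. of_nat (i choose j) * (\<Sum>l\<le>L (i - j). c (i - j) l *
      (R j x * nderiv l (\<lambda>t. of_real (t ^ (k + l)) * fourier \<phi> t) x)))"
      unfolding nderiv_mult[OF open_UNIV Fs s UNIV_I]
    proof (intro sum.cong refl arg_cong2[where f = "(*)"])
      fix j assume "j \<in> {..i}"
      then have "nderiv j F x * nderiv (i - j) (fourier \<phi>) x =
          R j x * (of_real (x ^ (k + (i - j))) * nderiv (i - j) (fourier \<phi>) x)"
        by (simp only: Fj atMost_iff mult.assoc)
      also have "\<dots> = (\<Sum>l\<le>L (i - j). c (i - j) l * (R j x * nderiv l (\<lambda>t. of_real (t ^ (k + l)) * fourier \<phi> t) x))"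
        unfolding E[OF s] sum_distrib_left by (simp only: mult.left_commute)
      finally show "nderiv j F x * nderiv (i - j) (fourier \<phi>) x =
          (\<Sum>l\<le>L (i - j). c (i - j) l * (R j x * nderiv l (\<lambda>t. of_real (t ^ (k + l)) * fourier \<phi> t) x))" .
    qed
  qed
qed

lemma smooth_on_UNIV_cutoff:
  assumes "smooth_on U F" "{-e..e} \<subseteq> U" "\<And>x. \<bar>x\<bar> > e \<Longrightarrow> F x = 0"
  shows "smooth_on UNIV F"
proof -
  have "smooth_on (- {-e..e}) F"
    by (rule smooth_on_cong[OF _ _ smooth_on_const[where c = 0]])
      (use assms(3) in \<open>auto simp: open_Compl abs_if\<close>)
  then show ?thesis using assms(1,2) unfolding smooth_on_def by blast
qed

text \<open>The orders of vanishing add up: i for the i-th coefficient of a tangential operator, k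
  for f and 0 for the cutoff. The sum i + k is what i outer derivatives can afford if k orders are
  to remain.\<close>

lemma representable_local:
  assumes U: "open U" "0 \<in> U" "{-e..e} \<subseteq> U"
    and \<kappa>: "smooth_on UNIV \<kappa>" "\<And>x. \<bar>x\<bar> > e \<Longrightarrow> \<kappa> x = 0"
    and h: "Linf_loc U h" and D: "diff_op_on U D" "tangential U 0 D"
    and f: "fun_vanishes_to_order U 0 k f"
  shows "representable k (\<lambda>\<phi>. dist_mult f (dist_op D (dist_of_fun U h)) (\<lambda>x. \<kappa> x * fourier \<phi> x))"
proof -
  define F where "F i t = (D ! i) t * (f t * \<kappa> t)" for i t
  have F0: "F i x = 0" if "\<bar>x\<bar> > e" for i x using \<kappa>(2)[OF that] by (simp add: F_def)
  have Fz: "zero_of_order UNIV 0 (i + k) (F i)" if "i < length D" for i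
  proof -
    have f: "zero_of_order U 0 k f"
      using f U by (intro point_ideal_power_zero_of_order) (auto simp: fun_vanishes_to_order_def)
    have k: "zero_of_order U 0 0 \<kappa>" using smooth_on_subset[OF \<kappa>(1)] by (auto simp: zero_of_order_def)
    have z: "zero_of_order U 0 (i + (k + 0)) (F i)"
      unfolding F_def[abs_def]
      by (intro zero_of_order_mult U(1,2) tangential_coefficient[OF U(1,2) D that] f k)
    then show ?thesis
      using smooth_on_UNIV_cutoff[OF _ U(3) F0] by (simp add: zero_of_order_def)
  qed
  have "local_kernel k U h (\<lambda>\<phi> x. \<Sum>i<length D. (- 1) ^ i * nderiv i (\<lambda>t. F i t * fourier \<phi> t) x)"
    by (intro local_kernel_sum local_kernel_cmult local_kernel_derivative[OF h U(1,3) Fz F0]) auto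
  moreover have "dist_mult f (dist_op D (dist_of_fun U h)) (\<lambda>x. \<kappa> x * fourier \<phi> x) =
      integral\<^sup>L (lebesgue_on U) (\<lambda>x. h x * (\<Sum>i<length D. (- 1) ^ i * nderiv i (\<lambda>t. F i t * fourier \<phi> t) x))" for \<phi>
    unfolding dist_mult_def dist_op_def dist_of_fun_def transpose_op_def F_def mult.assoc ..
  ultimately show ?thesis by (simp only: local_kernel_def)
qed

subsection \<open>Functionals of compact support and superposition of exponentials\<close>

text \<open>Linear functionals on all smooth functions, of order N and supported in [-b, b]; in
  particular they apply to exponentials. Continuity is stated with an arbitrary bound B in place of
  a supremum, so estimates can be inserted directly.\<close>

definition compact_functional :: "nat \<Rightarrow> real \<Rightarrow> functional \<Rightarrow> bool" where
  "compact_functional N b T \<longleftrightarrow>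
     (\<forall>E E'. smooth_on UNIV E \<longrightarrow> smooth_on UNIV E' \<longrightarrow> T (\<lambda>x. E x - E' x) = T E - T E') \<and>
     (\<forall>c E. smooth_on UNIV E \<longrightarrow> T (\<lambda>x. c * E x) = c * T E) \<and>
     (\<exists>C\<ge>0. \<forall>E B. smooth_on UNIV E \<longrightarrow> (\<forall>j\<le>N. \<forall>x\<in>{-b..b}. norm (nderiv j E x) \<le> B) \<longrightarrow> norm (T E) \<le> C * B)"

lemma compact_functional_diff:
  "compact_functional N b T \<Longrightarrow> smooth_on UNIV E \<Longrightarrow> smooth_on UNIV E' \<Longrightarrow> T (\<lambda>x. E x - E' x) = T E - T E'"
  unfolding compact_functional_def by blast

lemma compact_functional_cmult:
  "compact_functional N b T \<Longrightarrow> smooth_on UNIV E \<Longrightarrow> T (\<lambda>x. c * E x) = c * T E"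
  unfolding compact_functional_def by blast

definition fourier_kernel :: "(real \<Rightarrow> complex) \<Rightarrow> nat \<Rightarrow> real \<Rightarrow> real \<Rightarrow> complex" where
  "fourier_kernel f j x y = (- two_pi_i * of_real y) ^ j * f y * e_char (- (x * y))"

text \<open>The mean value inequality in y. The exponential contributes |2 pi x| \<le> 8 b to the
  derivative. Uniformity in x and in j \<le> N is what an estimate under a functional of order N
  requires.\<close>

lemma kernel_lipschitz:
  assumes P: "smooth_on UNIV P"
  shows "\<exists>M\<ge>0. \<forall>j\<le>N. \<forall>x\<in>{-b..b}. \<forall>y\<in>{-a..a}. \<forall>y'\<in>{-a..a}.
    norm (fourier_kernel P j x y' - fourier_kernel P j x y)
      \<le> M * \<bar>y' - y\<bar>"
proof -
  have "\<exists>M. \<forall>x\<in>{-b..b}. \<forall>y\<in>{-a..a}. \<forall>y'\<in>{-a..a}.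
    norm (fourier_kernel P j x y' - fourier_kernel P j x y)
      \<le> M * \<bar>y' - y\<bar>" for j
  proof -
    define p where "p y = (- two_pi_i * of_real y) ^ j * P y" for y
    have ps: "smooth_on UNIV p"
      unfolding p_def[abs_def] power_monomial mult.assoc
      by (intro smooth_on_cmult smooth_on_mult smooth_on_power P) auto
    have "\<exists>B. \<forall>y\<in>{-a..a}. norm (nderiv n p y) \<le> B" for n
      by (rule smooth_on_bounded[OF ps subset_UNIV]) blast
    then obtain B where B: "\<And>n y. y \<in> {-a..a} \<Longrightarrow> norm (nderiv n p y) \<le> B n" by metis
    show ?thesis
    proof (intro exI ballI)
      fix x y y' assume x: "x \<in> {-b..b}" and y: "y \<in> {-a..a}" "y' \<in> {-a..a}"
      have seg: "closed_segment y y' \<subseteq> {-a..a}" using y by (intro closed_segment_subset) auto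
      have "norm (p y' * e_char (- (x * y')) - p y * e_char (- (x * y))) \<le> (B 0 * (8 * b) + B 1) * \<bar>y' - y\<bar>"
      proof (rule vector_derivative_bound)
        fix z assume "z \<in> closed_segment y y'"
        then have z: "z \<in> {-a..a}" using seg by blast
        have "(p has_vector_derivative nderiv 1 p z) (at z)"
          using smooth_onD[OF ps UNIV_I, of 0] by simp
        then have "(p has_vector_derivative nderiv 1 p z) (at z within closed_segment y y')"
          by (rule has_vector_derivative_at_within)
        then show "((\<lambda>z. p z * e_char (- (x * z))) has_vector_derivative
            p z * ((- two_pi_i * of_real x) * e_char (- (x * z))) + nderiv 1 p z * e_char (- (x * z))) (at z within closed_segment y y')"
          by (intro has_vector_derivative_mult e_char_has_vector_derivative)
        have "norm (p z * ((- two_pi_i * of_real x) * e_char (- (x * z))) + nderiv 1 p z * e_char (- (x * z)))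
            \<le> norm (p z) * (norm two_pi_i * \<bar>x\<bar>) + norm (nderiv 1 p z)"
          by (rule order_trans[OF norm_triangle_ineq]) (simp add: norm_mult)
        also have "\<dots> \<le> B 0 * (8 * b) + B 1"
          using B[OF z, of 0] B[OF z, of 1] norm_two_pi_i x
          by (intro add_mono mult_mono) (auto simp: abs_if intro: order_trans[OF norm_ge_zero])
        finally show "norm (p z * ((- two_pi_i * of_real x) * e_char (- (x * z))) + nderiv 1 p z * e_char (- (x * z)))
            \<le> B 0 * (8 * b) + B 1" .
      qed
      then show "norm (fourier_kernel P j x y' - fourier_kernel P j x y)
          \<le> (B 0 * (8 * b) + B 1) * \<bar>y' - y\<bar>"
        by (simp add: p_def fourier_kernel_def)
    qed
  qed
  then obtain M where M: "\<And>j x y y'. x \<in> {-b..b} \<Longrightarrow> y \<in> {-a..a} \<Longrightarrow> y' \<in> {-a..a} \<Longrightarrow>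
    norm (fourier_kernel P j x y' - fourier_kernel P j x y)
      \<le> M j * \<bar>y' - y\<bar>" by metis
  show ?thesis
  proof (intro exI conjI allI impI ballI)
    show "0 \<le> (\<Sum>j\<le>N. \<bar>M j\<bar>)" by (intro sum_nonneg) auto
    fix j x y y' assume j: "j \<le> N" and *: "x \<in> {-b..b}" "y \<in> {-a..a}" "y' \<in> {-a..a}"
    have "M j \<le> (\<Sum>j\<le>N. \<bar>M j\<bar>)"
      using member_le_sum[of j "{..N}" "\<lambda>j. \<bar>M j\<bar>"] j by auto
    from mult_right_mono[OF this, of "\<bar>y' - y\<bar>"] M[OF *, of j]
    show "norm (fourier_kernel P j x y' - fourier_kernel P j x y)
      \<le> (\<Sum>j\<le>N. \<bar>M j\<bar>) * \<bar>y' - y\<bar>" by simp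
  qed
qed

text \<open>The functional is applied to the difference of two exponentials, whose x-derivatives up
  to order N are small by the Lipschitz bound for the constant function 1.\<close>

lemma compact_functional_e_char_continuous:
  assumes T: "compact_functional N b T"
  shows "continuous_on UNIV (\<lambda>y. T (\<lambda>x. e_char (- (x * y))))"
proof -
  obtain C where C: "C \<ge> 0" "\<And>E B. smooth_on UNIV E \<Longrightarrow> \<forall>j\<le>N. \<forall>x\<in>{-b..b}. norm (nderiv j E x) \<le> B \<Longrightarrow> norm (T E) \<le> C * B"
    using T unfolding compact_functional_def by blast
  define g where "g y = T (\<lambda>x. e_char (- (x * y)))" for y
  have "(g \<longlongrightarrow> g y) (at y)" for y
  proof -
    define a where "a = \<bar>y\<bar> + 1"
    obtain M where M: "M \<ge> 0" "\<And>j x y y'. j \<le> N \<Longrightarrow> x \<in> {-b..b} \<Longrightarrow> y \<in> {-a..a} \<Longrightarrow> y' \<in> {-a..a} \<Longrightarrow>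
      norm (fourier_kernel (\<lambda>_. 1) j x y' - fourier_kernel (\<lambda>_. 1) j x y) \<le> M * \<bar>y' - y\<bar>"
      using kernel_lipschitz[OF smooth_on_const[OF open_UNIV, of 1], of N b a] by metis
    have L: "norm (g y' - g y) \<le> C * (M * \<bar>y' - y\<bar>)" if "\<bar>y' - y\<bar> < 1" for y'
    proof -
      have "g y' - g y = T (\<lambda>x. e_char (- (x * y')) - e_char (- (x * y)))"
        unfolding g_def by (rule compact_functional_diff[OF T smooth_on_e_char smooth_on_e_char, symmetric])
      also have "norm \<dots> \<le> C * (M * \<bar>y' - y\<bar>)"
      proof (intro C(2) smooth_on_diff smooth_on_e_char open_UNIV allI impI ballI)
        fix j x assume "j \<le> N" "x \<in> {-b..b}"
        moreover have "y \<in> {-a..a}" "y' \<in> {-a..a}" using that by (auto simp: a_def abs_if split: if_splits)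
        ultimately show "norm (nderiv j (\<lambda>x. e_char (- (x * y')) - e_char (- (x * y))) x) \<le> M * \<bar>y' - y\<bar>"
          using M(2)[of j x y y'] by (simp only: nderiv_diff[OF open_UNIV smooth_on_e_char smooth_on_e_char UNIV_I] nderiv_e_char fourier_kernel_def mult_1_right)
      qed
      finally show ?thesis .
    qed
    have "((\<lambda>y'. g y' - g y) \<longlongrightarrow> 0) (at y)"
    proof (rule Lim_null_comparison)
      show "\<forall>\<^sub>F y' in at y. norm (g y' - g y) \<le> C * (M * \<bar>y' - y\<bar>)"
        unfolding eventually_at by (rule exI[of _ 1]) (use L in \<open>auto simp: dist_real_def\<close>)
      show "((\<lambda>y'. C * (M * \<bar>y' - y\<bar>)) \<longlongrightarrow> 0) (at y)"
        by (auto intro!: tendsto_eq_intros)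
    qed
    then show ?thesis by (simp add: LIM_zero_iff)
  qed
  then show ?thesis by (simp add: continuous_on_eq_continuous_at isCont_def g_def[symmetric])
qed

text \<open>The integral over \<open>y\<close> is taken out of \<open>T\<close> by differentiating with respect to its upper
  limit.\<close>

lemma compact_functional_fourier:
  assumes T: "compact_functional N b T" and f: "f \<in> test_functions UNIV"
  shows "T (fourier f) = (LBINT y. T (\<lambda>x. e_char (- (x * y))) * f y)"
proof -
  obtain C where C: "C \<ge> 0" "\<And>E B. smooth_on UNIV E \<Longrightarrow> \<forall>j\<le>N. \<forall>x\<in>{-b..b}. norm (nderiv j E x) \<le> B \<Longrightarrow> norm (T E) \<le> C * B"
    using T unfolding compact_functional_def by blast
  obtain a where a: "a > 0" "\<And>n x. \<bar>x\<bar> \<ge> a \<Longrightarrow> nderiv n f x = 0" by (rule test_functions_support[OF f]) blast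
  have a0: "f x = 0" if "\<bar>x\<bar> \<ge> a" for x using a(2)[OF that, of 0] by simp
  note fs = test_functions_smooth[OF f]
  note fc = smooth_on_continuous0[OF fs]
  define g where "g y = T (\<lambda>x. e_char (- (x * y)))" for y
  have gc: "continuous_on UNIV g" unfolding g_def by (rule compact_functional_e_char_continuous[OF T])
  obtain M where M: "M \<ge> 0" "\<And>j x y y'. j \<le> N \<Longrightarrow> x \<in> {-b..b} \<Longrightarrow> y \<in> {-a..a} \<Longrightarrow> y' \<in> {-a..a} \<Longrightarrow>
      norm (fourier_kernel f j x y' - fourier_kernel f j x y) \<le> M * \<bar>y' - y\<bar>"
    using kernel_lipschitz[OF fs, of N b a] by metis
  define A where "A Y = T (fourier_integral (-a) Y f 0)" for Y
  \<comment> \<open>The remainder is T applied to E. The x-derivatives of E are integrals from Y to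
    Y' of the kernel minus its value at Y, hence quadratically small by the Lipschitz bound; so A
    has derivative \<open>g Y * f Y\<close>.\<close>
  have A: "norm (A Y' - A Y - (Y' - Y) *\<^sub>R (g Y * f Y)) \<le> C * (M * \<bar>Y' - Y\<bar> * \<bar>Y' - Y\<bar>)"
    if Y: "Y \<in> {-a..a}" "Y' \<in> {-a..a}" for Y Y'
  proof -
    define E where "E x = (fourier_integral (-a) Y' f 0 x - fourier_integral (-a) Y f 0 x) - (of_real (Y' - Y) * f Y) * e_char (- (x * Y))" for x
    note s = smooth_on_fourier_integral[OF fc]
    note s' = smooth_on_diff[OF open_UNIV s s]
    note s'' = smooth_on_cmult[OF open_UNIV smooth_on_e_char]
    have "T E = A Y' - A Y - (of_real (Y' - Y) * f Y) * g Y"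
      unfolding E_def[abs_def] compact_functional_diff[OF T s' s''] compact_functional_diff[OF T s s]
        compact_functional_cmult[OF T smooth_on_e_char] A_def g_def ..
    also have "\<dots> = A Y' - A Y - (Y' - Y) *\<^sub>R (g Y * f Y)"
      by (simp add: scaleR_conv_of_real mult_ac)
    finally have TE: "T E = A Y' - A Y - (Y' - Y) *\<^sub>R (g Y * f Y)" .
    have "norm (T E) \<le> C * (M * \<bar>Y' - Y\<bar> * \<bar>Y' - Y\<bar>)"
    proof (intro C(2) allI impI ballI)
      show "smooth_on UNIV E" unfolding E_def[abs_def] by (rule smooth_on_diff[OF open_UNIV s' s''])
      fix j x assume j: "j \<le> N" and x: "x \<in> {-b..b}"
      define K where "K = fourier_kernel f j x"
      have Kc: "continuous_on {-a..a} K"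
        unfolding K_def fourier_kernel_def[abs_def] by (intro continuous_intros continuous_on_subset[OF fc]) auto
      have "nderiv j E x = fourier_integral (-a) Y' f j x - fourier_integral (-a) Y f j x - (Y' - Y) *\<^sub>R K Y"
        unfolding E_def[abs_def] nderiv_diff[OF open_UNIV s' s'' UNIV_I] nderiv_diff[OF open_UNIV s s UNIV_I]
          nderiv_cmult[OF open_UNIV smooth_on_e_char UNIV_I] nderiv_fourier_integral[OF fc] nderiv_e_char K_def fourier_kernel_def
        by (simp add: scaleR_conv_of_real mult_ac)
      also have "norm \<dots> \<le> norm (Y' - Y) * (M * \<bar>Y' - Y\<bar>)"
        unfolding fourier_integral_def fourier_kernel_def[symmetric] K_def[symmetric]
      proof (rule vector_differentiable_bound_linearization[where S = "closed_segment Y Y'"])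
        have seg: "closed_segment Y Y' \<subseteq> {-a..a}" using Y by (intro closed_segment_subset) auto
        fix z assume z: "z \<in> closed_segment Y Y'"
        show "((\<lambda>Y. integral {-a..Y} K) has_vector_derivative K z) (at z within closed_segment Y Y')"
          using seg z by (intro has_vector_derivative_within_subset[OF integral_has_vector_derivative[OF Kc]]) auto
        have "norm (K z - K Y) \<le> M * \<bar>z - Y\<bar>"
          unfolding K_def using seg z by (intro M(2)[OF j x Y(1)]) auto
        also have "\<dots> \<le> M * \<bar>Y' - Y\<bar>"
          using z M(1) by (intro mult_left_mono) (auto simp: closed_segment_eq_real_ivl split: if_splits)
        finally show "norm (K z - K Y) \<le> M * \<bar>Y' - Y\<bar>" .
      qed auto
      finally show "norm (nderiv j E x) \<le> M * \<bar>Y' - Y\<bar> * \<bar>Y' - Y\<bar>" by (simp add: mult_ac)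
    qed
    then show ?thesis unfolding TE .
  qed
  have "((\<lambda>Y. g Y * f Y) has_integral (A a - A (- a))) {-a..a}"
  proof (rule fundamental_theorem_of_calculus)
    fix Y assume Y: "Y \<in> {-a..a}"
    show "(A has_vector_derivative g Y * f Y) (at Y within {-a..a})"
      unfolding has_vector_derivative_def has_derivative_iff_norm
    proof
      show "((\<lambda>Y'. norm (A Y' - A Y - (Y' - Y) *\<^sub>R (g Y * f Y)) / norm (Y' - Y)) \<longlongrightarrow> 0) (at Y within {-a..a})"
      proof (rule Lim_null_comparison)
        show "\<forall>\<^sub>F Y' in at Y within {-a..a}. norm (norm (A Y' - A Y - (Y' - Y) *\<^sub>R (g Y * f Y)) / norm (Y' - Y)) \<le> C * (M * \<bar>Y' - Y\<bar>)"
          unfolding eventually_at_filter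
        proof (rule always_eventually, intro allI impI)
          fix Y' assume "Y' \<noteq> Y" "Y' \<in> {-a..a}"
          then show "norm (norm (A Y' - A Y - (Y' - Y) *\<^sub>R (g Y * f Y)) / norm (Y' - Y)) \<le> C * (M * \<bar>Y' - Y\<bar>)"
            using A[OF Y, of Y'] by (simp add: pos_divide_le_eq mult_ac)
        qed
        show "((\<lambda>Y'. C * (M * \<bar>Y' - Y\<bar>)) \<longlongrightarrow> 0) (at Y within {-a..a})"
          by (auto intro!: tendsto_eq_intros)
      qed
    qed (rule bounded_linear_scaleR_left)
  qed (use a in auto)
  then have I: "integral {-a..a} (\<lambda>Y. g Y * f Y) = A a - A (- a)" by (rule integral_unique)
  \<comment> \<open>Zero is written as a multiple of an exponential so that homogeneity of T yields
    the initial value \<open>A (- a) = 0\<close>.\<close>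
  have "fourier_integral (-a) (-a) f 0 = (\<lambda>x. 0 * e_char (- (x * 0)))"
    by (simp add: fun_eq_iff fourier_integral_def)
  then have "A (- a) = 0"
    using compact_functional_cmult[OF T smooth_on_e_char[of 0], of 0] by (simp only: A_def mult_zero_left)
  moreover have "A a = T (fourier f)"
    using fourier_eq_fourier_integral[where a = a, OF fc a0] by (simp add: A_def)
  moreover have "(LBINT y. g y * f y) = integral {-a..a} (\<lambda>Y. g Y * f Y)"
    by (rule integral_compact_support) (use gc fc a0 in \<open>auto intro!: continuous_intros\<close>)
  ultimately show ?thesis using I by (simp add: g_def)
qed

subsection \<open>The part of the distribution away from the origin\<close>

lemma schwartz_smooth: "f \<in> schwartz \<Longrightarrow> smooth_on UNIV f"
  by (simp add: schwartz_def)

lemma schwartz_bounded: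
  assumes "f \<in> schwartz"
  obtains B where "\<And>x. norm (nderiv n f x) \<le> B"
proof -
  have "bounded (range (\<lambda>x. of_real (x ^ 0) * nderiv n f x))"
    using assms unfolding schwartz_def by blast
  then show ?thesis using that by (auto simp: bounded_iff)
qed

lemma schwartz_cmult:
  assumes "f \<in> schwartz"
  shows "(\<lambda>x. c * f x) \<in> schwartz"
  unfolding schwartz_def
proof (intro CollectI conjI allI smooth_on_cmult open_UNIV schwartz_smooth[OF assms])
  fix m n
  have "bounded (range (\<lambda>x. of_real (x ^ m) * nderiv n f x))" using assms by (simp add: schwartz_def)
  then have "bounded ((\<lambda>z. c * z) ` range (\<lambda>x. of_real (x ^ m) * nderiv n f x))"
    by (rule bounded_linear_image) (rule bounded_linear_mult_right)
  then show "bounded (range (\<lambda>x. of_real (x ^ m) * nderiv n (\<lambda>x. c * f x) x))"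
    by (simp add: image_image nderiv_cmult[OF open_UNIV schwartz_smooth[OF assms]] mult.left_commute[of c] del: of_real_power)
qed

lemma schwartz_diff:
  assumes "f \<in> schwartz" "g \<in> schwartz"
  shows "(\<lambda>x. f x - g x) \<in> schwartz"
  unfolding schwartz_def
proof (intro CollectI conjI allI smooth_on_diff open_UNIV schwartz_smooth assms)
  fix m n
  have "bounded (range (\<lambda>x. of_real (x ^ m) * nderiv n f x))" "bounded (range (\<lambda>x. of_real (x ^ m) * nderiv n g x))"
    using assms by (auto simp: schwartz_def)
  then have "bounded (range (\<lambda>x. of_real (x ^ m) * nderiv n f x - of_real (x ^ m) * nderiv n g x))"
    by (rule bounded_minus_comp)
  then show "bounded (range (\<lambda>x. of_real (x ^ m) * nderiv n (\<lambda>x. f x - g x) x))"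
    by (simp add: nderiv_diff[OF open_UNIV schwartz_smooth[OF assms(1)] schwartz_smooth[OF assms(2)]] right_diff_distrib del: of_real_power)
qed

lemma tempered_cmult: "tempered \<sigma> \<Longrightarrow> f \<in> schwartz \<Longrightarrow> \<sigma> (\<lambda>x. c * f x) = c * \<sigma> f"
  unfolding tempered_def by blast

lemma tempered_diff:
  assumes "tempered \<sigma>" "f \<in> schwartz" "g \<in> schwartz"
  shows "\<sigma> (\<lambda>x. f x - g x) = \<sigma> f - \<sigma> g"
proof -
  have "\<forall>f\<in>schwartz. \<forall>g\<in>schwartz. \<sigma> (\<lambda>x. f x + g x) = \<sigma> f + \<sigma> g"
    using assms(1) unfolding tempered_def by blast
  from bspec[OF bspec[OF this schwartz_diff[OF assms(2,3)]] assms(3)] show ?thesis by simp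
qed

text \<open>A single weight (1 + |x|)^N dominates all |x|^m with m \<le> N, so the double sum of
  suprema costs only the factor (N + 1)^2.\<close>

lemma tempered_bound:
  assumes "tempered \<sigma>"
  shows "\<exists>C\<ge>0. \<exists>N. \<forall>f\<in>schwartz. \<forall>B. (\<forall>n\<le>N. \<forall>x. (1 + \<bar>x\<bar>) ^ N * norm (nderiv n f x) \<le> B) \<longrightarrow> norm (\<sigma> f) \<le> C * B"
proof -
  obtain C N where C: "\<And>f. f \<in> schwartz \<Longrightarrow> norm (\<sigma> f) \<le> C * (\<Sum>m\<le>N. \<Sum>n\<le>N. SUP x. norm (of_real (x ^ m) * nderiv n f x))"
    using assms unfolding tempered_def by blast
  show ?thesis
  proof (intro exI conjI ballI allI impI)
    show "0 \<le> \<bar>C\<bar> * (real (Suc N) * real (Suc N))" by simp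
    fix f B assume f: "f \<in> schwartz" and B: "\<forall>n\<le>N. \<forall>x. (1 + \<bar>x\<bar>) ^ N * norm (nderiv n f x) \<le> B"
    have up: "(SUP x. norm (of_real (x ^ m) * nderiv n f x)) \<le> B" if "m \<le> N" "n \<le> N" for m n
    proof (rule cSUP_least)
      fix x
      have "norm (of_real (x ^ m) * nderiv n f x) = \<bar>x\<bar> ^ m * norm (nderiv n f x)"
        by (simp only: norm_mult norm_of_real power_abs)
      also have "\<bar>x\<bar> ^ m \<le> (1 + \<bar>x\<bar>) ^ m" by (intro power_mono) auto
      also have "\<dots> \<le> (1 + \<bar>x\<bar>) ^ N" using that(1) by (intro power_increasing) auto
      finally have "norm (of_real (x ^ m) * nderiv n f x) \<le> (1 + \<bar>x\<bar>) ^ N * norm (nderiv n f x)"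
        by (simp add: mult_right_mono)
      also have "\<dots> \<le> B" using B that(2) by blast
      finally show "norm (of_real (x ^ m) * nderiv n f x) \<le> B" .
    qed simp
    have low: "0 \<le> (SUP x. norm (of_real (x ^ m) * nderiv n f x))" for m n
    proof (rule cSUP_upper2[where x = 0])
      have "bounded (range (\<lambda>x. of_real (x ^ m) * nderiv n f x))" using f by (simp add: schwartz_def)
      then show "bdd_above (range (\<lambda>x. norm (of_real (x ^ m) * nderiv n f x)))"
        unfolding bounded_iff bdd_above_def by blast
    qed auto
    have "norm (\<sigma> f) \<le> C * (\<Sum>m\<le>N. \<Sum>n\<le>N. SUP x. norm (of_real (x ^ m) * nderiv n f x))" by (rule C[OF f])
    also have "\<dots> \<le> \<bar>C\<bar> * (\<Sum>m\<le>N. \<Sum>n\<le>N. SUP x. norm (of_real (x ^ m) * nderiv n f x))"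
      by (intro mult_right_mono sum_nonneg low) auto
    also have "\<dots> \<le> \<bar>C\<bar> * (\<Sum>m\<le>N. \<Sum>n\<le>N. B)"
      by (intro mult_left_mono sum_mono up) auto
    finally show "norm (\<sigma> f) \<le> \<bar>C\<bar> * (real (Suc N) * real (Suc N)) * B" by (simp add: mult_ac)
  qed
qed

lemma nderiv_mult_bound:
  assumes f: "smooth_on UNIV f" and g: "smooth_on UNIV g"
    and a: "\<And>j. j \<le> n \<Longrightarrow> norm (nderiv j f x) \<le> a" and b: "\<And>j. j \<le> n \<Longrightarrow> norm (nderiv j g x) \<le> b"
  shows "norm (nderiv n (\<lambda>x. f x * g x) x) \<le> 2 ^ n * (a * b)"
proof -
  have a0: "0 \<le> a" by (rule order_trans[OF norm_ge_zero a[of 0]]) simp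
  have "norm (nderiv n (\<lambda>x. f x * g x) x) \<le> (\<Sum>j\<le>n. real (n choose j) * (a * b))"
    unfolding nderiv_mult[OF open_UNIV f g UNIV_I]
    by (rule order_trans[OF norm_sum sum_mono])
      (auto simp: norm_mult intro!: mult_left_mono mult_mono a b a0)
  also have "\<dots> = 2 ^ n * (a * b)"
    unfolding sum_distrib_right[symmetric] using choose_row_sum[of n] by (simp flip: of_nat_sum)
  finally show ?thesis .
qed

text \<open>Multiplication by v turns every smooth function into a test function, and outside the
  support of v no derivative of the product survives.\<close>

lemma tempered_compact_functional:
  assumes \<sigma>: "tempered \<sigma>" and v: "v \<in> test_functions UNIV"
  shows "\<exists>N b. compact_functional N b (\<lambda>E. \<sigma> (\<lambda>x. v x * E x))"
proof -
  obtain C N where C: "C \<ge> 0" "\<And>f B. f \<in> schwartz \<Longrightarrow> \<forall>n\<le>N. \<forall>x. (1 + \<bar>x\<bar>) ^ N * norm (nderiv n f x) \<le> B \<Longrightarrow> norm (\<sigma> f) \<le> C * B"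
    using tempered_bound[OF \<sigma>] by blast
  obtain b where b: "b > 0" "\<And>n x. \<bar>x\<bar> \<ge> b \<Longrightarrow> nderiv n v x = 0" by (rule test_functions_support[OF v]) blast
  note vs = test_functions_smooth[OF v]
  have sch: "(\<lambda>x. v x * E x) \<in> schwartz" if "smooth_on UNIV E" for E
    using test_functions_schwartz[OF test_functions_mult[OF v that]] by (simp add: mult.commute)
  have "\<exists>V. \<forall>x\<in>{-b..b}. norm (nderiv j v x) \<le> V" for j
    by (rule smooth_on_bounded[OF vs subset_UNIV]) blast
  then obtain V where V: "\<And>j x. x \<in> {-b..b} \<Longrightarrow> norm (nderiv j v x) \<le> V j" by metis
  define W where "W = (\<Sum>j\<le>N. V j)"
  have V0: "0 \<le> V j" for j by (rule order_trans[OF norm_ge_zero V[of 0]]) (use b in auto)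
  have W: "norm (nderiv j v x) \<le> W" if "j \<le> N" "x \<in> {-b..b}" for j x
    using V[OF that(2), of j] member_le_sum[of j "{..N}" V] that(1) V0 unfolding W_def by force
  have W0: "0 \<le> W" unfolding W_def by (intro sum_nonneg V0)
  define K where "K = (1 + b) ^ N * (2 ^ N * W)"
  have bd: "norm (\<sigma> (\<lambda>x. v x * E x)) \<le> C * K * B"
    if E: "smooth_on UNIV E" and B: "\<forall>j\<le>N. \<forall>x\<in>{-b..b}. norm (nderiv j E x) \<le> B" for E B
  proof -
    have B0: "0 \<le> B" using B b(1) order_trans[OF norm_ge_zero] by fastforce
    have "norm (\<sigma> (\<lambda>x. v x * E x)) \<le> C * (K * B)"
    proof (intro C(2) sch E allI impI)
      fix n x assume n: "n \<le> N"
      show "(1 + \<bar>x\<bar>) ^ N * norm (nderiv n (\<lambda>x. v x * E x) x) \<le> K * B"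
      proof (cases "x \<in> {-b..b}")
        case True
        have "norm (nderiv n (\<lambda>x. v x * E x) x) \<le> 2 ^ n * (W * B)"
          by (rule nderiv_mult_bound[OF vs E]) (use W True n B in auto)
        also have "\<dots> \<le> 2 ^ N * (W * B)"
          using n W0 B0 by (intro mult_right_mono power_increasing) auto
        finally have "(1 + \<bar>x\<bar>) ^ N * norm (nderiv n (\<lambda>x. v x * E x) x) \<le> (1 + b) ^ N * (2 ^ N * (W * B))"
          using True b(1) by (intro mult_mono power_mono) auto
        then show ?thesis by (simp add: K_def mult_ac)
      next
        case False
        then have "nderiv n (\<lambda>x. v x * E x) x = 0"
          unfolding nderiv_mult[OF open_UNIV vs E UNIV_I]
          by (intro sum.neutral ballI) (use b(2)[of x] in \<open>auto simp: abs_if\<close>)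
        then show ?thesis using W0 B0 b(1) by (simp add: K_def)
      qed
    qed
    then show ?thesis by (simp add: mult.assoc)
  qed
  have "0 \<le> C * K" using C(1) W0 b(1) by (simp add: K_def)
  moreover have "\<sigma> (\<lambda>x. v x * (E x - E' x)) = \<sigma> (\<lambda>x. v x * E x) - \<sigma> (\<lambda>x. v x * E' x)"
    if "smooth_on UNIV E" "smooth_on UNIV E'" for E E'
    using tempered_diff[OF \<sigma> sch[OF that(1)] sch[OF that(2)]] by (simp add: right_diff_distrib)
  moreover have "\<sigma> (\<lambda>x. v x * (c * E x)) = c * \<sigma> (\<lambda>x. v x * E x)" if "smooth_on UNIV E" for E c
    using tempered_cmult[OF \<sigma> sch[OF that]] by (simp add: mult.left_commute)
  ultimately have "compact_functional N b (\<lambda>E. \<sigma> (\<lambda>x. v x * E x))"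
    unfolding compact_functional_def using bd by blast
  then show ?thesis by blast
qed

text \<open>Division by x^n is harmless since 1 - \<kappa> vanishes near 0. For |x| > 1 the weight
  equals x^(-n), whose derivatives decay at least as fast; on [-1, 1] compactness gives a
  bound.\<close>

lemma outer_weight:
  assumes \<kappa>: "smooth_on UNIV \<kappa>" "d > 0" "\<And>x. \<bar>x\<bar> < d \<Longrightarrow> \<kappa> x = 1" "\<And>x. \<bar>x\<bar> > 1 \<Longrightarrow> \<kappa> x = 0" and n: "n > 0"
  defines "w \<equiv> (\<lambda>x. (1 - \<kappa> x) * of_real ((1 / x) ^ n))"
  shows smooth_on_outer_weight: "smooth_on UNIV w"
    and outer_weight_bound: "\<exists>W. \<forall>x. norm (nderiv j w x) * (1 + \<bar>x\<bar>) ^ n \<le> W"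
    and outer_weight_eq: "of_real (x ^ n) * w x = 1 - \<kappa> x"
proof -
  show "of_real (x ^ n) * w x = 1 - \<kappa> x"
    using n \<kappa>(2,3) by (cases "x = 0") (simp_all add: w_def power_divide)
  \<comment> \<open>The m-th derivative of y^(-n) is \<open>c m\<close> times y^(-n-m).\<close>
  define c :: "nat \<Rightarrow> complex" where "c = rec_nat 1 (\<lambda>m z. - of_nat (n + m) * z)"
  have c_Suc: "c (Suc m) = - of_nat (n + m) * c m" for m by (simp add: c_def)
  define F where "F m y = c m * of_real ((1 / y) ^ (n + m))" for m y
  have F: "(F m has_vector_derivative F (Suc m) y) (at y)" if "y \<in> - {0}" for m y
  proof -
    have "F (Suc m) y = c m * (- of_nat (n + m) * of_real ((1 / y) ^ (n + m + 1)))"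
      by (simp add: F_def c_Suc mult_ac del: of_nat_add)
    then show ?thesis
      using has_vector_derivative_mult_right[OF inverse_power_has_vector_derivative[of y "n + m"], of "c m"] that
      by (simp add: F_def[abs_def] mult.assoc)
  qed
  have F0: "of_real ((1 / y) ^ n) = F 0 y" for y by (simp add: F_def c_def)
  have op: "open (- {0::real})" by (auto simp: open_Compl)
  have s1: "smooth_on (- {0}) (\<lambda>y. of_real ((1 / y) ^ n))"
    by (rule smooth_on_derivative_sequence[OF op F0 F])
  have "smooth_on (- {0}) w"
    unfolding w_def
    by (intro smooth_on_mult[OF op _ s1] smooth_on_diff op smooth_on_const smooth_on_subset[OF \<kappa>(1)]) auto
  moreover have "smooth_on {-d<..<d} w"
    by (rule smooth_on_cong[OF _ _ smooth_on_const[where c = 0]]) (auto simp: w_def \<kappa>(3) abs_if)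
  ultimately show ws: "smooth_on UNIV w"
    using \<kappa>(2) unfolding smooth_on_def by (metis ComplI UNIV_I greaterThanLessThan_iff neg_less_0_iff_less singletonD)
  have "bounded ((\<lambda>x. norm (nderiv j w x) * (1 + \<bar>x\<bar>) ^ n) ` {-1..1})"
    by (intro compact_imp_bounded compact_continuous_image continuous_intros
        continuous_on_subset[OF smooth_on_continuous[OF ws]]) auto
  then obtain W where W: "\<And>x. x \<in> {-1..1} \<Longrightarrow> norm (nderiv j w x) * (1 + \<bar>x\<bar>) ^ n \<le> W"
    unfolding bounded_iff by fastforce
  show "\<exists>W. \<forall>x. norm (nderiv j w x) * (1 + \<bar>x\<bar>) ^ n \<le> W"
  proof (intro exI allI)
    fix x
    show "norm (nderiv j w x) * (1 + \<bar>x\<bar>) ^ n \<le> max W (norm (c j) * 2 ^ n)"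
    proof (cases "x \<in> {-1..1}")
      case True
      then show ?thesis using W by (simp add: max.coboundedI1)
    next
      case False
      then have x: "x \<in> - {-1..1}" and x1: "\<bar>x\<bar> > 1" by auto
      have "nderiv j w x = nderiv j (\<lambda>y. of_real ((1 / y) ^ n)) x"
      proof (rule nderiv_cong[of "- {-1..1}"])
        show "smooth_on (- {-1..1}) (\<lambda>y. of_real ((1 / y) ^ n))" by (rule smooth_on_subset[OF s1]) auto
      qed (use x \<kappa>(4) in \<open>auto simp: w_def open_Compl abs_if\<close>)
      also have "\<dots> = F j x"
        by (rule nderiv_derivative_sequence[OF op F0 F]) (use x in auto)
      finally have "norm (nderiv j w x) = norm (c j) * \<bar>1 / x\<bar> ^ (n + j)"
        by (simp only: F_def norm_mult norm_of_real power_abs)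
      also have "\<dots> \<le> norm (c j) * \<bar>1 / x\<bar> ^ n"
        using x1 by (intro mult_left_mono power_decreasing) auto
      finally have "norm (nderiv j w x) * (1 + \<bar>x\<bar>) ^ n \<le> norm (c j) * \<bar>1 / x\<bar> ^ n * (2 * \<bar>x\<bar>) ^ n"
        using x1 by (intro mult_mono power_mono) auto
      also have "\<dots> = norm (c j) * 2 ^ n * (\<bar>1 / x\<bar> * \<bar>x\<bar>) ^ n"
        by (simp only: power_mult_distrib mult_ac)
      also have "\<bar>1 / x\<bar> * \<bar>x\<bar> = 1" using x1 by (simp flip: abs_mult)
      finally show ?thesis by (simp add: max.coboundedI2)
    qed
  qed
qed

text \<open>The decay of w exceeds the weight (1 + |x|)^N in the bound for \<sigma> by one power. As
  q vanishes for |x| < R, this power is worth 1/(1 + R), the rate for all limits in the radius. The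
  factor 4^N comes from two Leibniz expansions.\<close>

lemma outer_estimate:
  assumes C: "C \<ge> 0" "\<And>f B. f \<in> schwartz \<Longrightarrow> \<forall>n\<le>N. \<forall>x. (1 + \<bar>x\<bar>) ^ N * norm (nderiv n f x) \<le> B \<Longrightarrow> norm (\<sigma> f) \<le> C * B"
    and w: "smooth_on UNIV w" "\<And>j x. j \<le> N \<Longrightarrow> norm (nderiv j w x) * (1 + \<bar>x\<bar>) ^ (N + 1) \<le> W"
    and q: "smooth_on UNIV q" "\<And>j x. j \<le> N \<Longrightarrow> norm (nderiv j q x) \<le> A" "R \<ge> 0" "\<And>x. \<bar>x\<bar> < R \<Longrightarrow> q x = 0"
    and E: "smooth_on UNIV E" "\<And>j x. j \<le> N \<Longrightarrow> norm (nderiv j E x) \<le> B"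
    and sch: "(\<lambda>x. q x * w x * E x) \<in> schwartz"
  shows "norm (\<sigma> (\<lambda>x. q x * w x * E x)) \<le> C * (4 ^ N * (A * W * B) / (1 + R))"
proof (intro C(2) sch allI impI)
  fix n x assume n: "n \<le> N"
  have A0: "0 \<le> A" by (rule order_trans[OF norm_ge_zero q(2)[of 0]]) simp
  have B0: "0 \<le> B" by (rule order_trans[OF norm_ge_zero E(2)[of 0]]) simp
  have W0: "0 \<le> W" by (rule order_trans[OF _ w(2)[of 0 0]]) auto
  note qw = smooth_on_mult[OF open_UNIV q(1) w(1)]
  show "(1 + \<bar>x\<bar>) ^ N * norm (nderiv n (\<lambda>x. q x * w x * E x) x) \<le> 4 ^ N * (A * W * B) / (1 + R)"
  proof (cases "\<bar>x\<bar> < R")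
    case True
    have "nderiv n (\<lambda>x. q x * w x * E x) x = 0"
      by (rule nderiv_eq_0[of "{-R<..<R}"]) (use True q(4) in \<open>auto simp: abs_less_iff\<close>)
    then show ?thesis using A0 B0 W0 q(3) by simp
  next
    case False
    define u where "u = W / (1 + \<bar>x\<bar>) ^ (N + 1)"
    have u: "norm (nderiv j w x) \<le> u" if "j \<le> N" for j
      using w(2)[OF that, of x] by (simp add: u_def pos_le_divide_eq del: power_Suc)
    have u0: "0 \<le> u" using W0 by (simp add: u_def)
    have "norm (nderiv j (\<lambda>x. q x * w x) x) \<le> 2 ^ N * (A * u)" if "j \<le> n" for j
    proof -
      have "norm (nderiv j (\<lambda>x. q x * w x) x) \<le> 2 ^ j * (A * u)"
        by (rule nderiv_mult_bound[OF q(1) w(1)]) (use q(2) u n that in auto)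
      also have "\<dots> \<le> 2 ^ N * (A * u)"
        using n that A0 u0 by (intro mult_right_mono power_increasing) auto
      finally show ?thesis .
    qed
    then have "norm (nderiv n (\<lambda>x. q x * w x * E x) x) \<le> 2 ^ n * (2 ^ N * (A * u) * B)"
      by (intro nderiv_mult_bound[OF qw E(1)]) (use E(2) n in auto)
    also have "\<dots> \<le> 2 ^ N * (2 ^ N * (A * u) * B)"
      using n A0 u0 B0 by (intro mult_right_mono power_increasing) auto
    also have "\<dots> = 4 ^ N * (A * W * B) / ((1 + \<bar>x\<bar>) ^ N * (1 + \<bar>x\<bar>))"
      by (simp add: u_def power_mult_distrib[symmetric] mult_ac)
    finally have "(1 + \<bar>x\<bar>) ^ N * norm (nderiv n (\<lambda>x. q x * w x * E x) x) \<le> (1 + \<bar>x\<bar>) ^ N * (4 ^ N * (A * W * B) / ((1 + \<bar>x\<bar>) ^ N * (1 + \<bar>x\<bar>)))"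
      by (intro mult_left_mono) auto
    also have "\<dots> = 4 ^ N * (A * W * B) / (1 + \<bar>x\<bar>)" by simp
    also have "\<dots> \<le> 4 ^ N * (A * W * B) / (1 + R)"
      using False A0 B0 W0 q(3) by (intro divide_left_mono) auto
    finally show ?thesis .
  qed
qed

lemma inverse_Suc_cauchy:
  fixes X :: "nat \<Rightarrow> complex"
  assumes "\<And>r s. r \<le> s \<Longrightarrow> norm (X r - X s) \<le> K / (1 + real r)"
  shows "convergent X"
proof (rule Cauchy_convergent, rule CauchyI')
  fix e :: real assume e: "e > 0"
  obtain M :: nat where M: "K / e < real M" using reals_Archimedean2 by blast
  show "\<exists>M. \<forall>m\<ge>M. \<forall>n>m. dist (X m) (X n) < e"
  proof (intro exI allI impI)
    fix m n assume m: "m \<ge> M" "n > m"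
    have "K < e * (1 + real m)"
      using M e m(1) by (simp add: pos_divide_less_eq) (smt (verit) mult.commute mult_strict_left_mono of_nat_le_iff)
    then have "K / (1 + real m) < e" by (simp add: pos_divide_less_eq)
    then show "dist (X m) (X n) < e" using assms[of m n] m(2) by (simp add: dist_norm)
  qed
qed

text \<open>Away from the origin \<open>\<sigma>\<close> equals \<open>x ^ n\<close> times a distribution whose Fourier transform is a
  function \<open>g\<close>. The growth of \<open>g\<close> is bounded by the order \<open>N\<close> of \<open>\<sigma>\<close>, independently of \<open>n\<close>, so that
  \<open>n - N\<close> can be made as large as required.\<close>

lemma representable_outer:
  assumes \<sigma>: "tempered \<sigma>"
    and \<kappa>: "smooth_on UNIV \<kappa>" "d > 0" "\<And>x. \<bar>x\<bar> < d \<Longrightarrow> \<kappa> x = 1" "\<And>x. \<bar>x\<bar> > 1 \<Longrightarrow> \<kappa> x = 0"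
  shows "representable k (\<lambda>\<phi>. \<sigma> (\<lambda>x. (1 - \<kappa> x) * fourier \<phi> x))"
proof -
  obtain C N where C: "C \<ge> 0" "\<And>f B. f \<in> schwartz \<Longrightarrow> \<forall>n\<le>N. \<forall>x. (1 + \<bar>x\<bar>) ^ N * norm (nderiv n f x) \<le> B \<Longrightarrow> norm (\<sigma> f) \<le> C * B"
    using tempered_bound[OF \<sigma>] by blast
  \<comment> \<open>The term N + 1 has two purposes: it gives w one power of decay more than
    \<sigma> requires, and it lets the function g of growth N serve as a weight of index N + 1
    against the derivative of order k + (N + 1).\<close>
  define n where "n = k + (N + 1)"
  have n: "n > 0" "N + 1 \<le> n" by (simp_all add: n_def)
  define w where "w x = (1 - \<kappa> x) * of_real ((1 / x) ^ n)" for x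
  note ws = smooth_on_outer_weight[OF \<kappa> n(1), folded w_def]
  have "\<exists>W. \<forall>x. norm (nderiv j w x) * (1 + \<bar>x\<bar>) ^ n \<le> W" for j
    using outer_weight_bound[OF \<kappa> n(1), folded w_def] .
  then obtain W where W: "\<And>j x. norm (nderiv j w x) * (1 + \<bar>x\<bar>) ^ n \<le> W j" by metis
  have W0: "0 \<le> W j" for j by (rule order_trans[OF _ W[of j 0]]) auto
  define V where "V = (\<Sum>j\<le>N. W j)"
  have V: "norm (nderiv j w x) * (1 + \<bar>x\<bar>) ^ (N + 1) \<le> V" if "j \<le> N" for j x
  proof -
    have "norm (nderiv j w x) * (1 + \<bar>x\<bar>) ^ (N + 1) \<le> norm (nderiv j w x) * (1 + \<bar>x\<bar>) ^ n"
      using n(2) by (intro mult_left_mono power_increasing) auto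
    also have "\<dots> \<le> W j" by (rule W)
    also have "\<dots> \<le> V" unfolding V_def using that W0 by (intro member_le_sum) auto
    finally show ?thesis .
  qed
  obtain \<mu> where \<mu>: "smooth_on UNIV \<mu>" "\<And>x. \<bar>x\<bar> \<le> 1 \<Longrightarrow> \<mu> x = 1" "\<And>x. \<bar>x\<bar> \<ge> 2 \<Longrightarrow> \<mu> x = 0"
    by (rule smooth_cutoff) blast
  \<comment> \<open>The cutoff at radius about r makes each \<open>T r\<close> a functional of
    compact support, whose transform is the continuous function \<open>g' r\<close>.\<close>
  define q where "q r x = \<mu> (1 / real (Suc r) * x + 0)" for r x
  have qs: "smooth_on UNIV (q r)" for r unfolding q_def[abs_def] by (rule smooth_on_affine[OF \<mu>(1)])
  have q1: "q r x = 1" if "\<bar>x\<bar> < 1 + real r" for r x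
    unfolding q_def using that by (intro \<mu>(2)) (simp add: abs_mult pos_divide_le_eq)
  have q0: "q r x = 0" if "\<bar>x\<bar> > 2 * (1 + real r)" for r x
    unfolding q_def using that by (intro \<mu>(3)) (simp add: abs_mult pos_le_divide_eq)
  have \<mu>t: "\<mu> \<in> test_functions UNIV" by (rule test_functionsI[OF \<mu>(1), of 2]) (simp add: \<mu>(3))
  have "\<exists>K. \<forall>x. norm (nderiv j \<mu> x) \<le> K" for j
    by (rule schwartz_bounded[OF test_functions_schwartz[OF \<mu>t]]) blast
  then obtain K where K: "\<And>j x. norm (nderiv j \<mu> x) \<le> K j" by metis
  have K0: "0 \<le> K j" for j by (rule order_trans[OF norm_ge_zero K])
  define A where "A = (\<Sum>j\<le>N. K j)"
  have A0: "0 \<le> A" unfolding A_def by (intro sum_nonneg K0)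
  have A: "norm (nderiv j (q r) x) \<le> A" if "j \<le> N" for j r x
  proof -
    have "norm (nderiv j (q r) x) = (1 / real (Suc r)) ^ j * norm (nderiv j \<mu> (1 / real (Suc r) * x + 0))"
      unfolding q_def[abs_def] nderiv_affine[OF \<mu>(1)] norm_mult norm_of_real by simp
    also have "\<dots> \<le> 1 * K j" by (intro mult_mono K power_le_one) auto
    also have "\<dots> \<le> A" unfolding A_def using that K0 by (simp add: member_le_sum)
    finally show ?thesis .
  qed
  have qw: "(\<lambda>x. q r x * w x) \<in> test_functions UNIV" for r
    by (rule test_functionsI[of _ "2 * (1 + real r)"]) (use q0 in \<open>auto intro!: smooth_on_mult qs ws\<close>)
  have qwE: "(\<lambda>x. q r x * w x * E x) \<in> schwartz" if "smooth_on UNIV E" for r E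
    using test_functions_schwartz[OF test_functions_mult[OF qw that]] by (simp add: mult.commute)
  define T where "T r E = \<sigma> (\<lambda>x. q r x * w x * E x)" for r E
  have T: "\<exists>N b. compact_functional N b (T r)" for r
    using tempered_compact_functional[OF \<sigma> qw] unfolding T_def[abs_def] .
  define g' where "g' r y = T r (\<lambda>x. e_char (- (x * y)))" for r y
  have g'c: "continuous_on UNIV (g' r)" for r
    using T[of r] compact_functional_e_char_continuous unfolding g'_def[abs_def] by blast
  have g'f: "T r (fourier f) = (LBINT y. g' r y * f y)" if "f \<in> test_functions UNIV" for r f
    using T[of r] compact_functional_fourier[OF _ that] unfolding g'_def by blast
  \<comment> \<open>The factor 2 is for differences of two cutoffs; 8^N comes from the N-th power of
    2 pi in the derivatives of the exponential.\<close>
  define D where "D = C * (4 ^ N * (2 * A * V * 8 ^ N))"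
  have V0: "0 \<le> V" unfolding V_def by (intro sum_nonneg W0)
  have D0: "0 \<le> D" using C(1) A0 V0 by (simp add: D_def)
  have eb: "norm (nderiv j (\<lambda>x. e_char (- (x * y))) x) \<le> 8 ^ N * (1 + \<bar>y\<bar>) ^ N" if "j \<le> N" for j x y
  proof -
    have "norm (nderiv j (\<lambda>x. e_char (- (x * y))) x) = (norm two_pi_i * \<bar>y\<bar>) ^ j"
      by (simp add: nderiv_e_char norm_mult norm_power power_mult_distrib)
    also have "\<dots> \<le> (8 * (1 + \<bar>y\<bar>)) ^ j"
      using norm_two_pi_i by (intro power_mono mult_mono) auto
    also have "\<dots> \<le> (8 * (1 + \<bar>y\<bar>)) ^ N" using that by (intro power_increasing) auto
    finally show ?thesis unfolding power_mult_distrib .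
  qed
  have g'b: "norm (g' r y) \<le> D * (1 + \<bar>y\<bar>) ^ N" for r y
  proof -
    have "norm (g' r y) \<le> C * (4 ^ N * (A * V * (8 ^ N * (1 + \<bar>y\<bar>) ^ N)) / (1 + 0))"
      unfolding g'_def T_def
      by (rule outer_estimate[OF C ws V qs A]) (auto intro!: eb qwE smooth_on_e_char)
    also have "\<dots> \<le> 2 * (C * (4 ^ N * (A * V * (8 ^ N * (1 + \<bar>y\<bar>) ^ N)) / (1 + 0)))"
      using C(1) A0 V0 by simp
    finally show ?thesis by (simp add: D_def mult_ac)
  qed
  \<comment> \<open>The difference of the two cutoffs vanishes for |x| < r, so
    \<open>outer_estimate\<close> gives a Cauchy rate at each fixed y.\<close>
  have g'd: "norm (g' r y - g' s y) \<le> D * (1 + \<bar>y\<bar>) ^ N / (1 + real r)" if "r \<le> s" for r s y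
  proof -
    note e = smooth_on_e_char[of y]
    have eq: "(\<lambda>x. q r x * w x * e_char (- (x * y)) - q s x * w x * e_char (- (x * y))) =
        (\<lambda>x. (q r x - q s x) * w x * e_char (- (x * y)))"
      by (simp add: left_diff_distrib)
    have "g' r y - g' s y = \<sigma> (\<lambda>x. (q r x - q s x) * w x * e_char (- (x * y)))"
      unfolding g'_def T_def eq[symmetric] by (rule tempered_diff[OF \<sigma> qwE[OF e] qwE[OF e], symmetric])
    also have "norm \<dots> \<le> C * (4 ^ N * (2 * A * V * (8 ^ N * (1 + \<bar>y\<bar>) ^ N)) / (1 + real r))"
    proof (rule outer_estimate[OF C ws V])
      show "smooth_on UNIV (\<lambda>x. q r x - q s x)" by (intro smooth_on_diff qs) auto
      show "norm (nderiv j (\<lambda>x. q r x - q s x) x) \<le> 2 * A" if "j \<le> N" for j x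
        unfolding nderiv_diff[OF open_UNIV qs qs UNIV_I]
        by (rule order_trans[OF norm_triangle_ineq4]) (use A[OF that, of r x] A[OF that, of s x] in simp)
      show "q r x - q s x = 0" if "\<bar>x\<bar> < real r" for x
        using that \<open>r \<le> s\<close> q1[of x r] q1[of x s] by simp
      show "(\<lambda>x. (q r x - q s x) * w x * e_char (- (x * y))) \<in> schwartz"
        unfolding eq[symmetric] by (rule schwartz_diff[OF qwE[OF e] qwE[OF e]])
    qed (auto intro!: eb smooth_on_e_char)
    finally show ?thesis by (simp add: D_def mult_ac)
  qed
  have "convergent (\<lambda>r. g' r y)" for y
    by (rule inverse_Suc_cauchy[OF g'd])
  then obtain g where g: "\<And>y. (\<lambda>r. g' r y) \<longlonglongrightarrow> g y" unfolding convergent_def by metis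
  have gm: "g \<in> borel_measurable borel"
    by (rule borel_measurable_LIMSEQ_metric[OF _ g]) (rule borel_measurable_continuous_onI[OF g'c])
  have gb: "norm (g y) \<le> D * (1 + \<bar>y\<bar>) ^ N" for y
    by (rule tendsto_upperbound[OF tendsto_norm[OF g]]) (auto simp: g'b)
  have key: "two_pi_i ^ n * \<sigma> (\<lambda>x. (1 - \<kappa> x) * fourier \<phi> x) = (LBINT y. g y * nderiv n \<phi> y)"
    if \<phi>: "\<phi> \<in> test_functions UNIV" for \<phi>
  proof -
    define f where "f = nderiv n \<phi>"
    have ft: "f \<in> test_functions UNIV" unfolding f_def by (rule test_functions_nderiv[OF \<phi>])
    note fs = test_functions_smooth[OF ft]
    have \<kappa>t: "\<kappa> \<in> test_functions UNIV" by (rule test_functionsI[OF \<kappa>(1,4)])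
    have out: "(\<lambda>x. (1 - \<kappa> x) * fourier \<phi> x) \<in> schwartz"
      using schwartz_diff[OF fourier_schwartz[OF \<phi>] test_functions_schwartz[OF test_functions_mult[OF \<kappa>t smooth_on_fourier[OF \<phi>]]]]
      by (simp add: algebra_simps)
    \<comment> \<open>Taking n derivatives of \<phi> multiplies its transform by (2 pi i x)^n, which
      cancels the division by x^n in w.\<close>
    have wf: "(\<lambda>x. w x * fourier f x) = (\<lambda>x. two_pi_i ^ n * ((1 - \<kappa> x) * fourier \<phi> x))"
    proof
      fix x
      have e: "of_real (x ^ n) * w x = 1 - \<kappa> x"
        using outer_weight_eq[OF \<kappa> n(1), of x] by (simp only: w_def)
      show "w x * fourier f x = two_pi_i ^ n * ((1 - \<kappa> x) * fourier \<phi> x)"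
        unfolding f_def fourier_nderiv[OF \<phi>] e[symmetric] by (simp only: mult_ac)
    qed
    have wsch: "(\<lambda>x. w x * fourier f x) \<in> schwartz" unfolding wf by (rule schwartz_cmult[OF out])
    have lim1: "(\<lambda>r. T r (fourier f)) \<longlonglongrightarrow> \<sigma> (\<lambda>x. w x * fourier f x)"
    proof -
      have "\<exists>B. \<forall>x. norm (nderiv j (fourier f) x) \<le> B" for j
        by (rule schwartz_bounded[OF fourier_schwartz[OF ft]]) blast
      then obtain B where B: "\<And>j x. norm (nderiv j (fourier f) x) \<le> B j" by metis
      have B0: "0 \<le> B j" for j by (rule order_trans[OF norm_ge_zero B])
      have B': "norm (nderiv j (fourier f) x) \<le> (\<Sum>j\<le>N. B j)" if "j \<le> N" for j x
        using order_trans[OF B[of j x] member_le_sum[of j "{..N}" B]] that B0 by simp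
      have bd: "norm (\<sigma> (\<lambda>x. w x * fourier f x) - T r (fourier f)) \<le>
          C * (4 ^ N * ((1 + A) * V * (\<Sum>j\<le>N. B j))) * (1 / (1 + real r))" for r
      proof -
        have eq: "(\<lambda>x. w x * fourier f x - q r x * w x * fourier f x) = (\<lambda>x. (1 - q r x) * w x * fourier f x)"
          by (simp add: left_diff_distrib)
        have "\<sigma> (\<lambda>x. w x * fourier f x) - T r (fourier f) = \<sigma> (\<lambda>x. (1 - q r x) * w x * fourier f x)"
          unfolding T_def eq[symmetric] by (rule tempered_diff[OF \<sigma> wsch qwE[OF smooth_on_fourier[OF ft]], symmetric])
        also have "norm \<dots> \<le> C * (4 ^ N * ((1 + A) * V * (\<Sum>j\<le>N. B j)) / (1 + real r))"
        proof (rule outer_estimate[OF C ws V])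
          note c1 = smooth_on_const[OF open_UNIV, of 1]
          show "smooth_on UNIV (\<lambda>x. 1 - q r x)" by (intro smooth_on_diff c1 qs) auto
          show "norm (nderiv j (\<lambda>x. 1 - q r x) x) \<le> 1 + A" if "j \<le> N" for j x
            unfolding nderiv_diff[OF open_UNIV c1 qs UNIV_I] nderiv_const[OF open_UNIV UNIV_I]
            by (rule order_trans[OF norm_triangle_ineq4]) (use A[OF that, of r x] in auto)
          show "1 - q r x = 0" if "\<bar>x\<bar> < real r" for x using that q1[of x r] by simp
          show "(\<lambda>x. (1 - q r x) * w x * fourier f x) \<in> schwartz"
            unfolding eq[symmetric] by (rule schwartz_diff[OF wsch qwE[OF smooth_on_fourier[OF ft]]])
        qed (auto intro!: B' smooth_on_fourier ft)
        finally show ?thesis by simp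
      qed
      have "(\<lambda>r. C * (4 ^ N * ((1 + A) * V * (\<Sum>j\<le>N. B j))) * (1 / (1 + real r))) \<longlonglongrightarrow> C * (4 ^ N * ((1 + A) * V * (\<Sum>j\<le>N. B j))) * 0"
        by (intro tendsto_mult_left LIMSEQ_Suc[OF lim_1_over_n, simplified add.commute, unfolded of_nat_Suc])
      then have "(\<lambda>r. \<sigma> (\<lambda>x. w x * fourier f x) - T r (fourier f)) \<longlonglongrightarrow> 0"
        by (intro Lim_null_comparison[OF always_eventually[OF allI[OF bd]]]) simp
      then have "(\<lambda>r. \<sigma> (\<lambda>x. w x * fourier f x) - (\<sigma> (\<lambda>x. w x * fourier f x) - T r (fourier f))) \<longlonglongrightarrow> \<sigma> (\<lambda>x. w x * fourier f x) - 0"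
        by (intro tendsto_diff tendsto_const)
      then show ?thesis by simp
    qed
    \<comment> \<open>The bound on \<open>g' r\<close> is uniform in r, and f has compact support,
      so the convergence is dominated.\<close>
    have lim2: "(\<lambda>r. LBINT y. g' r y * f y) \<longlonglongrightarrow> (LBINT y. g y * f y)"
    proof (rule integral_dominated_convergence[where w = "\<lambda>y. norm (of_real (D * (1 + \<bar>y\<bar>) ^ N) * f y)"])
      note fm = borel_measurable_continuous_onI[OF smooth_on_continuous0[OF fs]]
      show "(\<lambda>y. g y * f y) \<in> borel_measurable lborel" using gm fm by measurable
      show "(\<lambda>y. g' r y * f y) \<in> borel_measurable lborel" for r
        using borel_measurable_continuous_onI[OF g'c] fm by measurable
      obtain a where a: "\<And>n x. \<bar>x\<bar> \<ge> a \<Longrightarrow> nderiv n f x = 0" by (rule test_functions_support[OF ft]) blast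
      show "integrable lborel (\<lambda>y. norm (of_real (D * (1 + \<bar>y\<bar>) ^ N) * f y))"
        by (intro integrable_norm integrable_compact_support[where a = a] continuous_intros smooth_on_continuous0[OF fs])
          (use a[of _ 0] in auto)
      show "AE y in lborel. (\<lambda>r. g' r y * f y) \<longlonglongrightarrow> g y * f y"
        by (intro AE_I2 tendsto_mult_right g)
      show "AE y in lborel. norm (g' r y * f y) \<le> norm (of_real (D * (1 + \<bar>y\<bar>) ^ N) * f y)" for r
        unfolding norm_mult norm_of_real
        by (intro AE_I2 mult_right_mono order_trans[OF g'b]) auto
    qed
    have "\<sigma> (\<lambda>x. w x * fourier f x) = (LBINT y. g y * f y)"
      using lim1 lim2 unfolding g'f[OF ft] by (rule LIMSEQ_unique)
    then show ?thesis unfolding wf tempered_cmult[OF \<sigma> out] by (simp add: f_def)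
  qed
  have "representable k (\<lambda>\<phi>. (1 / two_pi_i ^ n) * (LBINT y. g y * nderiv (k + (N + 1)) \<phi> y))"
  proof (rule representable_cmult[OF representable_term[OF gm]])
    fix y
    show "norm (g y) \<le> D * (1 + \<bar>y\<bar>) ^ (N + 1)"
      by (rule order_trans[OF gb]) (intro mult_left_mono power_increasing D0, auto)
  qed
  then show ?thesis
    by (rule representable_cong) (simp only: n_def[symmetric] key[symmetric], simp add: two_pi_i_nonzero)
qed

text \<open>The transform of \<phi> has no compact support, so the local description of \<sigma>
  applies only after multiplication by \<kappa>, which is supported in U; the complementary part
  uses temperedness alone.\<close>

lemma representable_fourier_dist:
  assumes \<sigma>: "tempered \<sigma>" and vanish: "dist_vanishes_to_order 0 k \<sigma>"
  shows "representable k (fourier_dist \<sigma>)"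
proof -
  obtain U N f D h where U: "open U" "0 \<in> U"
    and *: "\<forall>j\<in>{1..N::nat}. Linf_loc U (h j) \<and> diff_op_on U (D j) \<and> tangential U 0 (D j) \<and>
           smooth_on U (f j) \<and> fun_vanishes_to_order U 0 k (f j)"
    and S: "agree_on U \<sigma> (\<lambda>\<phi>. \<Sum>j=1..N. dist_mult (f j) (dist_op (D j) (dist_of_fun U (h j))) \<phi>)"
    using vanish unfolding dist_vanishes_to_order_def by (elim exE conjE) (rule that)
  obtain e0 where e0: "e0 > 0" "cball 0 e0 \<subseteq> U" using U open_contains_cball by blast
  \<comment> \<open>The bound e \<le> 1 ensures that \<kappa> vanishes for |x| > 1, as
    \<open>representable_outer\<close> demands.\<close>
  define e where "e = min e0 1"
  have "{-e..e} \<subseteq> cball 0 e0" by (auto simp: e_def)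
  then have e: "0 < e" "e \<le> 1" "{-e..e} \<subseteq> U" using e0 by (auto simp: e_def)
  obtain \<mu> where \<mu>: "smooth_on UNIV \<mu>" "\<And>x. \<bar>x\<bar> \<le> 1 \<Longrightarrow> \<mu> x = 1" "\<And>x. \<bar>x\<bar> \<ge> 2 \<Longrightarrow> \<mu> x = 0"
    by (rule smooth_cutoff) blast
  \<comment> \<open>The scale 2/e makes \<kappa> equal to 1 for |x| \<le> e/2 and 0 for |x| \<ge>
    e.\<close>
  define \<kappa> where "\<kappa> x = \<mu> (2 / e * x + 0)" for x
  have \<kappa>s: "smooth_on UNIV \<kappa>" unfolding \<kappa>_def[abs_def] by (rule smooth_on_affine[OF \<mu>(1)])
  have \<kappa>1: "\<kappa> x = 1" if "\<bar>x\<bar> < e / 2" for x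
    unfolding \<kappa>_def using that e(1) by (intro \<mu>(2)) (simp add: abs_mult field_simps)
  have \<kappa>0: "\<kappa> x = 0" if "\<bar>x\<bar> > e" for x
    unfolding \<kappa>_def using that e(1) by (intro \<mu>(3)) (simp add: abs_mult field_simps)
  have inner: "(\<lambda>x. \<kappa> x * fourier \<phi> x) \<in> test_functions U" if "\<phi> \<in> test_functions UNIV" for \<phi>
    unfolding test_functions_def
    by (intro CollectI conjI smooth_on_mult \<kappa>s smooth_on_fourier that open_UNIV exI[of _ "{-e..e}"])
      (use e \<kappa>0 in \<open>auto simp: abs_if\<close>)
  have "representable k (\<lambda>\<phi>. \<Sum>j=1..N. dist_mult (f j) (dist_op (D j) (dist_of_fun U (h j))) (\<lambda>x. \<kappa> x * fourier \<phi> x))"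
    by (intro representable_sum finite_atLeastAtMost representable_local[OF U e(3) \<kappa>s \<kappa>0]) (use * in auto)
  moreover have "representable k (\<lambda>\<phi>. \<sigma> (\<lambda>x. (1 - \<kappa> x) * fourier \<phi> x))"
    by (rule representable_outer[where d = "e / 2", OF \<sigma> \<kappa>s _ \<kappa>1]) (use e \<kappa>0 in auto)
  ultimately have "representable k (\<lambda>\<phi>. (\<Sum>j=1..N. dist_mult (f j) (dist_op (D j) (dist_of_fun U (h j))) (\<lambda>x. \<kappa> x * fourier \<phi> x))
      + \<sigma> (\<lambda>x. (1 - \<kappa> x) * fourier \<phi> x))"
    by (rule representable_add)
  then show ?thesis
  proof (rule representable_cong)
    fix \<phi> :: "real \<Rightarrow> complex" assume \<phi>: "\<phi> \<in> test_functions UNIV"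
    have i: "(\<lambda>x. \<kappa> x * fourier \<phi> x) \<in> schwartz"
      using inner[OF \<phi>] test_functions_mono[of U UNIV] by (intro test_functions_schwartz) auto
    have "\<sigma> (\<lambda>x. (1 - \<kappa> x) * fourier \<phi> x) = \<sigma> (fourier \<phi>) - \<sigma> (\<lambda>x. \<kappa> x * fourier \<phi> x)"
      using tempered_diff[OF \<sigma> fourier_schwartz[OF \<phi>] i] by (simp add: left_diff_distrib)
    moreover have "\<sigma> (\<lambda>x. \<kappa> x * fourier \<phi> x) = (\<Sum>j=1..N. dist_mult (f j) (dist_op (D j) (dist_of_fun U (h j))) (\<lambda>x. \<kappa> x * fourier \<phi> x))"
      using S inner[OF \<phi>] by (simp add: agree_on_def)
    ultimately show "fourier_dist \<sigma> \<phi> = (\<Sum>j=1..N. dist_mult (f j) (dist_op (D j) (dist_of_fun U (h j))) (\<lambda>x. \<kappa> x * fourier \<phi> x))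
      + \<sigma> (\<lambda>x. (1 - \<kappa> x) * fourier \<phi> x)"
      by (simp add: fourier_dist_def)
  qed
qed

theorem theorem3p19:
  fixes \<sigma> :: "(real \<Rightarrow> complex) \<Rightarrow> complex"
  assumes "tempered \<sigma>"
  shows "(\<forall>k. dist_vanishes_to_order 0 k \<sigma> \<longrightarrow>
            (\<exists>T. rp1_extends T (fourier_dist \<sigma>) \<and> vanishes_to_order_at_infinity k T)) \<and>
         ((\<forall>k. dist_vanishes_to_order 0 k \<sigma>) \<longrightarrow>
            has_canonical_extension_across_infinity (fourier_dist \<sigma>))"
  using representable_imp_extension representable_imp_canonical_extension
    representable_fourier_dist[OF assms] by blast

end
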